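(* Let $\omega$ be a subadditive weight function and let $L=\frac{\partial}{\partial t}+\sum_{j=1}^{N}(a_j+ib_j)(t)\frac{\partial}{\partial x_j}$ on $\mathbb{T}^{N+1}$, with $a_j,b_j$ real-valued functions in $\mathcal{E}_{\{\omega\}}(\mathbb{T}^1)$. The following are equivalent: \begin{itemize} \item $L$ is strongly $\{\omega\}$-solvable; \item $L$ is globally $\{\omega\}$-hypoelliptic; \item (1) the functions $b_j$ do not change sign; (2) $\dim\mathrm{span}\{b_1,\dots,b_N\}\le1$; (3) the pair $(\alpha_0,\beta_0)$ satisfies $(EDC)_1^{\{\omega\}}$. \end{itemize}
   Context: $\mathbb{T}^n=(\mathbb{R}/2\pi\mathbb{Z})^n$; coordinates on $\mathbb{T}^{N+1}$ are $(t,x)$. A weight function is an increasing continuous $\omega:[0,\infty)\to[0,\infty)$ such that: there is $K\ge0$ with $\omega(2t)\le K(\omega(t)+1)$; $\omega(t)=O(t)$; $\log t=o(\omega(t))$ as $t\to\infty$; $\varphi(t)=\omega(e^t)$ convex (one may assume $\omega=0$ on $[0,1]$). Subadditive: $\omega(s+t)\le\omega(s)+\omega(t)$. $\varphi^*(t)=\sup_{s\ge0}\{st-\varphi(s)\}$. $\|f\|_\lambda=\sup_{x}\sup_{\alpha}|\partial^\alpha f(x)|\exp(-\lambda\varphi^*(|\alpha|/\lambda))$; $\mathcal{E}_{\{\omega\}}(\mathbb{T}^n)=\{f\in C^\infty(\mathbb{T}^n):\|f\|_\lambda<\infty$ for some $\lambda>0\}$ with the inductive limit topology of the Banach spaces $\{f:\|f\|_{1/k}<\infty\}$,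 $k\in\mathbb{N}$; $\mathcal{E}'_{\{\omega\}}$ is its strong dual. ${}^tL$ denotes the transpose of $L$ acting on $\mathcal{E}'_{\{\omega\}}(\mathbb{T}^{N+1})$ (${}^tL=-L$). $L$ is strongly $\{\omega\}$-solvable if $L\mathcal{E}_{\{\omega\}}(\mathbb{T}^{N+1})$ is closed in $\mathcal{E}_{\{\omega\}}(\mathbb{T}^{N+1})$ and $\ker{}^tL\subset\mathcal{E}'_{\{\omega\}}(\mathbb{T}^{N+1})$ is finite dimensional. $L$ is globally $\{\omega\}$-hypoelliptic if $\mu\in\mathcal{E}'_{\{\omega\}}(\mathbb{T}^{N+1})$ and $L\mu\in\mathcal{E}_{\{\omega\}}(\mathbb{T}^{N+1})$ imply $\mu\in\mathcal{E}_{\{\omega\}}(\mathbb{T}^{N+1})$. $\alpha_0=(a_{10},\dots,a_{N0})$, $\beta_0=(b_{10},\dots,b_{N0})$ with $a_{j0},b_{j0}$ the means of $a_j,b_j$ over $[0,2\pi]$. $(\alpha,\beta)\in\mathbb{R}^N\times\mathbb{R}^N$ satisfies $(EDC)_1^{\{\omega\}}$ if for every $\epsilon>0$ there is $C_\epsilon>0$ with $|\tau+\langle\xi,\alpha+i\beta\rangle|\ge C_\epsilon e^{-\epsilon\omega(|(\tau,\xi)|)}$ for all $(\tau,\xi)\in\mathbb{Z}^{N+1}\setminus\{0\}$. A real function changes sign if it takes both strictly positive and strictly negative values. *)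

theory Defs
  imports "HOL-Analysis.Analysis" "HOL-Library.Landau_Symbols"
begin

definition weight_function :: "(real \<Rightarrow> real) \<Rightarrow> bool" where
  "weight_function \<omega> \<longleftrightarrow>
     continuous_on {0..} \<omega> \<and> mono_on {0..} \<omega> \<and> (\<forall>t\<ge>0. \<omega> t \<ge> 0) \<and>
     (\<exists>K\<ge>0. \<forall>t\<ge>0. \<omega> (2 * t) \<le> K * (\<omega> t + 1)) \<and>
     \<omega> \<in> O[at_top](\<lambda>t. t) \<and>
     ln \<in> o[at_top](\<omega>) \<and>
     convex_on UNIV (\<lambda>t. \<omega> (exp t))"

definition subadditive_weight :: "(real \<Rightarrow> real) \<Rightarrow> bool" where
  "subadditive_weight \<omega> \<longleftrightarrow> (\<forall>s\<ge>0. \<forall>t\<ge>0. \<omega> (s + t) \<le> \<omega> s + \<omega> t)"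

definition phi_star :: "(real \<Rightarrow> real) \<Rightarrow> real \<Rightarrow> real" where
  "phi_star \<omega> t = (SUP s\<in>{0..}. s * t - \<omega> (exp s))"

text \<open>Functions on \<open>T^m\<close> are modelled as \<open>2\<pi>\<close>-periodic functions on \<open>real^'m\<close>.\<close>

definition periodic_torus :: "(real^'m \<Rightarrow> complex) \<Rightarrow> bool" where
  "periodic_torus f \<longleftrightarrow> (\<forall>i x. f (x + (2 * pi) *\<^sub>R axis i 1) = f x)"

definition pd :: "'m \<Rightarrow> (real^'m \<Rightarrow> complex) \<Rightarrow> real^'m \<Rightarrow> complex" where
  "pd i f x = vector_derivative (\<lambda>s. f (x + s *\<^sub>R axis i 1)) (at 0)"

fun iter_pd :: "'m list \<Rightarrow> (real^'m \<Rightarrow> complex) \<Rightarrow> real^'m \<Rightarrow> complex" where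
  "iter_pd [] f = f"
| "iter_pd (i # is) f = pd i (iter_pd is f)"

definition smooth_fun :: "(real^'m \<Rightarrow> complex) \<Rightarrow> bool" where
  "smooth_fun f \<longleftrightarrow>
     (\<forall>is. continuous_on UNIV (iter_pd is f) \<and>
        (\<forall>i x. (\<lambda>s. iter_pd is f (x + s *\<^sub>R axis i 1)) differentiable (at 0)))"

definition weighted_vals :: "(real \<Rightarrow> real) \<Rightarrow> real \<Rightarrow> (real^'m \<Rightarrow> complex) \<Rightarrow> real set" where
  "weighted_vals \<omega> lam f =
     {cmod (iter_pd is f x) * exp (- lam * phi_star \<omega> (real (length is) / lam)) | x is. True}"

definition rnorm :: "(real \<Rightarrow> real) \<Rightarrow> real \<Rightarrow> (real^'m \<Rightarrow> complex) \<Rightarrow> real" where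
  "rnorm \<omega> lam f = Sup (weighted_vals \<omega> lam f)"

definition E_step :: "(real \<Rightarrow> real) \<Rightarrow> real \<Rightarrow> (real^'m \<Rightarrow> complex) set" where
  "E_step \<omega> lam = {f. smooth_fun f \<and> periodic_torus f \<and> bdd_above (weighted_vals \<omega> lam f)}"

definition E_roumieu :: "(real \<Rightarrow> real) \<Rightarrow> (real^'m \<Rightarrow> complex) set" where
  "E_roumieu \<omega> = {f. \<exists>lam>0. f \<in> E_step \<omega> lam}"

text \<open>Zero-neighbourhoods of the locally convex inductive limit topology of the
  Banach spaces \<open>E_step \<omega> (1/k)\<close>, \<open>k \<ge> 1\<close>: absolutely convex sets whose trace on every step
  is a zero-neighbourhood of that step.\<close>
definition lb_zero_nbhd :: "(real \<Rightarrow> real) \<Rightarrow> (real^'m \<Rightarrow> complex) set \<Rightarrow> bool" where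
  "lb_zero_nbhd \<omega> U \<longleftrightarrow>
     U \<subseteq> E_roumieu \<omega> \<and>
     (\<forall>f\<in>U. \<forall>g\<in>U. \<forall>a b :: complex. cmod a + cmod b \<le> 1 \<longrightarrow> (\<lambda>x. a * f x + b * g x) \<in> U) \<and>
     (\<forall>k::nat. k \<ge> 1 \<longrightarrow> (\<exists>r>0. \<forall>f \<in> E_step \<omega> (1 / real k). rnorm \<omega> (1 / real k) f < r \<longrightarrow> f \<in> U))"

definition lb_open :: "(real \<Rightarrow> real) \<Rightarrow> (real^'m \<Rightarrow> complex) set \<Rightarrow> bool" where
  "lb_open \<omega> V \<longleftrightarrow> V \<subseteq> E_roumieu \<omega> \<and>
     (\<forall>f\<in>V. \<exists>U. lb_zero_nbhd \<omega> U \<and> (\<lambda>g. (\<lambda>x. f x + g x)) ` U \<subseteq> V)"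

definition lb_closed :: "(real \<Rightarrow> real) \<Rightarrow> (real^'m \<Rightarrow> complex) set \<Rightarrow> bool" where
  "lb_closed \<omega> A \<longleftrightarrow> A \<subseteq> E_roumieu \<omega> \<and> lb_open \<omega> (E_roumieu \<omega> - A)"

text \<open>Continuous linear functionals on the inductive limit; a functional is represented by
  a function that vanishes outside \<open>E_roumieu \<omega>\<close> (canonical representative).\<close>
definition E_dual :: "(real \<Rightarrow> real) \<Rightarrow> ((real^'m \<Rightarrow> complex) \<Rightarrow> complex) set" where
  "E_dual \<omega> = {\<mu>.
     (\<forall>f\<in>E_roumieu \<omega>. \<forall>g\<in>E_roumieu \<omega>. \<mu> (\<lambda>x. f x + g x) = \<mu> f + \<mu> g) \<and>
     (\<forall>f\<in>E_roumieu \<omega>. \<forall>c. \<mu> (\<lambda>x. c * f x) = c * \<mu> f) \<and>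
     (\<forall>f. f \<notin> E_roumieu \<omega> \<longrightarrow> \<mu> f = 0) \<and>
     (\<forall>k::nat. k \<ge> 1 \<longrightarrow> (\<exists>C. \<forall>f \<in> E_step \<omega> (1 / real k). cmod (\<mu> f) \<le> C * rnorm \<omega> (1 / real k) f))}"

definition fin_dim_span :: "(('a \<Rightarrow> complex) \<Rightarrow> complex) set \<Rightarrow> bool" where
  "fin_dim_span S \<longleftrightarrow> (\<exists>B. finite B \<and> B \<subseteq> S \<and>
      (\<forall>\<mu>\<in>S. \<exists>c. \<mu> = (\<lambda>f. \<Sum>\<nu>\<in>B. c \<nu> * \<nu> f)))"

definition torus_integral :: "(real^'m \<Rightarrow> complex) \<Rightarrow> complex" where
  "torus_integral f = integral (cbox 0 (\<chi> i. 2 * pi)) f"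

text \<open>Coordinates on \<open>T^{N+1}\<close>: index \<open>None\<close> is \<open>t\<close>, index \<open>Some j\<close> is \<open>x_j\<close>.\<close>
definition Lop :: "('n::finite \<Rightarrow> real \<Rightarrow> real) \<Rightarrow> ('n \<Rightarrow> real \<Rightarrow> real) \<Rightarrow>
    (real^('n option) \<Rightarrow> complex) \<Rightarrow> real^('n option) \<Rightarrow> complex" where
  "Lop a b f v = pd None f v +
     (\<Sum>j\<in>UNIV. (complex_of_real (a j (v $ None)) + \<i> * complex_of_real (b j (v $ None))) * pd (Some j) f v)"

definition ker_transpose :: "(real \<Rightarrow> real) \<Rightarrow> ('n::finite \<Rightarrow> real \<Rightarrow> real) \<Rightarrow> ('n \<Rightarrow> real \<Rightarrow> real) \<Rightarrow>
    ((real^('n option) \<Rightarrow> complex) \<Rightarrow> complex) set" where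
  "ker_transpose \<omega> a b = {\<mu> \<in> E_dual \<omega>. \<forall>\<phi>\<in>E_roumieu \<omega>. \<mu> (Lop a b \<phi>) = 0}"

definition strongly_solvable :: "(real \<Rightarrow> real) \<Rightarrow> ('n::finite \<Rightarrow> real \<Rightarrow> real) \<Rightarrow> ('n \<Rightarrow> real \<Rightarrow> real) \<Rightarrow> bool" where
  "strongly_solvable \<omega> a b \<longleftrightarrow>
     lb_closed \<omega> (Lop a b ` E_roumieu \<omega>) \<and> fin_dim_span (ker_transpose \<omega> a b)"

text \<open>\<open>L\<mu>\<close> is defined by \<open>(L\<mu>)(\<phi>) = \<mu>(\<^sup>tL \<phi>) = \<mu>(-L\<phi>)\<close>; a functional "is" a function \<open>g\<close>
  if it equals \<open>\<phi> \<mapsto> \<integral> g \<phi>\<close> on \<open>E_roumieu \<omega>\<close>.\<close>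
definition globally_hypoelliptic :: "(real \<Rightarrow> real) \<Rightarrow> ('n::finite \<Rightarrow> real \<Rightarrow> real) \<Rightarrow> ('n \<Rightarrow> real \<Rightarrow> real) \<Rightarrow> bool" where
  "globally_hypoelliptic \<omega> a b \<longleftrightarrow>
     (\<forall>\<mu>\<in>E_dual \<omega>.
        (\<exists>g\<in>E_roumieu \<omega>. \<forall>\<phi>\<in>E_roumieu \<omega>.
            \<mu> (\<lambda>v. - Lop a b \<phi> v) = torus_integral (\<lambda>v. g v * \<phi> v)) \<longrightarrow>
        (\<exists>h\<in>E_roumieu \<omega>. \<forall>\<phi>\<in>E_roumieu \<omega>. \<mu> \<phi> = torus_integral (\<lambda>v. h v * \<phi> v)))"

definition changes_sign :: "(real \<Rightarrow> real) \<Rightarrow> bool" where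
  "changes_sign f \<longleftrightarrow> (\<exists>t. f t > 0) \<and> (\<exists>s. f s < 0)"

definition mean_T1 :: "(real \<Rightarrow> real) \<Rightarrow> real" where
  "mean_T1 f = integral {0..2 * pi} f / (2 * pi)"

definition EDC1 :: "(real \<Rightarrow> real) \<Rightarrow> ('n::finite \<Rightarrow> real) \<Rightarrow> ('n \<Rightarrow> real) \<Rightarrow> bool" where
  "EDC1 \<omega> \<alpha> \<beta> \<longleftrightarrow>
     (\<forall>\<epsilon>>0. \<exists>C>0. \<forall>(\<tau>::int) (\<xi>::'n \<Rightarrow> int). (\<tau> \<noteq> 0 \<or> (\<exists>j. \<xi> j \<noteq> 0)) \<longrightarrow>
        cmod (of_int \<tau> + (\<Sum>j\<in>UNIV. of_int (\<xi> j) * (complex_of_real (\<alpha> j) + \<i> * complex_of_real (\<beta> j))))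
          \<ge> C * exp (- \<epsilon> * \<omega> (sqrt (real_of_int \<tau> ^ 2 + (\<Sum>j\<in>UNIV. real_of_int (\<xi> j) ^ 2)))))"

definition lift_T1 :: "(real \<Rightarrow> real) \<Rightarrow> real^1 \<Rightarrow> complex" where
  "lift_T1 f v = complex_of_real (f (v $ 1))"

end

(*
  Everything is read off Fourier coefficients.  By convexity of t \<mapsto> \<omega>(exp t), a function lies in
  E_roumieu iff its coefficients are O(exp(-\<delta> \<omega>(|k|))) for some \<delta> > 0 (Paley-Wiener), and a
  sequence of growth O(exp(\<epsilon> \<omega>(|k|))) for every \<epsilon> > 0 defines an element of the dual.  On the
  slice of frequency \<xi> in x the operator becomes the periodic ODE u' + i p_\<xi> u = f with
  p_\<xi> = <\<xi>, a + i b>.  Where |\<tau>| dominates |\<xi>| the equation is elliptic, so decay in (\<tau>, \<xi>)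
  follows from bounds on sup |u| that decay in \<xi>.

  Sufficiency: if <\<xi>, b> never changes sign, the explicit periodic solution is bounded by
  sup |f| / |1 - exp(\<plusminus> 2 \<pi> i <\<xi>, \<alpha>_0 + i \<beta>_0>)|, and (EDC) controls the denominator; so L maps
  E_roumieu onto its subspace of mean zero, whence solvability and hypoellipticity.

  Necessity: if a condition fails there are infinitely many \<xi> with approximate solutions u_\<xi> of
  sup norm about 1 and L u_\<xi> exponentially small.  Glued together they form a non-smooth \<mu> with
  L \<mu> smooth; if the range of L were closed, then L \<mu> = L v for some v in E_roumieu, and each slice of
  v - \<mu> would be a separate element of the kernel of the transpose.  Without (EDC), u_\<xi> is a
  normalised solution of L u = i \<eta> u with \<eta> small; if <\<xi>, b> changes sign for some integer \<xi>,
  the right-hand sides concentrate at the maximal oscillation of the primitive of <\<xi>, b>, along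
  multiples of \<xi>.
*)
theory Submission
  imports Defs
begin

section \<open>Fourier series on the torus\<close>

text \<open>The quantifiers of the Roumieu class fix the shape of all constants: decay means some
  rate \<delta>, growth in the dual means every \<epsilon>. Each step may therefore give away a
  fraction of its rate, and (EDC), available for every \<epsilon>, can be charged to the rate of the
  data. Subadditivity is what makes coefficients depending on t bearable: multiplication by them is
  convolution in \<tau>, and \<omega>(|k|) \<le> \<omega>(|k - \<sigma>|) + \<omega>(|\<sigma>|)
  lets weighted bounds pass through it. It is given constant modulus instead, and the localisation
  is left to the integrating factor. Its phase has to cancel n Re P, P a primitive of p, which is
  periodic only up to n times the mean; n is restricted to values for which n times the mean is
  within 1/8 of an integer. That case is treated with (EDC) in force: it makes the periodic
  solutions exist and bounds their growth, so that the glued family belongs to the dual.\<close>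

definition ee :: "('m::finite \<Rightarrow> int) \<Rightarrow> real^'m \<Rightarrow> complex" where
  "ee k x = cis (\<Sum>i\<in>UNIV. of_int (k i) * x $ i)"

definition fc :: "(real^'m::finite \<Rightarrow> complex) \<Rightarrow> ('m \<Rightarrow> int) \<Rightarrow> complex" where
  "fc f k = torus_integral (\<lambda>x. f x * ee (\<lambda>i. - k i) x) / of_real ((2 * pi) ^ CARD('m))"

definition Ffun :: "(('m::finite \<Rightarrow> int) \<Rightarrow> complex) \<Rightarrow> real^'m \<Rightarrow> complex" where
  "Ffun c x = (\<Sum>\<^sub>\<infinity>k. c k * ee k x)"

lemma norm_ee [simp]: "norm (ee k x) = 1"
  by (simp add: ee_def)

lemma continuous_on_ee [continuous_intros]: "continuous_on S (ee k)"
  unfolding ee_def by (intro continuous_intros)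

lemma ee_shift: "ee k (x + s *\<^sub>R axis i 1) = ee k x * cis (of_int (k i) * s)"
proof -
  have "(\<Sum>j\<in>UNIV. of_int (k j) * (x + s *\<^sub>R axis i 1) $ j)
      = (\<Sum>j\<in>UNIV. of_int (k j) * x $ j) + (\<Sum>j\<in>UNIV. if j = i then of_int (k i) * s else 0)"
    unfolding sum.distrib [symmetric] by (rule sum.cong) (auto simp: axis_def algebra_simps)
  then show ?thesis by (simp add: ee_def cis_mult)
qed

lemma periodic_ee: "periodic_torus (ee k)"
proof -
  have "cis (of_int (k i) * (2 * pi)) = 1" for i
    using cis_multiple_2pi[of "of_int (k i)"] by (simp add: mult.commute)
  then show ?thesis by (simp add: periodic_torus_def ee_shift)
qed

lemma ee_mult: "ee k x * ee l x = ee (\<lambda>i. k i + l i) x"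
  by (simp add: ee_def cis_mult sum.distrib algebra_simps)

lemma ee_zero [simp]: "ee (\<lambda>_. 0) x = 1"
  by (simp add: ee_def)

text \<open>The translated cube sticks out beyond the face x_i = 2 pi by a slab of width s; moving
  this slab back by one period refills the part of the original cube below x_i = s. The bounds on s
  keep this to a single cut.\<close>

lemma torus_integral_shift:
  fixes f :: "real^'m::finite \<Rightarrow> complex"
  assumes cont: "continuous_on UNIV f" and per: "periodic_torus f" and s: "0 \<le> s" "s \<le> 2 * pi"
  shows "torus_integral (\<lambda>x. f (x + s *\<^sub>R axis i 1)) = torus_integral f"
proof -
  let ?e = "axis i 1 :: real^'m"
  let ?b = "(\<chi> j. 2 * pi) :: real^'m"
  have int: "f integrable_on cbox u v" for u v
    by (intro integrable_continuous continuous_on_subset[OF cont]) auto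
  have B: "?e \<in> Basis" by (simp add: axis_in_Basis_iff)
  have ax: "(r *\<^sub>R ?e) $ j = (if j = i then r else 0)" for r j by (simp add: axis_def)
  have ip: "x \<bullet> ?e = x $ i" for x by (simp add: inner_axis)
  have mem: "x \<in> cbox u v \<longleftrightarrow> (u $ i \<le> x $ i \<and> x $ i \<le> v $ i) \<and> (\<forall>j. j \<noteq> i \<longrightarrow> u $ j \<le> x $ j \<and> x $ j \<le> v $ j)"
    for u v x :: "real^'m" by (auto simp: mem_box_cart)
  have s1: "cbox (s *\<^sub>R ?e) (?b + s *\<^sub>R ?e) \<inter> {x. x \<bullet> ?e \<le> 2 * pi} = cbox (s *\<^sub>R ?e) ?b"
    using s by (intro set_eqI, unfold Int_iff mem_Collect_eq mem ip) (auto simp: axis_def)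
  have s2: "cbox (s *\<^sub>R ?e) (?b + s *\<^sub>R ?e) \<inter> {x. x \<bullet> ?e \<ge> 2 * pi}
      = cbox ((2 * pi) *\<^sub>R ?e) (?b + s *\<^sub>R ?e)"
    using s by (intro set_eqI, unfold Int_iff mem_Collect_eq mem ip) (auto simp: axis_def)
  have s3: "cbox 0 ?b \<inter> {x. x \<bullet> ?e \<le> s} = cbox 0 (?b + (s - 2 * pi) *\<^sub>R ?e)"
    using s by (intro set_eqI, unfold Int_iff mem_Collect_eq mem ip) (auto simp: axis_def)
  have s4: "cbox 0 ?b \<inter> {x. x \<bullet> ?e \<ge> s} = cbox (s *\<^sub>R ?e) ?b"
    using s by (intro set_eqI, unfold Int_iff mem_Collect_eq mem ip) (auto simp: axis_def)
  have "integral (cbox 0 ?b) (\<lambda>x. f (x + s *\<^sub>R ?e)) = integral (cbox (s *\<^sub>R ?e) (?b + s *\<^sub>R ?e)) f"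
    using integral_shift_cbox[of "s *\<^sub>R ?e" "s *\<^sub>R ?e" "?b + s *\<^sub>R ?e" f] by simp
  also have "\<dots> = integral (cbox (s *\<^sub>R ?e) ?b) f + integral (cbox ((2 * pi) *\<^sub>R ?e) (?b + s *\<^sub>R ?e)) f"
    using integral_split[OF int B, of "s *\<^sub>R ?e" "?b + s *\<^sub>R ?e" "2 * pi"] by (simp add: s1 s2)
  also have "integral (cbox ((2 * pi) *\<^sub>R ?e) (?b + s *\<^sub>R ?e)) f
      = integral (cbox 0 (?b + (s - 2 * pi) *\<^sub>R ?e)) (\<lambda>x. f (x + (2 * pi) *\<^sub>R ?e))"
    using integral_shift_cbox[of "(2 * pi) *\<^sub>R ?e" "(2 * pi) *\<^sub>R ?e" "?b + s *\<^sub>R ?e" f]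
    by (simp add: algebra_simps)
  also have "(\<lambda>x. f (x + (2 * pi) *\<^sub>R ?e)) = f"
    using per by (simp add: periodic_torus_def fun_eq_iff)
  also have "integral (cbox (s *\<^sub>R ?e) ?b) f + integral (cbox 0 (?b + (s - 2 * pi) *\<^sub>R ?e)) f
      = integral (cbox 0 ?b) f"
    using integral_split[OF int B, of 0 ?b s] by (simp add: s3 s4)
  finally show ?thesis by (simp add: torus_integral_def)
qed

lemma integrable_torus:
  fixes f :: "real^'m::finite \<Rightarrow> complex"
  shows "continuous_on UNIV f \<Longrightarrow> f integrable_on cbox 0 (\<chi> i. 2 * pi)"
  by (rule integrable_continuous) (rule continuous_on_subset, auto)

lemma content_torus: "measure lborel (cbox 0 (\<chi> i. 2 * pi) :: (real^'m::finite) set) = (2 * pi) ^ CARD('m)"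
  by (subst content_cbox_cart) (auto simp: interval_eq_empty_cart not_less)

lemma torus_integral_const: "torus_integral (\<lambda>x::real^'m::finite. c) = c * of_real ((2 * pi) ^ CARD('m))"
  by (simp add: torus_integral_def content_torus scaleR_conv_of_real)

text \<open>Translation by half a wavelength in a direction with k_i \<noteq> 0 flips the sign of
  the character but preserves the integral, which therefore equals its own negative.\<close>

lemma torus_integral_ee:
  fixes k :: "'m::finite \<Rightarrow> int"
  shows "torus_integral (ee k) = (if k = (\<lambda>_. 0) then of_real ((2 * pi) ^ CARD('m)) else 0)"
proof (cases "k = (\<lambda>_. 0)")
  case True
  then show ?thesis using torus_integral_const[of 1, where 'm='m]
    by (simp add: ee_zero [abs_def])
next
  case False
  then obtain i where i: "k i \<noteq> 0" by auto
  define s where "s = pi / \<bar>of_int (k i)\<bar>"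
  have ge1: "\<bar>of_int (k i) :: real\<bar> \<ge> 1" using i by (simp flip: of_int_abs)
  have "s \<le> pi / 1" unfolding s_def using ge1 by (intro divide_left_mono) auto
  then have s: "0 \<le> s" "s \<le> 2 * pi" using pi_gt_zero by (auto simp: s_def intro: order_trans)
  have "of_int (k i) * s = pi \<or> of_int (k i) * s = - pi"
    using i by (cases "k i > 0") (auto simp: s_def)
  then have c: "cis (of_int (k i) * s) = -1" by (auto simp flip: cis_cnj)
  have "torus_integral (ee k) = torus_integral (\<lambda>x. ee k x * (-1))"
    using torus_integral_shift[OF continuous_on_ee periodic_ee s, of k i] by (simp add: ee_shift c)
  also have "\<dots> = - torus_integral (ee k)"
    by (simp add: torus_integral_def)
  finally show ?thesis using False by simp
qed

lemma norm_increment_le: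
  fixes F :: "real \<Rightarrow> complex"
  assumes "a \<le> b" "0 \<le> B"
    and "\<And>s. a \<le> s \<Longrightarrow> s \<le> b \<Longrightarrow> (F has_vector_derivative F' s) (at s within {a..b})"
    and "\<And>s. a \<le> s \<Longrightarrow> s \<le> b \<Longrightarrow> norm (F' s) \<le> B"
  shows "norm (F b - F a) \<le> B * (b - a)"
proof -
  have "(F' has_integral (F b - F a)) {a..b}"
    using assms by (intro fundamental_theorem_of_calculus) auto
  then show ?thesis
    using has_integral_bound[of B F' "F b - F a" a b] assms by simp
qed

lemma has_vector_derivative_at_0_iff:
  fixes F :: "real \<Rightarrow> complex"
  shows "(F has_vector_derivative D) (at 0) \<longleftrightarrow> ((\<lambda>h. (F h - F 0) /\<^sub>R h) \<longlongrightarrow> D) (at 0)"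
proof -
  have "norm (F h - F 0 - h *\<^sub>R D) / norm h = norm ((F h - F 0) /\<^sub>R h - D)" if "h \<noteq> 0" for h
  proof -
    have "F h - F 0 - h *\<^sub>R D = h *\<^sub>R ((F h - F 0) /\<^sub>R h - D)"
      using that by (simp add: algebra_simps)
    then show ?thesis using that by simp
  qed
  then have "((\<lambda>h. norm (F h - F 0 - h *\<^sub>R D) / norm h) \<longlongrightarrow> 0) (at 0)
      \<longleftrightarrow> ((\<lambda>h. norm ((F h - F 0) /\<^sub>R h - D)) \<longlongrightarrow> 0) (at 0)"
    by (intro filterlim_cong) (auto simp: eventually_at_filter)
  then show ?thesis
    by (simp add: has_vector_derivative_def has_derivative_at bounded_linear_scaleR_left
        tendsto_norm_zero_iff LIM_zero_iff)
qed

lemma has_vector_derivative_along_axis: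
  fixes f :: "real^'m::finite \<Rightarrow> complex"
  assumes "\<And>x. ((\<lambda>s. f (x + s *\<^sub>R axis i 1)) has_vector_derivative g x) (at 0)"
  shows "((\<lambda>s. f (x + s *\<^sub>R axis i 1)) has_vector_derivative g (x + r *\<^sub>R axis i 1)) (at r within S)"
proof -
  let ?y = "x + r *\<^sub>R axis i 1"
  have "((\<lambda>s. s - r) has_vector_derivative 1) (at r)"
    by (auto intro!: derivative_eq_intros)
  from vector_diff_chain_at[OF this, of "\<lambda>s. f (?y + s *\<^sub>R axis i 1)" "g ?y"] assms[of ?y]
  have "((\<lambda>s. f (?y + s *\<^sub>R axis i 1)) \<circ> (\<lambda>s. s - r) has_vector_derivative g ?y) (at r)"
    by simp
  moreover have "(\<lambda>s. f (?y + s *\<^sub>R axis i 1)) \<circ> (\<lambda>s. s - r) = (\<lambda>s. f (x + s *\<^sub>R axis i 1))"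
    by (auto simp: fun_eq_iff algebra_simps)
  ultimately show ?thesis by (simp add: has_vector_derivative_at_within)
qed

text \<open>Difference quotients integrate to zero by translation invariance, and dominated
  convergence passes this on to the derivative. Applied to a product with a character it becomes
  integration by parts.\<close>

lemma torus_integral_derivative:
  fixes f :: "real^'m::finite \<Rightarrow> complex"
  assumes cf: "continuous_on UNIV f" and per: "periodic_torus f" and cg: "continuous_on UNIV g"
    and der: "\<And>x. ((\<lambda>s. f (x + s *\<^sub>R axis i 1)) has_vector_derivative g x) (at 0)"
  shows "torus_integral g = 0"
proof -
  let ?e = "axis i 1 :: real^'m"
  let ?b = "(\<chi> j. 2 * pi) :: real^'m"
  \<comment> \<open>The bound on the derivative is taken on a cube enlarged by 1 in direction i,
    because the segment from x to \<open>x + h n *\<^sub>R ?e\<close> may leave the fundamental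
    cube.\<close>
  have "compact (g ` cbox 0 (?b + ?e))"
    by (intro compact_continuous_image continuous_on_subset[OF cg]) auto
  then obtain B where B: "\<And>x. x \<in> cbox 0 (?b + ?e) \<Longrightarrow> norm (g x) \<le> B"
    by (metis bounded_iff compact_imp_bounded imageI)
  have B0: "B \<ge> 0" using B[of 0] by (auto simp: mem_box_cart axis_def) (smt (verit) norm_ge_zero pi_gt_zero)
  define h :: "nat \<Rightarrow> real" where "h n = 1 / (real n + 1)" for n
  have h: "0 < h n" "h n \<le> 1" for n by (auto simp: h_def)
  have hlim: "h \<longlonglongrightarrow> 0" unfolding h_def
    using LIMSEQ_inverse_real_of_nat by (simp add: inverse_eq_divide add.commute)
  define D where "D n x = (f (x + h n *\<^sub>R ?e) - f x) /\<^sub>R h n" for n x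
  have Dcont: "continuous_on UNIV (D n)" for n
    unfolding D_def
    by (intro continuous_intros continuous_on_compose2[OF cf]) auto
  have intD: "integral (cbox 0 ?b) (D n) = 0" for n
  proof -
    have c2: "continuous_on UNIV (\<lambda>x. f (x + h n *\<^sub>R ?e))"
      by (intro continuous_intros continuous_on_compose2[OF cf]) auto
    have "h n \<le> 2 * pi" using h(2)[of n] pi_gt3 by linarith
    then have "torus_integral (\<lambda>x. f (x + h n *\<^sub>R ?e)) = torus_integral f"
      using h[of n] by (intro torus_integral_shift[OF cf per]) auto
    then show ?thesis
      unfolding D_def
      by (simp add: integral_diff[OF integrable_torus[OF c2] integrable_torus[OF cf]] torus_integral_def)
  qed
  have bound: "norm (D n x) \<le> B" if x: "x \<in> cbox 0 ?b" for n x
  proof -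
    have "norm (f (x + h n *\<^sub>R ?e) - f (x + 0 *\<^sub>R ?e)) \<le> B * (h n - 0)"
    proof (rule norm_increment_le)
      fix s assume s: "0 \<le> s" "s \<le> h n"
      show "((\<lambda>s. f (x + s *\<^sub>R ?e)) has_vector_derivative g (x + s *\<^sub>R ?e)) (at s within {0..h n})"
        by (rule has_vector_derivative_along_axis[OF der])
      have "0 \<le> x $ j \<and> x $ j \<le> 2 * pi" for j using x by (auto simp: mem_box_cart)
      then have "x + s *\<^sub>R ?e \<in> cbox 0 (?b + ?e)"
        using s h(2)[of n] by (auto simp: mem_box_cart axis_def)
          (smt (verit, best))+
      then show "norm (g (x + s *\<^sub>R ?e)) \<le> B" by (rule B)
    qed (use h(1)[of n] B0 in auto)
    then show ?thesis using h(1)[of n] by (simp add: D_def divide_simps mult.commute)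
  qed
  have lim: "(\<lambda>n. D n x) \<longlonglongrightarrow> g x" for x
  proof -
    have "((\<lambda>s. (f (x + s *\<^sub>R ?e) - f (x + 0 *\<^sub>R ?e)) /\<^sub>R s) \<longlongrightarrow> g x) (at 0)"
      using der[of x] has_vector_derivative_at_0_iff[of "\<lambda>s. f (x + s *\<^sub>R ?e)"] by blast
    moreover have "filterlim h (at 0) sequentially"
      using hlim h(1) by (auto simp: filterlim_at eventually_sequentially) (metis less_irrefl)
    ultimately show ?thesis
      by (auto dest: filterlim_compose simp: D_def)
  qed
  have "(\<lambda>n. integral (cbox 0 ?b) (D n)) \<longlonglongrightarrow> integral (cbox 0 ?b) g"
    using bound lim integrable_torus[OF Dcont]
    by (intro dominated_convergence(2)[where h="\<lambda>_. B"]) auto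
  then have "integral (cbox 0 ?b) g = 0"
    by (simp add: intD LIMSEQ_const_iff)
  then show ?thesis by (simp add: torus_integral_def)
qed

lemma norm_torus_integral_le:
  fixes f :: "real^'m::finite \<Rightarrow> complex"
  assumes "continuous_on UNIV f" "\<And>x. norm (f x) \<le> B"
  shows "norm (torus_integral f) \<le> B * (2 * pi) ^ CARD('m)"
proof -
  have "B \<ge> 0" using assms(2)[of 0] norm_ge_zero order_trans by blast
  then have "norm (integral (cbox 0 (\<chi> i. 2 * pi)) f) \<le> B * measure lborel (cbox 0 (\<chi> i. 2 * pi) :: (real^'m) set)"
    using has_integral_bound[OF _ integrable_integral[OF integrable_torus[OF assms(1)]], of B] assms(2)
    by auto
  then show ?thesis by (simp add: torus_integral_def content_torus)
qed

lemma norm_fc_le: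
  fixes f :: "real^'m::finite \<Rightarrow> complex"
  assumes "continuous_on UNIV f" "\<And>x. norm (f x) \<le> B"
  shows "norm (fc f k) \<le> B"
proof -
  have "norm (torus_integral (\<lambda>x. f x * ee (\<lambda>i. - k i) x)) \<le> B * (2 * pi) ^ CARD('m)"
    using assms by (intro norm_torus_integral_le continuous_intros) (auto simp: norm_mult)
  then show ?thesis
    by (simp add: fc_def norm_divide norm_mult norm_power divide_le_eq)
qed

lemma has_vector_derivative_cis_mult:
  "((\<lambda>s. cis (r * s)) has_vector_derivative \<i> * of_real r * cis (r * s)) (at s)"
proof -
  have "((\<lambda>z. exp (\<i> * of_real r * z)) has_field_derivative \<i> * of_real r * exp (\<i> * of_real r * of_real s))
      (at (of_real s))"
    by (auto intro!: derivative_eq_intros)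
  from has_vector_derivative_real_field[OF this] show ?thesis
    by (simp add: cis_conv_exp mult.assoc)
qed

lemma fc_derivative:
  fixes f :: "real^'m::finite \<Rightarrow> complex"
  assumes cf: "continuous_on UNIV f" and per: "periodic_torus f" and cg: "continuous_on UNIV g"
    and der: "\<And>x. ((\<lambda>s. f (x + s *\<^sub>R axis i 1)) has_vector_derivative g x) (at 0)"
  shows "fc g k = \<i> * of_int (k i) * fc f k"
proof -
  let ?k = "\<lambda>i. - k i"
  have dee: "((\<lambda>s. ee ?k (x + s *\<^sub>R axis i 1)) has_vector_derivative - \<i> * of_int (k i) * ee ?k x) (at 0)" for x
    unfolding ee_shift
    by (rule has_vector_derivative_eq_rhs,
        rule has_vector_derivative_mult_right, rule has_vector_derivative_cis_mult) simp
  have "torus_integral (\<lambda>x. g x * ee ?k x + f x * (- \<i> * of_int (k i) * ee ?k x)) = 0"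
  proof (rule torus_integral_derivative[where f="\<lambda>x. f x * ee ?k x" and i=i])
    show "periodic_torus (\<lambda>x. f x * ee ?k x)"
      using per periodic_ee[of ?k] by (simp add: periodic_torus_def)
    show "((\<lambda>s. f (x + s *\<^sub>R axis i 1) * ee ?k (x + s *\<^sub>R axis i 1)) has_vector_derivative
       (g x * ee ?k x + f x * (- \<i> * of_int (k i) * ee ?k x))) (at 0)" for x
      using has_vector_derivative_mult[OF der[of x] dee[of x]] by (simp add: algebra_simps)
  qed (intro continuous_intros cf cg)+
  moreover have "torus_integral (\<lambda>x. g x * ee ?k x + f x * (- \<i> * of_int (k i) * ee ?k x))
     = torus_integral (\<lambda>x. g x * ee ?k x) + torus_integral (\<lambda>x. (- \<i> * of_int (k i)) * (f x * ee ?k x))"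
  proof -
    have "(\<lambda>x. g x * ee ?k x + f x * (- \<i> * of_int (k i) * ee ?k x))
      = (\<lambda>x. g x * ee ?k x + (- \<i> * of_int (k i)) * (f x * ee ?k x))"
      by (simp add: algebra_simps)
    then show ?thesis
      unfolding torus_integral_def
      by (simp only:) (rule integral_add; intro integrable_torus continuous_intros cf cg)
  qed
  moreover have "torus_integral (\<lambda>x. (- \<i> * of_int (k i)) * (f x * ee ?k x))
     = (- \<i> * of_int (k i)) * torus_integral (\<lambda>x. f x * ee ?k x)"
    unfolding torus_integral_def by (rule integral_mult_right)
  ultimately show ?thesis by (simp add: fc_def)
qed

section \<open>Absolutely convergent Fourier series: integration, coefficients,
  differentiation\<close>

lemma torus_integral_infsum:
  fixes h :: "'k \<Rightarrow> real^'m::finite \<Rightarrow> complex"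
  assumes c: "\<And>k. continuous_on UNIV (h k)" and M: "\<And>k x. norm (h k x) \<le> M k" "M summable_on UNIV"
  shows "continuous_on UNIV (\<lambda>x. \<Sum>\<^sub>\<infinity>k. h k x)"
    and "torus_integral (\<lambda>x. \<Sum>\<^sub>\<infinity>k. h k x) = (\<Sum>\<^sub>\<infinity>k. torus_integral (h k))"
proof -
  let ?F = "finite_subsets_at_top (UNIV :: 'k set)"
  let ?b = "(\<chi> j. 2 * pi) :: real^'m"
  have ul: "uniform_limit Y (\<lambda>X x. \<Sum>k\<in>X. h k x) (\<lambda>x. \<Sum>\<^sub>\<infinity>k. h k x) ?F" for Y
    using M by (intro Weierstrass_m_test_general) auto
  show "continuous_on UNIV (\<lambda>x. \<Sum>\<^sub>\<infinity>k. h k x)"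
    by (rule uniform_limit_theorem[OF _ ul]) (auto intro!: always_eventually continuous_intros c)
  have "continuous_on (cbox 0 ?b) (\<lambda>x. \<Sum>k\<in>X. h k x)" for X
    by (intro continuous_intros continuous_on_subset[OF c]) auto
  from uniform_limit_integral_cbox[OF ul this]
  obtain I J where IJ: "\<And>X. ((\<lambda>x. \<Sum>k\<in>X. h k x) has_integral I X) (cbox 0 ?b)"
    "((\<lambda>x. \<Sum>\<^sub>\<infinity>k. h k x) has_integral J) (cbox 0 ?b)" "(I \<longlongrightarrow> J) ?F"
    by (metis finite_subsets_at_top_neq_bot)
  have "I X = (\<Sum>k\<in>X. torus_integral (h k))" if "finite X" for X
    using integral_unique[OF IJ(1)[of X]] that
    by (simp add: torus_integral_def integral_sum integrable_torus c)
  then have "(sum (\<lambda>k. torus_integral (h k)) \<longlongrightarrow> J) ?F"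
    by (intro Lim_transform_eventually[OF IJ(3)]) (auto intro: eventually_finite_subsets_at_top_weakI)
  then show "torus_integral (\<lambda>x. \<Sum>\<^sub>\<infinity>k. h k x) = (\<Sum>\<^sub>\<infinity>k. torus_integral (h k))"
    using integral_unique[OF IJ(2)] infsumI[of "\<lambda>k. torus_integral (h k)" UNIV J]
    by (simp add: torus_integral_def has_sum_def)
qed

lemma continuous_on_Ffun:
  assumes "(\<lambda>k. norm (c k)) summable_on UNIV"
  shows "continuous_on UNIV (Ffun c)"
  unfolding Ffun_def [abs_def]
  by (rule torus_integral_infsum(1)[OF _ _ assms]) (auto simp: norm_mult intro!: continuous_intros)

lemma periodic_Ffun: "periodic_torus (Ffun c)"
proof -
  have "ee k (x + (2 * pi) *\<^sub>R axis i 1) = ee k x" for k :: "'a \<Rightarrow> int" and i x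
    using periodic_ee[of k] by (simp add: periodic_torus_def)
  then show ?thesis by (simp add: periodic_torus_def Ffun_def)
qed

lemma norm_Ffun_le:
  assumes "(\<lambda>k. norm (c k)) summable_on UNIV"
  shows "norm (Ffun c x) \<le> (\<Sum>\<^sub>\<infinity>k. norm (c k))"
  unfolding Ffun_def using norm_infsum_bound[of "\<lambda>k. c k * ee k x" UNIV] assms by (simp add: norm_mult)

lemma torus_integral_mult_Ffun:
  fixes g :: "real^'m::finite \<Rightarrow> complex"
  assumes c: "(\<lambda>k. norm (c k)) summable_on UNIV" and g: "continuous_on UNIV g" "\<And>x. norm (g x) \<le> B"
  shows "torus_integral (\<lambda>x. g x * Ffun c x) = (\<Sum>\<^sub>\<infinity>k. c k * torus_integral (\<lambda>x. g x * ee k x))"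
proof -
  have "torus_integral (\<lambda>x. \<Sum>\<^sub>\<infinity>k. g x * (c k * ee k x)) = (\<Sum>\<^sub>\<infinity>k. torus_integral (\<lambda>x. g x * (c k * ee k x)))"
  proof (rule torus_integral_infsum(2))
    show "(\<lambda>k. B * norm (c k)) summable_on UNIV" using c by (rule summable_on_cmult_right)
    show "norm (g x * (c k * ee k x)) \<le> B * norm (c k)" for k x
      using g(2)[of x] by (simp add: norm_mult mult_right_mono)
  qed (intro continuous_intros g)
  moreover have "(\<Sum>\<^sub>\<infinity>k. g x * (c k * ee k x)) = g x * Ffun c x" for x
    by (simp add: Ffun_def infsum_cmult_right')
  moreover have "torus_integral (\<lambda>x. g x * (c k * ee k x)) = c k * torus_integral (\<lambda>x. g x * ee k x)" for k
    unfolding torus_integral_def integral_mult_right [symmetric] by (simp add: mult_ac)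
  ultimately show ?thesis by simp
qed

lemma fc_Ffun:
  fixes c :: "('m::finite \<Rightarrow> int) \<Rightarrow> complex"
  assumes c: "(\<lambda>k. norm (c k)) summable_on UNIV"
  shows "fc (Ffun c) k = c k"
proof -
  have eqk: "(\<lambda>i. - k i + l i) = (\<lambda>_. 0) \<longleftrightarrow> l = k" for l
    by (auto simp: fun_eq_iff)
  have "torus_integral (\<lambda>x. Ffun c x * ee (\<lambda>i. - k i) x)
     = (\<Sum>\<^sub>\<infinity>l. c l * torus_integral (\<lambda>x. ee (\<lambda>i. - k i) x * ee l x))"
    using torus_integral_mult_Ffun[OF c, of "ee (\<lambda>i. - k i)" 1] by (simp add: continuous_on_ee mult.commute)
  also have "\<dots> = (\<Sum>\<^sub>\<infinity>l. if l = k then c k * of_real ((2 * pi) ^ CARD('m)) else 0)"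
    using eqk by (intro infsum_cong) (simp add: ee_mult torus_integral_ee)
  also have "\<dots> = (\<Sum>\<^sub>\<infinity>l\<in>{k}. if l = k then c k * of_real ((2 * pi) ^ CARD('m)) else 0)"
    by (rule infsum_cong_neutral) auto
  finally show ?thesis by (simp add: fc_def)
qed

lemma norm_cis_minus_one_le: "norm (cis r - 1) \<le> \<bar>r\<bar>"
  using dist_exp_i_1[of r] abs_sin_x_le_abs_x[of "r / 2"] by (simp add: cis_conv_exp)

lemma infsum_diff:
  fixes f g :: "'a \<Rightarrow> complex"
  assumes "f summable_on A" "g summable_on A"
  shows "infsum (\<lambda>x. f x - g x) A = infsum f A - infsum g A"
  using infsum_add[of f A "\<lambda>x. - g x"] assms by (simp add: infsum_uminus summable_on_uminus)

text \<open>Since |cis r - 1| \<le> |r|, the difference quotients of the terms are bounded by |k_i|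
  |c_k| uniformly in the increment; hence the limit in the increment may be exchanged with the limit
  over finite partial sums.\<close>

lemma has_vector_derivative_Ffun:
  fixes c :: "('m::finite \<Rightarrow> int) \<Rightarrow> complex"
  assumes c: "(\<lambda>k. norm (c k)) summable_on UNIV" and ic: "(\<lambda>k. \<bar>real_of_int (k i)\<bar> * norm (c k)) summable_on UNIV"
  shows "((\<lambda>s. Ffun c (x + s *\<^sub>R axis i 1)) has_vector_derivative Ffun (\<lambda>k. \<i> * of_int (k i) * c k) x) (at 0)"
proof -
  let ?F = "finite_subsets_at_top (UNIV :: ('m \<Rightarrow> int) set)"
  let ?q = "\<lambda>k s. c k * ee k x * ((cis (of_int (k i) * s) - 1) /\<^sub>R s)"
  let ?d = "\<lambda>k. \<i> * of_int (k i) * c k * ee k x"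
  have qn: "norm (?q k s) \<le> \<bar>real_of_int (k i)\<bar> * norm (c k)" if "s \<in> UNIV - {0}" for k s
  proof -
    have "norm ((cis (of_int (k i) * s) - 1) /\<^sub>R s) \<le> \<bar>real_of_int (k i)\<bar>"
      using that norm_cis_minus_one_le[of "of_int (k i) * s"] by (simp add: abs_mult divide_simps)
    from mult_left_mono[OF this, of "norm (c k)"] show ?thesis by (simp add: norm_mult mult_ac)
  qed
  have at0: "at (0::real) within UNIV - {0} = at 0" by (simp add: at_within_def)
  have ul: "uniform_limit (UNIV - {0}) (\<lambda>X s. \<Sum>k\<in>X. ?q k s) (\<lambda>s. \<Sum>\<^sub>\<infinity>k. ?q k s) ?F"
  proof (rule Weierstrass_m_test_general)
    fix k s assume "s \<in> UNIV - {0::real}"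
    then show "norm (?q k s) \<le> \<bar>real_of_int (k i)\<bar> * norm (c k)" by (rule qn)
  qed (rule ic)
  have "(?q k \<longlongrightarrow> ?d k) (at 0)" for k
  proof -
    have "((\<lambda>s. cis (of_int (k i) * s)) has_vector_derivative \<i> * of_int (k i)) (at 0)"
      using has_vector_derivative_cis_mult[of "of_int (k i)" 0] by simp
    then have "((\<lambda>s. (cis (of_int (k i) * s) - 1) /\<^sub>R s) \<longlongrightarrow> \<i> * of_int (k i)) (at 0)"
      by (simp add: has_vector_derivative_at_0_iff)
    from tendsto_mult[OF tendsto_const this, of "c k * ee k x"] show ?thesis by (simp add: mult_ac)
  qed
  then have l1: "((\<lambda>s. \<Sum>k\<in>X. ?q k s) \<longlongrightarrow> (\<Sum>k\<in>X. ?d k)) (at 0 within UNIV - {0})" for X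
    unfolding at0 by (intro tendsto_sum)
  have "?d summable_on UNIV"
    by (rule abs_summable_summable, rule summable_on_comparison_test[OF ic]) (auto simp: norm_mult)
  then have l2: "((\<lambda>X. \<Sum>k\<in>X. ?d k) \<longlongrightarrow> Ffun (\<lambda>k. \<i> * of_int (k i) * c k) x) ?F"
    using has_sum_infsum unfolding has_sum_def Ffun_def by blast
  have "((\<lambda>s. \<Sum>\<^sub>\<infinity>k. ?q k s) \<longlongrightarrow> Ffun (\<lambda>k. \<i> * of_int (k i) * c k) x) (at 0 within UNIV - {0})"
    by (rule swap_uniform_limit[OF always_eventually l2 ul]) (rule allI, rule l1, simp)
  moreover have "(\<Sum>\<^sub>\<infinity>k. ?q k s) = (Ffun c (x + s *\<^sub>R axis i 1) - Ffun c (x + 0 *\<^sub>R axis i 1)) /\<^sub>R s" for s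
  proof -
    have sm: "(\<lambda>k. c k * ee k y) summable_on UNIV" for y
      by (rule abs_summable_summable) (use c in \<open>simp add: norm_mult\<close>)
    have "Ffun c (x + s *\<^sub>R axis i 1) - Ffun c x = (\<Sum>\<^sub>\<infinity>k. c k * ee k (x + s *\<^sub>R axis i 1) - c k * ee k x)"
      unfolding Ffun_def by (rule infsum_diff [symmetric]) (rule sm)+
    also have "\<dots> /\<^sub>R s = (\<Sum>\<^sub>\<infinity>k. of_real (inverse s) * (c k * ee k (x + s *\<^sub>R axis i 1) - c k * ee k x))"
      by (simp only: infsum_cmult_right' scaleR_conv_of_real [where 'a=complex])
    also have "\<dots> = (\<Sum>\<^sub>\<infinity>k. ?q k s)"
      by (rule infsum_cong) (simp add: ee_shift scaleR_conv_of_real [where 'a=complex] algebra_simps)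
    finally show ?thesis by simp
  qed
  ultimately show ?thesis
    by (subst has_vector_derivative_at_0_iff) (simp add: at0)
qed

section \<open>Uniqueness of Fourier coefficients and Fourier inversion\<close>

lemma periodic_torus_int_shift:
  fixes f :: "real^'m::finite \<Rightarrow> complex"
  assumes per: "periodic_torus f"
  shows "f (x + (\<chi> i. 2 * pi * of_int (n i))) = f x"
proof -
  have nat1: "f (x + (real k * (2 * pi)) *\<^sub>R axis i 1) = f x" for k x i
  proof (induction k)
    case (Suc k)
    have "f (x + (real (Suc k) * (2 * pi)) *\<^sub>R axis i 1)
        = f ((x + (real k * (2 * pi)) *\<^sub>R axis i 1) + (2 * pi) *\<^sub>R axis i 1)"
      by (rule arg_cong[where f=f]) (simp add: algebra_simps)
    then show ?case using per Suc by (simp add: periodic_torus_def)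
  qed simp
  have int1: "f (x + (of_int m * (2 * pi)) *\<^sub>R axis i 1) = f x" for m x i
  proof (cases "m \<ge> 0")
    case True
    then show ?thesis using nat1[of x "nat m" i] by simp
  next
    case False
    have "f (x + (of_int m * (2 * pi)) *\<^sub>R axis i 1)
      = f (x + (of_int m * (2 * pi)) *\<^sub>R axis i 1 + (real (nat (- m)) * (2 * pi)) *\<^sub>R axis i 1)"
      by (simp add: nat1)
    also have "\<dots> = f x" using False by (intro arg_cong[where f=f]) (simp flip: scaleR_left_distrib)
    finally show ?thesis .
  qed
  have "f (x + (\<Sum>i\<in>S. (of_int (n i) * (2 * pi)) *\<^sub>R axis i 1)) = f x" if "finite S" for S
    using that
  proof (induction S)
    case (insert i S)
    have "f (x + (\<Sum>i\<in>insert i S. (of_int (n i) * (2 * pi)) *\<^sub>R axis i 1))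
      = f ((x + (\<Sum>i\<in>S. (of_int (n i) * (2 * pi)) *\<^sub>R axis i 1)) + (of_int (n i) * (2 * pi)) *\<^sub>R axis i 1)"
      using insert by (simp add: algebra_simps)
    then show ?case using insert by (simp add: int1)
  qed simp
  from this[of UNIV]
  have "f (x + (\<Sum>i\<in>UNIV. (of_int (n i) * (2 * pi)) *\<^sub>R axis i 1)) = f x" by simp
  moreover have "(\<Sum>i\<in>UNIV. (of_int (n i) * (2 * pi)) *\<^sub>R axis i 1) = ((\<chi> i. 2 * pi * of_int (n i)) :: real^'m)"
    by (simp add: vec_eq_iff axis_def if_distrib cong: if_cong)
  ultimately show ?thesis by simp
qed

text \<open>The peak functions \<open>T\<^sup>n\<close> below play the role of an approximate identity at \<open>x0\<close>.\<close>

lemma zero_in_open_cube_if_fc_zero: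
  fixes f :: "real^'m::finite \<Rightarrow> complex"
  assumes cf: "continuous_on UNIV f" and fc0: "\<And>k. fc f k = 0"
    and x0: "x0 \<in> box 0 (\<chi> i. 2 * pi)"
  shows "f x0 = 0"
proof (rule ccontr)
  assume f0: "f x0 \<noteq> 0"
  let ?b = "(\<chi> j. 2 * pi) :: real^'m" and ?Q = "cbox 0 (\<chi> j. 2 * pi) :: (real^'m) set"
  let ?m = "real CARD('m)"
  have zero: "torus_integral (\<lambda>x. f x * ee k x) = 0" for k
    using fc0[of "\<lambda>i. - k i"] by (simp add: fc_def)
  \<comment> \<open>An average of raised cosines with values in [0, 1]. In the closed cube it equals
    1 only at \<open>x0\<close>: as \<open>x0\<close> is interior, none of its other periodic copies
    lies in the closed cube.\<close>
  define T where "T x = (\<Sum>i\<in>UNIV. (1 + cos (x $ i - x0 $ i)) / (2 * ?m))" for x :: "real^'m"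
  define d where "d i = (\<lambda>j. if j = i then 1 else 0 :: int)" for i :: 'm
  have mpos: "?m > 0" by simp
  have Tc: "continuous_on S T" for S unfolding T_def by (intro continuous_intros) auto
  have Tle: "0 \<le> T x" "T x \<le> 1" for x
  proof -
    have c: "0 \<le> 1 + cos y" "1 + cos y \<le> 2" for y :: real
      using cos_ge_minus_one[of y] cos_le_one[of y] by linarith+
    show "0 \<le> T x" unfolding T_def
      by (intro sum_nonneg divide_nonneg_nonneg c) simp
    have "T x \<le> (\<Sum>i\<in>(UNIV::'m set). 2 / (2 * ?m))" unfolding T_def
      by (intro sum_mono divide_right_mono c) simp
    then show "T x \<le> 1" by simp
  qed
  have T1: "x = x0" if x: "x \<in> ?Q" and "T x = 1" for x
  proof -
    have "(\<Sum>i\<in>(UNIV::'m set). 1 / ?m - (1 + cos (x $ i - x0 $ i)) / (2 * ?m)) = 0"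
      using \<open>T x = 1\<close> by (simp add: sum_subtractf T_def)
    moreover have "1 / ?m - (1 + cos (x $ i - x0 $ i)) / (2 * ?m) \<ge> 0" for i
      using cos_le_one[of "x $ i - x0 $ i"] by (simp add: divide_simps)
    ultimately have *: "1 / ?m - (1 + cos (x $ i - x0 $ i)) / (2 * ?m) = 0" for i
      by (subst (asm) sum_nonneg_eq_0_iff) auto
    have "x $ i = x0 $ i" for i
    proof -
      have c: "cos (x $ i - x0 $ i) = 1" using *[of i] by (simp add: divide_simps)
      have "0 \<le> x $ i" "x $ i \<le> 2 * pi" "0 < x0 $ i" "x0 $ i < 2 * pi"
        using x x0 by (auto simp: mem_box_cart)
      then have "\<bar>x $ i - x0 $ i\<bar> < 2 * pi" by linarith
      moreover obtain n :: int where n: "x $ i - x0 $ i = of_int n * 2 * pi"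
        using c cos_one_2pi_int by auto
      ultimately have "\<bar>of_int n :: real\<bar> < 1" by (simp add: abs_mult)
      then have "n = 0" by linarith
      then show ?thesis using n by simp
    qed
    then show ?thesis by (simp add: vec_eq_iff)
  qed
  have Tee: "of_real (T x) = (\<Sum>i\<in>(UNIV::'m set). 1 / (2 * of_nat CARD('m)) +
      (cis (- x0 $ i) * ee (d i) x + cis (x0 $ i) * ee (\<lambda>j. - d i j) x) / (4 * of_nat CARD('m)))" for x
  proof -
    have e1: "ee (d i) x = cis (x $ i)" "ee (\<lambda>j. - d i j) x = cis (- (x $ i))" for i
    proof -
      have "(\<Sum>j\<in>UNIV. of_int (d i j) * x $ j) = (\<Sum>j\<in>UNIV. if j = i then x $ j else 0)"
        by (rule sum.cong) (auto simp: d_def)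
      then show "ee (d i) x = cis (x $ i)" "ee (\<lambda>j. - d i j) x = cis (- (x $ i))"
        by (simp_all add: ee_def sum_negf)
    qed
    have "of_real ((1 + cos (x $ i - x0 $ i)) / (2 * ?m)) = 1 / (2 * of_nat CARD('m)) +
      (cis (- x0 $ i) * ee (d i) x + cis (x0 $ i) * ee (\<lambda>j. - d i j) x) / (4 * of_nat CARD('m))" for i
    proof -
      define y where "y = x $ i - x0 $ i"
      have c: "of_real (cos y) = (cis y + cis (- y)) / 2" by (simp add: complex_eq_iff)
      have "of_real ((1 + cos y) / (2 * ?m)) = (1 + complex_of_real (cos y)) / (2 * of_nat CARD('m))" by simp
      also have "\<dots> = 1 / (2 * of_nat CARD('m)) + (cis y + cis (- y)) / (4 * of_nat CARD('m))"
        unfolding c by (simp add: field_simps)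
      finally have "complex_of_real ((1 + cos y) / (2 * ?m)) = 1 / (2 * of_nat CARD('m)) + (cis y + cis (- y)) / (4 * of_nat CARD('m))" .
      moreover have "cis (- x0 $ i) * ee (d i) x = cis y" "cis (x0 $ i) * ee (\<lambda>j. - d i j) x = cis (- y)"
        unfolding e1 cis_mult y_def by (simp_all add: algebra_simps)
      ultimately show ?thesis by (simp add: y_def)
    qed
    then show ?thesis by (simp add: T_def)
  qed
  \<comment> \<open>\<open>T\<close> is a combination of characters, so multiplication by it keeps f
    orthogonal to all characters. The induction on n needs the claim for every k at once, because
    each factor \<open>T\<close> shifts k.\<close>
  have Tz: "torus_integral (\<lambda>x. f x * of_real (T x ^ n) * ee k x) = 0" for n k
  proof (induction n arbitrary: k)
    case 0
    then show ?case by (simp add: zero)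
  next
    case (Suc n)
    let ?g = "\<lambda>k x. f x * of_real (T x ^ n) * ee k x"
    have gi: "(\<lambda>x. c * ?g k x) integrable_on ?Q" for k c
      by (intro integrable_torus continuous_intros cf Tc)
    have gz: "integral ?Q (\<lambda>x. c * ?g k x) = 0" for k c
      using Suc[of k] by (subst integral_mult_right) (simp add: torus_integral_def)
    have "f x * of_real (T x ^ Suc n) * ee k x = (\<Sum>i\<in>(UNIV::'m set).
       (1 / (2 * of_nat CARD('m)) * ?g k x + cis (- x0 $ i) / (4 * of_nat CARD('m)) * ?g (\<lambda>j. k j + d i j) x)
        + cis (x0 $ i) / (4 * of_nat CARD('m)) * ?g (\<lambda>j. k j + - d i j) x)" for x
    proof -
      have "f x * of_real (T x ^ Suc n) * ee k x = of_real (T x) * ?g k x" by simp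
      then show ?thesis
        unfolding Tee sum_distrib_right ee_mult [symmetric]
        by (simp add: algebra_simps add_divide_distrib)
    qed
    then have "torus_integral (\<lambda>x. f x * of_real (T x ^ Suc n) * ee k x) = integral ?Q (\<lambda>x. \<Sum>i\<in>(UNIV::'m set).
       (1 / (2 * of_nat CARD('m)) * ?g k x + cis (- x0 $ i) / (4 * of_nat CARD('m)) * ?g (\<lambda>j. k j + d i j) x)
        + cis (x0 $ i) / (4 * of_nat CARD('m)) * ?g (\<lambda>j. k j + - d i j) x)"
      unfolding torus_integral_def by (simp only:)
    also have "\<dots> = 0"
      by (subst integral_sum, simp, intro integrable_add gi)
         (intro sum.neutral ballI, simp only: integral_add integrable_add gi gz add_0)
    finally show ?case .
  qed
  define h where "h x = Re (cnj (f x0) * f x)" for x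
  have hc: "continuous_on S h" for S
    unfolding h_def by (intro continuous_intros continuous_on_subset[OF cf]) auto
  have h0: "h x0 > 0" using f0 by (simp add: h_def complex_neq_0 power2_eq_square)
  have "open {x. h x0 / 2 < h x}"
    using hc[of UNIV] by (intro open_Collect_less) auto
  then have "open ({x. h x0 / 2 < h x} \<inter> box 0 ?b)" by (intro open_Int open_box)
  moreover have "x0 \<in> {x. h x0 / 2 < h x} \<inter> box 0 ?b" using x0 h0 by simp
  ultimately have "\<exists>r>0. \<forall>x. dist x x0 < r \<longrightarrow> x \<in> {x. h x0 / 2 < h x} \<inter> box 0 ?b"
    unfolding open_dist by blast
  then obtain r where r: "r > 0" "\<And>x. dist x x0 < r \<Longrightarrow> h x0 / 2 < h x \<and> x \<in> box 0 ?b" by auto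
  have "\<exists>q. 1 / 2 \<le> q \<and> q < 1 \<and> (\<forall>x\<in>?Q - ball x0 r. T x \<le> q)"
  proof (cases "?Q - ball x0 r = {}")
    case False
    have "compact (?Q - ball x0 r)" by (intro compact_diff compact_cbox open_ball)
    from continuous_attains_sup[OF this False Tc]
    obtain y where y: "y \<in> ?Q - ball x0 r" "\<And>x. x \<in> ?Q - ball x0 r \<Longrightarrow> T x \<le> T y" by blast
    have "T y \<noteq> 1" using T1[of y] y(1) r(1) by auto
    then have "T y < 1" using Tle(2)[of y] by linarith
    then show ?thesis using y(2) by (intro exI[of _ "max (1 / 2) (T y)"]) (auto simp: le_max_iff_disj)
  qed (auto intro!: exI[of _ "1 / 2"])
  then obtain q where q: "1 / 2 \<le> q" "q < 1" "\<And>x. x \<in> ?Q \<Longrightarrow> x \<notin> ball x0 r \<Longrightarrow> T x \<le> q" by blast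
  \<comment> \<open>Two levels q < q' < 1: outside the ball \<open>T\<close> is at most
    \<open>q\<close>, on a small cube around \<open>x0\<close> it exceeds \<open>q'\<close>, and
    \<open>(q' / q) ^ n\<close> outgrows every constant. The bound q \<ge> 1/2 keeps the denominator
    positive.\<close>
  define q' where "q' = (1 + q) / 2"
  have q': "q < q'" "q' < 1" using q by (auto simp: q'_def)
  have Tx0: "T x0 = 1" by (simp add: T_def)
  have "open {x. q' < T x}" using Tc[of UNIV] by (intro open_Collect_less) auto
  then have "open ({x. q' < T x} \<inter> ball x0 r)" by (intro open_Int open_ball)
  moreover have "x0 \<in> {x. q' < T x} \<inter> ball x0 r" using r q' by (simp add: Tx0)
  ultimately obtain u v where uv: "x0 \<in> box u v" "cbox u v \<subseteq> {x. q' < T x} \<inter> ball x0 r"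
    by (metis open_contains_cbox)
  have N: "x \<in> ?Q" "h x0 / 2 < h x" "q' < T x" if "x \<in> cbox u v" for x
  proof -
    have "dist x x0 < r" "q' < T x" using uv(2) that by (auto simp: dist_commute)
    then show "h x0 / 2 < h x" "q' < T x" "x \<in> ?Q" using r(2)[of x] box_subset_cbox by auto
  qed
  have cv: "measure lborel (cbox u v) > 0"
    using uv(1) by (auto simp: content_pos_lt_eq mem_box intro: less_trans)
  obtain M where M: "\<And>x. x \<in> ?Q \<Longrightarrow> \<bar>h x\<bar> \<le> M"
    using compact_imp_bounded[OF compact_continuous_image[OF hc compact_cbox[of 0 ?b]]]
    unfolding bounded_iff by (metis imageI real_norm_def)
  have key: "h x0 / 2 * q' ^ n * measure lborel (cbox u v) \<le> M * q ^ n * measure lborel ?Q" for n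
  proof -
    \<comment> \<open>The added constant makes the integrand nonnegative on the whole cube, so its
      integral only shrinks when restricted to the small cube around \<open>x0\<close>.\<close>
    let ?F = "\<lambda>x. h x * T x ^ n + M * q ^ n"
    have Fi: "?F integrable_on cbox s t" for s t
      by (intro integrable_continuous continuous_intros hc Tc)
    have hT: "integral ?Q (\<lambda>x. h x * T x ^ n) = 0"
    proof -
      define G where "G x = cnj (f x0) * (f x * of_real (T x ^ n))" for x
      have "integral ?Q G = 0"
        using Tz[of n "\<lambda>_. 0"] unfolding G_def [abs_def] by (subst integral_mult_right) (simp add: torus_integral_def)
      moreover have "G integrable_on ?Q"
        unfolding G_def by (intro integrable_torus continuous_intros cf Tc)
      ultimately have "integral ?Q (Re \<circ> G) = 0"
        using integral_linear[OF _ bounded_linear_Re, of G ?Q] by simp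
      moreover have "Re \<circ> G = (\<lambda>x. h x * T x ^ n)"
        by (auto simp: fun_eq_iff h_def G_def algebra_simps simp flip: of_real_power)
      ultimately show ?thesis by simp
    qed
    have Fge: "?F x \<ge> 0" if x: "x \<in> ?Q" for x
    proof (cases "x \<in> ball x0 r")
      case True
      then have "h x > h x0 / 2" using r(2)[of x] by (auto simp: dist_commute)
      then have "h x \<ge> 0" "M \<ge> 0" using h0 M[OF x] by auto
      then show ?thesis using q(1) Tle(1)[of x] by simp
    next
      case False
      have "\<bar>h x * T x ^ n\<bar> \<le> M * q ^ n"
        unfolding abs_mult using M[OF x] q(3)[OF x False] Tle(1)[of x]
        by (intro mult_mono) (auto simp: power_mono)
      then show ?thesis by linarith
    qed
    have "h x0 / 2 * q' ^ n * measure lborel (cbox u v) = integral (cbox u v) (\<lambda>x. h x0 / 2 * q' ^ n)"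
      by simp
    also have "\<dots> \<le> integral (cbox u v) ?F"
    proof (rule integral_le)
      fix x assume x: "x \<in> cbox u v"
      have "h x0 / 2 * q' ^ n \<le> h x * T x ^ n"
        using N[OF x] h0 q' q by (intro mult_mono power_mono) auto
      moreover have "M \<ge> 0" using M[OF N(1)[OF x]] by linarith
      ultimately show "h x0 / 2 * q' ^ n \<le> ?F x" using q(1) by (simp add: add_increasing2)
    qed (auto intro: Fi)
    also have "\<dots> \<le> integral ?Q ?F"
      using N(1) Fge by (intro integral_subset_le Fi) auto
    also have "\<dots> = M * q ^ n * measure lborel ?Q"
      by (subst integral_add) (auto simp: hT intro!: integrable_continuous continuous_intros hc Tc)
    finally show ?thesis .
  qed
  define A where "A = h x0 / 2 * measure lborel (cbox u v)"
  have A: "A > 0" using h0 cv by (simp add: A_def)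
  have "(q' / q) ^ n \<le> M * measure lborel ?Q / A" for n
    using key[of n] A q by (simp add: A_def power_divide divide_simps mult_ac)
  moreover obtain n where "M * measure lborel ?Q / A < (q' / q) ^ n"
    using real_arch_pow[of "q' / q"] q q' by auto
  ultimately show False by (meson not_less)
qed

text \<open>The open cube is dense in the closed one, and the translates of the closed cube by
  periods cover the space.\<close>

lemma zero_if_fc_zero:
  fixes f :: "real^'m::finite \<Rightarrow> complex"
  assumes cf: "continuous_on UNIV f" and per: "periodic_torus f" and fc0: "\<And>k. fc f k = 0"
  shows "f x = 0"
proof -
  let ?b = "(\<chi> j. 2 * pi) :: real^'m"
  have "box 0 ?b \<noteq> {}" by (simp add: interval_eq_empty_cart not_le)
  then have "f y = 0" if "y \<in> cbox 0 ?b" for y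
    using continuous_constant_on_closure[of "box 0 ?b" f 0 y] zero_in_open_cube_if_fc_zero[OF cf fc0] that
    by (simp add: closure_box continuous_on_subset[OF cf])
  moreover define n where "n i = \<lfloor>x $ i / (2 * pi)\<rfloor>" for i
  have "x + (\<chi> i. 2 * pi * of_int (- n i)) \<in> cbox 0 ?b"
  proof -
    have "of_int (n i) \<le> x $ i / (2 * pi)" "x $ i / (2 * pi) \<le> of_int (n i) + 1" for i
      unfolding n_def by linarith+
    then show ?thesis by (simp add: mem_box_cart divide_simps) (simp add: algebra_simps)
  qed
  ultimately have "f (x + (\<chi> i. 2 * pi * of_int (- n i))) = 0" by blast
  then show ?thesis using periodic_torus_int_shift[OF per, of x "\<lambda>i. - n i"] by simp
qed

lemma fourier_inversion:
  fixes f :: "real^'m::finite \<Rightarrow> complex"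
  assumes cf: "continuous_on UNIV f" and per: "periodic_torus f"
    and s: "(\<lambda>k. norm (fc f k)) summable_on UNIV"
  shows "f = Ffun (fc f)"
proof
  fix x
  let ?g = "\<lambda>x. f x - Ffun (fc f) x"
  note cF = continuous_on_Ffun[OF s]
  have "fc ?g k = fc f k - fc (Ffun (fc f)) k" for k
  proof -
    have "torus_integral (\<lambda>x. f x * ee (\<lambda>i. - k i) x - Ffun (fc f) x * ee (\<lambda>i. - k i) x)
       = torus_integral (\<lambda>x. f x * ee (\<lambda>i. - k i) x) - torus_integral (\<lambda>x. Ffun (fc f) x * ee (\<lambda>i. - k i) x)"
      unfolding torus_integral_def by (intro integral_diff integrable_torus continuous_intros cf cF)
    then show ?thesis by (simp add: fc_def left_diff_distrib diff_divide_distrib)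
  qed
  then have "fc ?g k = 0" for k using fc_Ffun[OF s] by simp
  moreover have "periodic_torus ?g"
    using per periodic_Ffun[of "fc f"] by (simp add: periodic_torus_def)
  moreover have "continuous_on UNIV ?g" by (intro continuous_on_diff cf cF)
  ultimately have "?g x = 0"
    using zero_if_fc_zero[of ?g x] by blast
  then show "f x = Ffun (fc f) x" by simp
qed

section \<open>Weights and the Paley-Wiener characterisation\<close>

text \<open>The added 1 makes every value at least 1, so its logarithm is nonnegative and it can
  serve as base of powers. Replacing the Euclidean length by this l1 size costs a constant factor in
  the argument of \<open>\<omega>\<close>, which \<open>om_mult\<close> turns into a factor on the
  rate.\<close>

definition nrm :: "('m::finite \<Rightarrow> int) \<Rightarrow> real" where
  "nrm k = 1 + (\<Sum>i\<in>UNIV. \<bar>real_of_int (k i)\<bar>)"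

lemma nrm_ge_one: "1 \<le> nrm k"
  by (simp add: nrm_def sum_nonneg)

lemma nrm_ge: "1 + \<bar>real_of_int (k i)\<bar> \<le> nrm k"
  unfolding nrm_def by (intro add_left_mono member_le_sum) auto

lemma nrm_uminus [simp]: "nrm (\<lambda>i. - k i) = nrm k"
  by (simp add: nrm_def)

lemma nrm_pos: "0 < nrm k"
  using nrm_ge_one[of k] by linarith

lemma summable_on_inverse_square_int: "(\<lambda>j::int. 1 / (1 + \<bar>real_of_int j\<bar>)\<^sup>2) summable_on UNIV"
proof -
  let ?f = "\<lambda>j::int. 1 / (1 + \<bar>real_of_int j\<bar>)\<^sup>2"
  have "summable (\<lambda>n. inverse ((real (Suc n))\<^sup>2))"
    using inverse_power_summable[of 2, where 'a=real] by (subst summable_Suc_iff) simp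
  then have "summable (\<lambda>n. norm (1 / (1 + real n)\<^sup>2))" by (simp add: inverse_eq_divide)
  then have n: "(\<lambda>n::nat. 1 / (1 + real n)\<^sup>2) summable_on UNIV"
    by (rule norm_summable_imp_summable_on)
  have "?f summable_on (int ` UNIV)"
    by (subst summable_on_reindex) (use n in \<open>auto simp: o_def\<close>)
  moreover have "?f summable_on ((\<lambda>n. - int n) ` UNIV)"
    by (subst summable_on_reindex) (use n in \<open>auto simp: o_def inj_on_def\<close>)
  ultimately have "?f summable_on (int ` UNIV \<union> (\<lambda>n. - int n) ` UNIV)"
    by (rule summable_on_union)
  moreover have "int ` UNIV \<union> (\<lambda>n. - int n) ` UNIV = UNIV"
    by (auto simp: image_iff) (metis int_cases2)
  ultimately show ?thesis by simp
qed

lemma summable_on_inverse_square_prod: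
  "(\<lambda>k::'m::finite \<Rightarrow> int. \<Prod>i\<in>UNIV. 1 / (1 + \<bar>real_of_int (k i)\<bar>)\<^sup>2) summable_on UNIV"
proof -
  have "Infinite_Set_Sum.abs_summable_on (\<lambda>k::'m \<Rightarrow> int. \<Prod>i\<in>UNIV. 1 / (1 + \<bar>real_of_int (k i)\<bar>)\<^sup>2)
      (PiE UNIV (\<lambda>_. UNIV))"
    by (rule abs_summable_on_prod_PiE)
       (use summable_on_inverse_square_int in \<open>auto simp flip: abs_summable_equivalent\<close>)
  then show ?thesis
    by (auto simp flip: abs_summable_equivalent intro: abs_summable_summable)
qed

section \<open>Calculus of the weight and of its Young conjugate\<close>

locale weight =
  fixes \<omega> :: "real \<Rightarrow> real"
  assumes weight: "weight_function \<omega>" and subadditive: "subadditive_weight \<omega>"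
begin

lemma om_nonneg: "0 \<le> t \<Longrightarrow> 0 \<le> \<omega> t"
  using weight by (simp add: weight_function_def)

lemma om_mono: "0 \<le> s \<Longrightarrow> s \<le> t \<Longrightarrow> \<omega> s \<le> \<omega> t"
  using weight unfolding weight_function_def by (meson mono_onD atLeast_iff order_trans)

lemma om_add: "0 \<le> s \<Longrightarrow> 0 \<le> t \<Longrightarrow> \<omega> (s + t) \<le> \<omega> s + \<omega> t"
  using subadditive by (simp add: subadditive_weight_def)

text \<open>For integer c this is repeated subadditivity; rounding c up costs the additional
  1.\<close>

lemma om_mult:
  assumes "0 \<le> t" "0 \<le> c"
  shows "\<omega> (c * t) \<le> (c + 1) * \<omega> t"
proof -
  have S: "\<omega> (real (Suc n) * t) \<le> real (Suc n) * \<omega> t" for n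
  proof (induction n)
    case (Suc n)
    have "real (Suc (Suc n)) * t = real (Suc n) * t + t" by (simp add: algebra_simps)
    then show ?case using om_add[of "real (Suc n) * t" t] Suc assms by (simp add: algebra_simps)
  qed simp
  show ?thesis
  proof (cases "c = 0")
    case True
    then show ?thesis using om_mono[of 0 t] assms by simp
  next
    case False
    obtain n where n: "nat \<lceil>c\<rceil> = Suc n" using False assms by (cases "nat \<lceil>c\<rceil>") auto
    have c: "c \<le> real (Suc n)" "real (Suc n) \<le> c + 1"
      using n assms by linarith+
    have "\<omega> (c * t) \<le> \<omega> (real (Suc n) * t)"
      using c assms by (intro om_mono mult_right_mono) auto
    also have "\<dots> \<le> real (Suc n) * \<omega> t" by (rule S)
    also have "\<dots> \<le> (c + 1) * \<omega> t" using c om_nonneg[OF assms(1)] by (intro mult_right_mono)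
    finally show ?thesis .
  qed
qed

text \<open>The condition log t = o(\<omega>) in the form in which it is used: every power of the
  size is absorbed by an arbitrarily small multiple of \<omega> in the exponent. The constant covers
  the bounded range before the asymptotics set in.\<close>

lemma ln_le_om:
  assumes "0 < A"
  shows "\<exists>C\<ge>0. \<forall>t\<ge>1. A * ln t \<le> \<omega> t + C"
proof -
  have "ln \<in> o[at_top](\<omega>)" using weight by (simp add: weight_function_def)
  from landau_o.smallD[OF this, of "1 / A"] assms
  obtain t0 where t0: "\<And>t. t \<ge> t0 \<Longrightarrow> \<bar>ln t\<bar> \<le> 1 / A * \<bar>\<omega> t\<bar>"
    by (auto simp: eventually_at_top_linorder)
  show ?thesis
  proof (intro exI[of _ "A * ln (max 1 t0)"] conjI allI impI)
    show "0 \<le> A * ln (max 1 t0)" using assms by simp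
    fix t :: real assume t: "1 \<le> t"
    show "A * ln t \<le> \<omega> t + A * ln (max 1 t0)"
    proof (cases "t \<ge> t0")
      case True
      have "ln t \<le> \<omega> t / A" using t0[OF True] t om_nonneg[of t] by simp
      then have "A * ln t \<le> \<omega> t" using assms by (simp add: field_simps)
      then show ?thesis using assms by (simp add: add_increasing2)
    next
      case False
      then have "ln t \<le> ln (max 1 t0)" using t by simp
      then have "A * ln t \<le> A * ln (max 1 t0)" using assms by simp
      then show ?thesis using om_nonneg[of t] t by simp
    qed
  qed
qed

lemma om_nrm_nonneg: "0 \<le> \<omega> (nrm k)"
  using nrm_pos[of k] by (intro om_nonneg) simp

text \<open>With A = 2 m / \<delta> in \<open>ln_le_om\<close> the exponential is below a constant
  times the power -2m of the size, and 2m powers of the size dominate the product of the m squared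
  factors.\<close>

lemma summable_on_weight:
  assumes "0 < \<delta>"
  shows "(\<lambda>k::'m::finite \<Rightarrow> int. exp (- \<delta> * \<omega> (nrm k))) summable_on UNIV"
proof -
  let ?m = "CARD('m)"
  obtain C where C: "C \<ge> 0" "\<And>t. t \<ge> 1 \<Longrightarrow> (2 * real ?m / \<delta>) * ln t \<le> \<omega> t + C"
    using ln_le_om[of "2 * real ?m / \<delta>"] assms by auto
  show ?thesis
  proof (rule summable_on_comparison_test)
    show "(\<lambda>k::'m \<Rightarrow> int. exp (\<delta> * C) * (\<Prod>i\<in>UNIV. 1 / (1 + \<bar>real_of_int (k i)\<bar>)\<^sup>2)) summable_on UNIV"
      by (intro summable_on_cmult_right summable_on_inverse_square_prod)
    fix k :: "'m \<Rightarrow> int"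
    have "2 * real ?m * ln (nrm k) \<le> \<delta> * \<omega> (nrm k) + \<delta> * C"
      using mult_left_mono[OF C(2)[OF nrm_ge_one[of k]], of \<delta>] assms by (simp add: algebra_simps)
    then have "exp (- \<delta> * \<omega> (nrm k)) \<le> exp (\<delta> * C - real (2 * ?m) * ln (nrm k))"
      by simp
    also have "\<dots> = exp (\<delta> * C) / nrm k ^ (2 * ?m)"
      using nrm_pos[of k] by (simp only: exp_diff exp_of_nat_mult exp_ln)
    also have "\<dots> \<le> exp (\<delta> * C) * (\<Prod>i\<in>UNIV. 1 / (1 + \<bar>real_of_int (k i)\<bar>)\<^sup>2)"
    proof -
      have "(\<Prod>i\<in>(UNIV::'m set). 1 / (nrm k)\<^sup>2) \<le> (\<Prod>i\<in>UNIV. 1 / (1 + \<bar>real_of_int (k i)\<bar>)\<^sup>2)"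
        using nrm_ge[of k] by (intro prod_mono conjI divide_left_mono power_mono) (auto simp: nrm_pos intro!: mult_pos_pos zero_less_power add_pos_nonneg)
      then have "1 / nrm k ^ (2 * ?m) \<le> (\<Prod>i\<in>UNIV. 1 / (1 + \<bar>real_of_int (k i)\<bar>)\<^sup>2)"
        by (simp add: power_mult power_one_over)
      from mult_left_mono[OF this, of "exp (\<delta> * C)"] show ?thesis by simp
    qed
    finally show "exp (- \<delta> * \<omega> (nrm k)) \<le> exp (\<delta> * C) * (\<Prod>i\<in>UNIV. 1 / (1 + \<bar>real_of_int (k i)\<bar>)\<^sup>2)" .
  qed simp
qed

text \<open>The content is that the supremum is finite: \<open>\<omega> (exp s)\<close> eventually
  exceeds every linear function of s.\<close>

lemma phi_star_ge:
  assumes "0 \<le> s"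
  shows "s * t - \<omega> (exp s) \<le> phi_star \<omega> t"
proof -
  obtain C where C: "C \<ge> 0" "\<And>r. r \<ge> 1 \<Longrightarrow> (\<bar>t\<bar> + 1) * ln r \<le> \<omega> r + C"
    using ln_le_om[of "\<bar>t\<bar> + 1"] by (meson abs_ge_zero add_nonneg_pos zero_less_one)
  have "bdd_above ((\<lambda>s. s * t - \<omega> (exp s)) ` {0..})"
  proof (rule bdd_aboveI2)
    fix s :: real assume s: "s \<in> {0..}"
    have "s * t \<le> s * (\<bar>t\<bar> + 1)" using s by (intro mult_left_mono) auto
    then show "s * t - \<omega> (exp s) \<le> C" using C(2)[of "exp s"] s by (simp add: algebra_simps)
  qed
  then show ?thesis unfolding phi_star_def using assms by (intro cSUP_upper) auto
qed

lemma phi_star_le: "(\<And>s. 0 \<le> s \<Longrightarrow> s * t - \<omega> (exp s) \<le> B) \<Longrightarrow> phi_star \<omega> t \<le> B"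
  unfolding phi_star_def by (rule cSUP_least) auto

text \<open>Young's inequality for the conjugate pair at the points \<open>ln r\<close> and
  \<open>real n / lam\<close>, multiplied by \<open>lam\<close> and exponentiated.\<close>

lemma power_le_exp_phi_star:
  assumes "0 < lam" "1 \<le> r"
  shows "r ^ n \<le> exp (lam * phi_star \<omega> (real n / lam)) * exp (lam * \<omega> r)"
proof -
  have "ln r * (real n / lam) \<le> phi_star \<omega> (real n / lam) + \<omega> r"
    using phi_star_ge[of "ln r" "real n / lam"] assms by simp
  from mult_left_mono[OF this, of lam] assms
  have "real n * ln r \<le> lam * phi_star \<omega> (real n / lam) + lam * \<omega> r"
    by (simp add: algebra_simps)
  then have "exp (real n * ln r) \<le> exp (lam * phi_star \<omega> (real n / lam) + lam * \<omega> r)" by simp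
  then show ?thesis using assms by (simp add: exp_of_nat_mult exp_add)
qed

text \<open>The converse inequality, up to a factor \<open>r\<close>: biconjugation of the convex function
  \<open>\<omega> \<circ> exp\<close> through a supporting line at \<open>ln r\<close>.\<close>

lemma exp_phi_star_le_power:
  assumes "0 < lam" "1 \<le> r"
  shows "\<exists>n. exp (lam * phi_star \<omega> (real n / lam)) \<le> r ^ n * (r * exp (- lam * \<omega> r))"
proof -
  let ?\<phi> = "\<lambda>t. \<omega> (exp t)"
  define s where "s = ln r"
  have s: "s \<ge> 0" "exp s = r" using assms by (auto simp: s_def)
  have cv: "convex_on UNIV ?\<phi>" using weight by (simp add: weight_function_def)
  define t where "t = Inf ((\<lambda>t. (?\<phi> s - ?\<phi> t) / (s - t)) ` ({s<..} \<inter> UNIV))"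
  have sup: "?\<phi> s + t * (y - s) \<le> ?\<phi> y" for y
    using convex_le_Inf_differential[OF cv, of s y] by (simp add: t_def)
  have "?\<phi> (s - 1) \<le> ?\<phi> s" by (intro om_mono) auto
  then have t0: "t \<ge> 0" using sup[of "s - 1"] by simp
  \<comment> \<open>The optimal real order of differentiation is \<open>lam * t\<close>; rounding it
    down loses at most one factor exp s = r, which is the extra \<open>r\<close> in the
    statement.\<close>
  define n where "n = nat \<lfloor>lam * t\<rfloor>"
  have n: "real n \<le> lam * t" "lam * t \<le> real n + 1"
    using t0 assms by (auto simp: n_def)
  have nt: "real n / lam \<le> t" using n(1) assms by (simp add: field_simps)
  have "phi_star \<omega> (real n / lam) \<le> s * t - ?\<phi> s"
  proof (rule phi_star_le)
    fix y :: real assume "0 \<le> y"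
    then have "y * (real n / lam) \<le> y * t" using nt by (intro mult_left_mono) auto
    then show "y * (real n / lam) - ?\<phi> y \<le> s * t - ?\<phi> s"
      using sup[of y] by (simp add: algebra_simps)
  qed
  then have "lam * phi_star \<omega> (real n / lam) \<le> lam * (s * t - ?\<phi> s)"
    using assms by (intro mult_left_mono) auto
  also have "\<dots> = s * (lam * t) - lam * ?\<phi> s" by (simp add: algebra_simps)
  also have "\<dots> \<le> s * (real n + 1) - lam * ?\<phi> s" using n(2) s by (intro diff_right_mono mult_left_mono)
  finally have "exp (lam * phi_star \<omega> (real n / lam)) \<le> exp (real n * s + (s + - lam * \<omega> r))"
    by (simp add: algebra_simps s)
  then show ?thesis by (intro exI[of _ n]) (simp only: exp_add exp_of_nat_mult s)
qed

lemma iter_pd_le_rnorm: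
  assumes "f \<in> E_step \<omega> lam"
  shows "cmod (iter_pd is f x) \<le> rnorm \<omega> lam f * exp (lam * phi_star \<omega> (real (length is) / lam))"
proof -
  let ?e = "lam * phi_star \<omega> (real (length is) / lam)"
  have "cmod (iter_pd is f x) * exp (- lam * phi_star \<omega> (real (length is) / lam)) \<le> rnorm \<omega> lam f"
    unfolding rnorm_def using assms
    by (intro cSup_upper) (auto simp: E_step_def weighted_vals_def)
  then have "cmod (iter_pd is f x) * exp (- ?e) * exp ?e \<le> rnorm \<omega> lam f * exp ?e"
    by (intro mult_right_mono) auto
  then show ?thesis by (simp add: mult.assoc flip: exp_add)
qed

lemma rnorm_nonneg: "f \<in> E_step \<omega> lam \<Longrightarrow> 0 \<le> rnorm \<omega> lam f"
  using order_trans[OF norm_ge_zero iter_pd_le_rnorm[of f lam "[]" 0]]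
  by (simp add: zero_le_mult_iff not_le [symmetric])

end

section \<open>Decay of the coefficients characterises the Roumieu class\<close>

lemma periodic_iter_pd: "periodic_torus f \<Longrightarrow> periodic_torus (iter_pd is f)"
proof (induction "is")
  case (Cons i "is")
  have "iter_pd is f (x + (2 * pi) *\<^sub>R axis j 1 + s *\<^sub>R axis i 1) = iter_pd is f (x + s *\<^sub>R axis i 1)" for x j s
    using Cons unfolding periodic_torus_def by (metis add.commute add.assoc)
  then show ?case by (simp add: periodic_torus_def pd_def)
qed simp

lemma smooth_fun_has_vector_derivative:
  assumes "smooth_fun f"
  shows "((\<lambda>s. iter_pd is f (x + s *\<^sub>R axis i 1)) has_vector_derivative iter_pd (i # is) f x) (at 0)"
  using assms by (simp add: smooth_fun_def pd_def vector_derivative_works [symmetric])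

lemma fc_iter_pd:
  fixes f :: "real^'m::finite \<Rightarrow> complex"
  assumes "smooth_fun f" "periodic_torus f"
  shows "fc (iter_pd is f) k = (\<Prod>i\<leftarrow>is. \<i> * of_int (k i)) * fc f k"
proof (induction "is")
  case (Cons i "is")
  have "fc (iter_pd (i # is) f) k = \<i> * of_int (k i) * fc (iter_pd is f) k"
  proof (rule fc_derivative)
    show "continuous_on UNIV (iter_pd is f)" "continuous_on UNIV (iter_pd (i # is) f)"
      using assms(1) unfolding smooth_fun_def by blast+
  qed (auto intro!: periodic_iter_pd assms(2) smooth_fun_has_vector_derivative[OF assms(1), simplified])
  then show ?case using Cons by simp
qed simp

context weight
begin

text \<open>Differentiating n times in the coordinate with the largest |k_i| bounds r^n |fc f k|,
  and the best n turns this into decay. \<open>K\<close> and \<open>\<delta>\<close> are uniform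
  over the step and the norm enters linearly: this is what continuity on each Banach step
  requires.\<close>

lemma fc_decay:
  assumes "0 < lam"
  shows "\<exists>K \<delta>. K > 0 \<and> \<delta> > 0 \<and> (\<forall>f \<in> (E_step \<omega> lam :: (real^'m::finite \<Rightarrow> complex) set). \<forall>k.
     cmod (fc f k) \<le> rnorm \<omega> lam f * K * exp (- \<delta> * \<omega> (nrm k)))"
proof -
  let ?m = "real CARD('m)"
  define \<delta> where "\<delta> = lam / (2 * (?m + 2))"
  obtain C where C: "C \<ge> 0" "\<And>t. t \<ge> 1 \<Longrightarrow> (2 / lam) * ln t \<le> \<omega> t + C"
    using ln_le_om[of "2 / lam"] assms by auto
  \<comment> \<open>The first summand serves k = 0, the second one all other k.\<close>
  define K where "K = exp (lam * phi_star \<omega> 0 + \<delta> * \<omega> 1) + exp (lam / 2 * C)"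
  have d: "\<delta> > 0" using assms by (simp add: \<delta>_def add_pos_pos)
  have "cmod (fc f k) \<le> rnorm \<omega> lam f * K * exp (- \<delta> * \<omega> (nrm k))"
    if f: "f \<in> E_step \<omega> lam" for f :: "real^'m \<Rightarrow> complex" and k
  proof -
    have sm: "smooth_fun f" "periodic_torus f" using f by (auto simp: E_step_def)
    have b: "cmod (\<Prod>i\<leftarrow>is. \<i> * of_int (k i)) * cmod (fc f k)
        \<le> rnorm \<omega> lam f * exp (lam * phi_star \<omega> (real (length is) / lam))" for "is"
      unfolding norm_mult [symmetric] fc_iter_pd[OF sm, symmetric]
    proof (rule norm_fc_le)
      show "continuous_on UNIV (iter_pd is f)" using sm by (simp add: smooth_fun_def)
    qed (rule iter_pd_le_rnorm[OF f])
    note R = rnorm_nonneg[OF f]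
    show ?thesis
    proof (cases "\<forall>i. k i = 0")
      case True
      have "cmod (fc f k) \<le> rnorm \<omega> lam f * exp (lam * phi_star \<omega> 0)" using b[of "[]"] by simp
      also have "\<dots> = rnorm \<omega> lam f * (exp (lam * phi_star \<omega> 0 + \<delta> * \<omega> 1) * exp (- \<delta> * \<omega> (nrm k)))"
        using True by (simp add: nrm_def flip: exp_add)
      also have "\<dots> \<le> rnorm \<omega> lam f * (K * exp (- \<delta> * \<omega> (nrm k)))"
        by (intro mult_left_mono mult_right_mono R) (auto simp: K_def)
      finally show ?thesis by (simp add: mult.assoc)
    next
      case False
      have "Max (range (\<lambda>i. \<bar>k i\<bar>)) \<in> range (\<lambda>i. \<bar>k i\<bar>)" by (rule Max_in) auto
      then obtain i where "Max (range (\<lambda>i. \<bar>k i\<bar>)) = \<bar>k i\<bar>" by (rule rangeE)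
      then have i: "\<bar>k j\<bar> \<le> \<bar>k i\<bar>" for j using Max_ge[of "range (\<lambda>i. \<bar>k i\<bar>)" "\<bar>k j\<bar>"] by auto
      define r where "r = \<bar>real_of_int (k i)\<bar>"
      have "k i \<noteq> 0" using False i by (metis abs_le_zero_iff abs_zero)
      then have r1: "r \<ge> 1" unfolding r_def by (simp flip: of_int_abs)
      obtain n where n: "exp (lam * phi_star \<omega> (real n / lam)) \<le> r ^ n * (r * exp (- lam * \<omega> r))"
        using exp_phi_star_le_power[OF assms r1] by blast
      have "r ^ n * cmod (fc f k) \<le> rnorm \<omega> lam f * exp (lam * phi_star \<omega> (real n / lam))"
        using b[of "replicate n i"] by (simp add: r_def norm_mult norm_power)
      also have "\<dots> \<le> rnorm \<omega> lam f * (r ^ n * (r * exp (- lam * \<omega> r)))"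
        by (intro mult_left_mono n R)
      finally have "r ^ n * cmod (fc f k) \<le> r ^ n * (rnorm \<omega> lam f * (r * exp (- lam * \<omega> r)))"
        by (simp add: algebra_simps)
      then have "cmod (fc f k) \<le> rnorm \<omega> lam f * (r * exp (- lam * \<omega> r))"
        using r1 by simp
      also have "r * exp (- lam * \<omega> r) \<le> K * exp (- \<delta> * \<omega> (nrm k))"
      proof -
        have "(2 / lam) * ln r \<le> \<omega> r + C" by (rule C(2)[OF r1])
        from mult_left_mono[OF this, of "lam / 2"] assms
        have "ln r \<le> lam / 2 * \<omega> r + lam / 2 * C" by (simp add: algebra_simps)
        moreover have "\<delta> * \<omega> (nrm k) \<le> lam / 2 * \<omega> r"
        proof -
          have "nrm k \<le> 1 + (\<Sum>i\<in>(UNIV::'m set). r)"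
            unfolding nrm_def r_def using i by (intro add_left_mono sum_mono) (simp flip: of_int_abs)
          also have "\<dots> \<le> (?m + 1) * r" using r1 by (simp add: algebra_simps)
          finally have "\<omega> (nrm k) \<le> \<omega> ((?m + 1) * r)"
            using nrm_pos[of k] by (intro om_mono) auto
          also have "\<dots> \<le> (?m + 1 + 1) * \<omega> r" using r1 by (intro om_mult) auto
          finally have "\<delta> * \<omega> (nrm k) \<le> \<delta> * ((?m + 2) * \<omega> r)"
            using d by (intro mult_left_mono) (auto simp: algebra_simps)
          also have "\<dots> = lam / 2 * \<omega> r" by (simp add: \<delta>_def divide_simps add_eq_0_iff)
          finally show ?thesis .
        qed
        ultimately have "ln r + - lam * \<omega> r \<le> lam / 2 * C + - \<delta> * \<omega> (nrm k)"
          by (simp add: algebra_simps)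
        then have "exp (ln r + - lam * \<omega> r) \<le> exp (lam / 2 * C + - \<delta> * \<omega> (nrm k))" by simp
        then have "r * exp (- lam * \<omega> r) \<le> exp (lam / 2 * C) * exp (- \<delta> * \<omega> (nrm k))"
          using r1 by (simp only: exp_add exp_ln)
        also have "\<dots> \<le> K * exp (- \<delta> * \<omega> (nrm k))" by (intro mult_right_mono) (auto simp: K_def)
        finally show ?thesis .
      qed
      finally show ?thesis using R by (simp add: mult_left_mono mult.assoc)
    qed
  qed
  moreover have "K > 0" by (simp add: K_def add_pos_pos)
  ultimately show ?thesis using d by blast
qed

definition decays :: "(('m::finite \<Rightarrow> int) \<Rightarrow> complex) \<Rightarrow> bool" where
  "decays c \<longleftrightarrow> (\<exists>C \<delta>. 0 \<le> C \<and> 0 < \<delta> \<and> (\<forall>k. cmod (c k) \<le> C * exp (- \<delta> * \<omega> (nrm k))))"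

text \<open>Young's inequality bounds the power of the size by a constant times exp(\<delta>/2
  \<omega>), so half of the rate survives.\<close>

lemma decays_mult_power:
  assumes "decays c" and p: "\<And>k. cmod (p k) \<le> nrm k ^ n"
  shows "decays (\<lambda>k. p k * c k)"
proof -
  obtain C \<delta> where C: "0 \<le> C" "0 < \<delta>" "\<And>k. cmod (c k) \<le> C * exp (- \<delta> * \<omega> (nrm k))"
    using assms(1) by (auto simp: decays_def)
  let ?P = "exp (\<delta> / 2 * phi_star \<omega> (real n / (\<delta> / 2)))"
  show ?thesis
    unfolding decays_def
  proof (rule exI[of _ "?P * C"], rule exI[of _ "\<delta> / 2"], intro conjI allI)
    fix k
    have "cmod (p k * c k) \<le> (?P * exp (\<delta> / 2 * \<omega> (nrm k))) * (C * exp (- \<delta> * \<omega> (nrm k)))"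
      unfolding norm_mult using power_le_exp_phi_star[of "\<delta> / 2" "nrm k" n] C nrm_ge_one[of k]
      by (intro mult_mono order_trans[OF p]) auto
    also have "\<dots> = ?P * C * exp (\<delta> / 2 * \<omega> (nrm k) + - \<delta> * \<omega> (nrm k))" by (simp only: exp_add mult_ac)
    also have "\<delta> / 2 * \<omega> (nrm k) + - \<delta> * \<omega> (nrm k) = - (\<delta> / 2) * \<omega> (nrm k)" by simp
    finally show "cmod (p k * c k) \<le> ?P * C * exp (- (\<delta> / 2) * \<omega> (nrm k))" .
  qed (use C in auto)
qed

lemma decays_summable:
  assumes "decays c"
  shows "(\<lambda>k. cmod (c k)) summable_on UNIV"
proof -
  obtain C \<delta> where C: "0 < \<delta>" "\<And>k. cmod (c k) \<le> C * exp (- \<delta> * \<omega> (nrm k))"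
    using assms by (auto simp: decays_def)
  then show ?thesis
    by (intro summable_on_comparison_test[OF summable_on_cmult_right[OF summable_on_weight[OF C(1)], of C]]) auto
qed

lemmas decays_summable_power = decays_summable[OF decays_mult_power]

lemma norm_prod_list_le: "cmod (\<Prod>i\<leftarrow>is. \<i> * of_int (k i)) \<le> nrm k ^ length is"
proof (induction "is")
  case (Cons i "is")
  have "\<bar>real_of_int (k i)\<bar> \<le> nrm k" using nrm_ge[of k i] by simp
  then show ?case using Cons nrm_pos[of k] by (auto simp: norm_mult intro!: mult_mono)
qed simp

lemma has_vector_derivative_Ffun_prod:
  assumes "decays c"
  shows "((\<lambda>s. Ffun (\<lambda>k. (\<Prod>j\<leftarrow>is. \<i> * of_int (k j)) * c k) (x + s *\<^sub>R axis i 1)) has_vector_derivative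
    Ffun (\<lambda>k. (\<Prod>j\<leftarrow>(i # is). \<i> * of_int (k j)) * c k) x) (at 0)"
proof -
  have "(\<lambda>k. \<bar>real_of_int (k i)\<bar> * cmod ((\<Prod>j\<leftarrow>is. \<i> * of_int (k j)) * c k)) summable_on UNIV"
    using decays_summable_power[OF assms norm_prod_list_le[of _ "i # is"]] by (simp add: norm_mult mult.assoc)
  from has_vector_derivative_Ffun[OF decays_summable_power[OF assms norm_prod_list_le[of _ "is"]] this]
  show ?thesis by (simp add: mult.assoc)
qed

lemma iter_pd_Ffun:
  assumes "decays c"
  shows "iter_pd is (Ffun c) = Ffun (\<lambda>k. (\<Prod>i\<leftarrow>is. \<i> * of_int (k i)) * c k)"
proof (induction "is")
  case (Cons i "is")
  show ?case
    using vector_derivative_at[OF has_vector_derivative_Ffun_prod[OF assms, of "is" _ i]]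
    by (simp add: fun_eq_iff pd_def Cons)
qed simp

lemma pd_Ffun: "decays c \<Longrightarrow> pd i (Ffun c) = Ffun (\<lambda>k. \<i> * of_int (k i) * c k)"
  using iter_pd_Ffun[of c "[i]"] by simp

lemma smooth_fun_Ffun:
  assumes "decays c"
  shows "smooth_fun (Ffun c)"
  unfolding smooth_fun_def iter_pd_Ffun[OF assms]
  using has_vector_derivative_Ffun_prod[OF assms]
  by (auto intro!: continuous_on_Ffun decays_summable_power assms norm_prod_list_le
      simp: differentiable_def has_vector_derivative_def)

text \<open>One half of the rate absorbs the powers of k brought in by derivatives, with exactly the
  constant that the norm divides out; the other half makes the sum converge. The norm bound is
  linear in C, so a tail with a small constant is small in one fixed Banach step.\<close>

lemma Ffun_in_E_step:
  fixes c :: "('m::finite \<Rightarrow> int) \<Rightarrow> complex"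
  assumes C: "0 \<le> C" "\<And>k. cmod (c k) \<le> C * exp (- \<delta> * \<omega> (nrm k))" and lam: "0 < lam" "lam \<le> \<delta> / 2"
  shows "Ffun c \<in> E_step \<omega> lam"
    and "rnorm \<omega> lam (Ffun c) \<le> C * (\<Sum>\<^sub>\<infinity>k::'m \<Rightarrow> int. exp (- (\<delta> / 2) * \<omega> (nrm k)))"
proof -
  let ?Z = "\<Sum>\<^sub>\<infinity>k::'m \<Rightarrow> int. exp (- (\<delta> / 2) * \<omega> (nrm k))"
  have d: "0 < \<delta>" using lam by linarith
  then have dec: "decays c" using C by (auto simp: decays_def)
  have le: "cmod (iter_pd is (Ffun c) x) * exp (- lam * phi_star \<omega> (real (length is) / lam)) \<le> C * ?Z" for "is" x
  proof -
    let ?P = "exp (lam * phi_star \<omega> (real (length is) / lam))"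
    have "cmod (iter_pd is (Ffun c) x) \<le> (\<Sum>\<^sub>\<infinity>k. cmod ((\<Prod>i\<leftarrow>is. \<i> * of_int (k i)) * c k))"
      unfolding iter_pd_Ffun[OF dec]
      by (rule norm_Ffun_le[OF decays_summable_power[OF dec norm_prod_list_le]])
    also have "\<dots> \<le> (\<Sum>\<^sub>\<infinity>k::'m \<Rightarrow> int. ?P * C * exp (- (\<delta> / 2) * \<omega> (nrm k)))"
    proof (rule infsum_mono)
      show "(\<lambda>k. cmod ((\<Prod>i\<leftarrow>is. \<i> * of_int (k i)) * c k)) summable_on UNIV"
        by (rule decays_summable_power[OF dec norm_prod_list_le])
      show "(\<lambda>k::'m \<Rightarrow> int. ?P * C * exp (- (\<delta> / 2) * \<omega> (nrm k))) summable_on UNIV"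
        using d by (intro summable_on_cmult_right summable_on_weight) auto
      fix k :: "'m \<Rightarrow> int"
      have "cmod ((\<Prod>i\<leftarrow>is. \<i> * of_int (k i)) * c k) \<le> (?P * exp (lam * \<omega> (nrm k))) * (C * exp (- \<delta> * \<omega> (nrm k)))"
        unfolding norm_mult using power_le_exp_phi_star[OF lam(1) nrm_ge_one, of k "length is"] C
        by (intro mult_mono order_trans[OF norm_prod_list_le]) auto
      also have "\<dots> = ?P * C * exp (lam * \<omega> (nrm k) + - \<delta> * \<omega> (nrm k))" by (simp only: exp_add mult_ac)
      also have "\<dots> \<le> ?P * C * exp (- (\<delta> / 2) * \<omega> (nrm k))"
        using C(1) mult_right_mono[OF lam(2) om_nrm_nonneg[of k]] by (intro mult_left_mono) auto
      finally show "cmod ((\<Prod>i\<leftarrow>is. \<i> * of_int (k i)) * c k) \<le> ?P * C * exp (- (\<delta> / 2) * \<omega> (nrm k))" .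
    qed
    also have "\<dots> = ?P * C * ?Z" by (rule infsum_cmult_right')
    finally have "cmod (iter_pd is (Ffun c) x) \<le> ?P * C * ?Z" .
    then have "cmod (iter_pd is (Ffun c) x) * exp (- lam * phi_star \<omega> (real (length is) / lam))
       \<le> ?P * C * ?Z * exp (- lam * phi_star \<omega> (real (length is) / lam))"
      by (intro mult_right_mono) auto
    also have "\<dots> = C * ?Z" by (simp add: exp_minus divide_simps)
    finally show ?thesis .
  qed
  then have bd: "bdd_above (weighted_vals \<omega> lam (Ffun c))"
    unfolding weighted_vals_def by (intro bdd_aboveI[of _ "C * ?Z"]) auto
  show "Ffun c \<in> E_step \<omega> lam"
    unfolding E_step_def using bd smooth_fun_Ffun[OF dec] periodic_Ffun[of c] by simp
  show "rnorm \<omega> lam (Ffun c) \<le> C * ?Z"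
    unfolding rnorm_def
    by (rule cSup_least) (use le in \<open>auto simp: weighted_vals_def\<close>)
qed

lemma E_roumieu_imp_decays:
  assumes "f \<in> E_roumieu \<omega>"
  shows "decays (fc f)" and "f = Ffun (fc f)"
proof -
  obtain lam where lam: "lam > 0" "f \<in> E_step \<omega> lam" using assms by (auto simp: E_roumieu_def)
  obtain K \<delta> where K: "K > 0" "\<delta> > 0" "\<And>k. cmod (fc f k) \<le> rnorm \<omega> lam f * K * exp (- \<delta> * \<omega> (nrm k))"
    using fc_decay[OF lam(1)] lam(2) by blast
  then show d: "decays (fc f)"
    unfolding decays_def using rnorm_nonneg[OF lam(2)] by (intro exI[of _ "rnorm \<omega> lam f * K"] exI[of _ \<delta>]) auto
  have "continuous_on UNIV (iter_pd [] f)" "periodic_torus f"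
    using lam(2) unfolding E_step_def smooth_fun_def by blast+
  then show "f = Ffun (fc f)" using decays_summable[OF d] by (intro fourier_inversion) auto
qed

lemma Ffun_in_E_roumieu:
  assumes "decays c"
  shows "Ffun c \<in> E_roumieu \<omega>"
proof -
  obtain C \<delta> where C: "0 \<le> C" "0 < \<delta>" "\<And>k. cmod (c k) \<le> C * exp (- \<delta> * \<omega> (nrm k))"
    using assms by (auto simp: decays_def)
  have "Ffun c \<in> E_step \<omega> (\<delta> / 2)" by (rule Ffun_in_E_step(1)[OF C(1,3)]) (use C in auto)
  then show ?thesis using C(2) by (auto simp: E_roumieu_def intro!: exI[of _ "\<delta> / 2"])
qed

lemma fc_Ffun_decays: "decays c \<Longrightarrow> fc (Ffun c) = c"
  using fc_Ffun[OF decays_summable] by blast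

end

section \<open>The operator on Fourier coefficients\<close>

lemma infsum_finite_sum:
  fixes f :: "'j \<Rightarrow> 'k \<Rightarrow> 'c::{topological_comm_monoid_add,t2_space}"
  assumes "finite A" "\<And>j. j \<in> A \<Longrightarrow> f j summable_on B"
  shows "(\<lambda>k. \<Sum>j\<in>A. f j k) summable_on B" "infsum (\<lambda>k. \<Sum>j\<in>A. f j k) B = (\<Sum>j\<in>A. infsum (f j) B)"
  using assms by (induction A) (simp_all add: infsum_add summable_on_add)

section \<open>Algebra of coefficient sequences and their duality\<close>

context weight
begin

lemma decays_add:
  fixes c d :: "('m::finite \<Rightarrow> int) \<Rightarrow> complex"
  assumes "decays c" "decays d"
  shows "decays (\<lambda>k. c k + d k)"
proof -
  obtain C \<delta> where C: "0 \<le> C" "0 < \<delta>" "\<And>k. cmod (c k) \<le> C * exp (- \<delta> * \<omega> (nrm k))"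
    using assms(1) by (auto simp: decays_def)
  obtain D \<eta> where D: "0 \<le> D" "0 < \<eta>" "\<And>k. cmod (d k) \<le> D * exp (- \<eta> * \<omega> (nrm k))"
    using assms(2) by (auto simp: decays_def)
  show ?thesis
    unfolding decays_def
  proof (rule exI[of _ "C + D"], rule exI[of _ "min \<delta> \<eta>"], intro conjI allI)
    fix k :: "'m \<Rightarrow> int"
    have "C * exp (- \<delta> * \<omega> (nrm k)) \<le> C * exp (- min \<delta> \<eta> * \<omega> (nrm k))"
      "D * exp (- \<eta> * \<omega> (nrm k)) \<le> D * exp (- min \<delta> \<eta> * \<omega> (nrm k))"
      using C(1) D(1) om_nrm_nonneg[of k] by (auto intro!: mult_left_mono mult_right_mono)
    then show "cmod (c k + d k) \<le> (C + D) * exp (- min \<delta> \<eta> * \<omega> (nrm k))"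
      using norm_triangle_ineq[of "c k" "d k"] C(3)[of k] D(3)[of k] unfolding distrib_right by linarith
  qed (use C D in auto)
qed

lemma decays_zero: "decays (\<lambda>k. 0)"
  unfolding decays_def by (intro exI[of _ 0] exI[of _ 1]) auto

lemma decays_cmult: "decays d \<Longrightarrow> decays (\<lambda>k. c * d k)"
proof -
  assume "decays d"
  then obtain C \<delta> where C: "0 \<le> C" "0 < \<delta>" "\<And>k. cmod (d k) \<le> C * exp (- \<delta> * \<omega> (nrm k))"
    by (auto simp: decays_def)
  have "cmod (c * d k) \<le> cmod c * C * exp (- \<delta> * \<omega> (nrm k))" for k
    using mult_left_mono[OF C(3)[of k], of "cmod c"] by (simp add: norm_mult mult.assoc)
  then show ?thesis
    unfolding decays_def using C by (intro exI[of _ "cmod c * C"] exI[of _ \<delta>]) auto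
qed

lemma decays_sum: "finite A \<Longrightarrow> (\<And>j. j \<in> A \<Longrightarrow> decays (c j)) \<Longrightarrow> decays (\<lambda>k. \<Sum>j\<in>A. c j k)"
  by (induction A rule: finite_induct) (simp_all add: decays_zero decays_add)

lemma decays_mult_index: "decays c \<Longrightarrow> decays (\<lambda>k. \<i> * of_int (k i) * c k)"
  using decays_mult_power[OF _ norm_prod_list_le, of c "[i]"] by simp

definition grows :: "(('m::finite \<Rightarrow> int) \<Rightarrow> complex) \<Rightarrow> bool" where
  "grows m \<longleftrightarrow> (\<forall>\<epsilon>>0. \<exists>C\<ge>0. \<forall>k. cmod (m k) \<le> C * exp (\<epsilon> * \<omega> (nrm k)))"

lemma decays_imp_grows:
  fixes c :: "('m::finite \<Rightarrow> int) \<Rightarrow> complex"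
  assumes "decays c"
  shows "grows c"
  unfolding grows_def
proof (intro allI impI)
  fix \<epsilon> :: real assume e: "\<epsilon> > 0"
  obtain C \<delta> where C: "0 \<le> C" "0 < \<delta>" "\<And>k. cmod (c k) \<le> C * exp (- \<delta> * \<omega> (nrm k))"
    using assms by (auto simp: decays_def)
  have "C * exp (- \<delta> * \<omega> (nrm k)) \<le> C * exp (\<epsilon> * \<omega> (nrm k))" for k :: "'m \<Rightarrow> int"
  proof -
    have "0 \<le> \<delta> * \<omega> (nrm k)" "0 \<le> \<epsilon> * \<omega> (nrm k)" using C(2) e om_nrm_nonneg[of k] by auto
    then show ?thesis using C(1) by (intro mult_left_mono) auto
  qed
  then show "\<exists>C\<ge>0. \<forall>k. cmod (c k) \<le> C * exp (\<epsilon> * \<omega> (nrm k))"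
    using C by (meson order_trans)
qed

lemma grows_uminus_index: "grows c \<Longrightarrow> grows (\<lambda>k. c (\<lambda>i. - k i))"
  unfolding grows_def by (metis nrm_uminus)

lemma grows_mult_decays:
  assumes "grows m" "decays c"
  shows "decays (\<lambda>k. m k * c k)"
proof -
  obtain C \<delta> where C: "0 \<le> C" "0 < \<delta>" "\<And>k. cmod (c k) \<le> C * exp (- \<delta> * \<omega> (nrm k))"
    using assms(2) by (auto simp: decays_def)
  obtain D where D: "0 \<le> D" "\<And>k. cmod (m k) \<le> D * exp (\<delta> / 2 * \<omega> (nrm k))"
    using assms(1) C(2) unfolding grows_def by (metis half_gt_zero)
  show ?thesis unfolding decays_def
  proof (rule exI[of _ "D * C"], rule exI[of _ "\<delta> / 2"], intro conjI allI)
    fix k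
    have "cmod (m k * c k) \<le> (D * exp (\<delta> / 2 * \<omega> (nrm k))) * (C * exp (- \<delta> * \<omega> (nrm k)))"
      unfolding norm_mult by (intro mult_mono C D) (use D in auto)
    also have "\<dots> = D * C * exp (\<delta> / 2 * \<omega> (nrm k) + - \<delta> * \<omega> (nrm k))" by (simp only: exp_add mult_ac)
    also have "\<delta> / 2 * \<omega> (nrm k) + - \<delta> * \<omega> (nrm k) = - (\<delta> / 2) * \<omega> (nrm k)" by simp
    finally show "cmod (m k * c k) \<le> D * C * exp (- (\<delta> / 2) * \<omega> (nrm k))" .
  qed (use C D in auto)
qed

lemma Ffun_add:
  fixes c d :: "('m::finite \<Rightarrow> int) \<Rightarrow> complex"
  assumes "decays c" "decays d"
  shows "Ffun (\<lambda>k. c k + d k) x = Ffun c x + Ffun d x"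
proof -
  have "(\<lambda>k. e k * ee k x) summable_on UNIV" if "decays e" for e :: "('m \<Rightarrow> int) \<Rightarrow> complex"
    by (rule abs_summable_summable) (use decays_summable[OF that] in \<open>simp add: norm_mult\<close>)
  then show ?thesis unfolding Ffun_def distrib_right using assms by (intro infsum_add) auto
qed

lemma Ffun_cmult: "Ffun (\<lambda>k. c * d k) x = c * Ffun d x"
  unfolding Ffun_def by (simp add: mult.assoc infsum_cmult_right')

lemma Ffun_zero: "Ffun (\<lambda>k. 0) x = 0"
  unfolding Ffun_def by simp

lemma Ffun_sum:
  "finite A \<Longrightarrow> (\<And>j. j \<in> A \<Longrightarrow> decays (c j)) \<Longrightarrow> Ffun (\<lambda>k. \<Sum>j\<in>A. c j k) x = (\<Sum>j\<in>A. Ffun (c j) x)"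
  by (induction A rule: finite_induct) (simp_all add: Ffun_zero Ffun_add decays_sum)

lemma E_roumieu_add:
  assumes "f \<in> E_roumieu \<omega>" "g \<in> E_roumieu \<omega>"
  shows "(\<lambda>x. f x + g x) \<in> E_roumieu \<omega>" "fc (\<lambda>x. f x + g x) = (\<lambda>k. fc f k + fc g k)"
proof -
  note f = E_roumieu_imp_decays[OF assms(1)] and g = E_roumieu_imp_decays[OF assms(2)]
  have "Ffun (\<lambda>k. fc f k + fc g k) x = f x + g x" for x
    using Ffun_add[OF f(1) g(1), of x] f(2) g(2) by simp
  then have e: "(\<lambda>x. f x + g x) = Ffun (\<lambda>k. fc f k + fc g k)" by (simp add: fun_eq_iff)
  show "(\<lambda>x. f x + g x) \<in> E_roumieu \<omega>" "fc (\<lambda>x. f x + g x) = (\<lambda>k. fc f k + fc g k)"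
    unfolding e by (intro Ffun_in_E_roumieu fc_Ffun_decays decays_add f(1) g(1))+
qed

lemma E_roumieu_cmult:
  assumes "f \<in> E_roumieu \<omega>"
  shows "(\<lambda>x. c * f x) \<in> E_roumieu \<omega>" "fc (\<lambda>x. c * f x) = (\<lambda>k. c * fc f k)"
proof -
  note f = E_roumieu_imp_decays[OF assms(1)]
  have "Ffun (\<lambda>k. c * fc f k) x = c * f x" for x
    using Ffun_cmult[of c "fc f" x] f(2) by simp
  then have e: "(\<lambda>x. c * f x) = Ffun (\<lambda>k. c * fc f k)" by (simp add: fun_eq_iff)
  show "(\<lambda>x. c * f x) \<in> E_roumieu \<omega>" "fc (\<lambda>x. c * f x) = (\<lambda>k. c * fc f k)"
    unfolding e by (intro Ffun_in_E_roumieu fc_Ffun_decays decays_cmult f(1))+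
qed

text \<open>The reflection of k makes this the normalised integral pairing: for decaying m it is the
  integral of \<open>Ffun m\<close> against \<open>\<phi>\<close>, divided by the volume of the
  torus. The value 0 outside the class is the canonical representative demanded by
  \<open>E_dual\<close>.\<close>

definition mu_of :: "(('m::finite \<Rightarrow> int) \<Rightarrow> complex) \<Rightarrow> (real^'m \<Rightarrow> complex) \<Rightarrow> complex" where
  "mu_of m \<phi> = (if \<phi> \<in> E_roumieu \<omega> then \<Sum>\<^sub>\<infinity>k. m (\<lambda>i. - k i) * fc \<phi> k else 0)"

lemma summable_pairing:
  assumes "grows m" "decays c"
  shows "(\<lambda>k. cmod (m (\<lambda>i. - k i) * c k)) summable_on UNIV" "(\<lambda>k. m (\<lambda>i. - k i) * c k) summable_on UNIV"
proof -
  show *: "(\<lambda>k. cmod (m (\<lambda>i. - k i) * c k)) summable_on UNIV"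
    by (rule decays_summable[OF grows_mult_decays[OF grows_uminus_index[OF assms(1)] assms(2)]])
  show "(\<lambda>k. m (\<lambda>i. - k i) * c k) summable_on UNIV"
    by (rule abs_summable_summable[OF *])
qed

text \<open>On each step the coefficients decay at a rate \<delta> depending on the step, and the
  growth of m is then used at rate \<delta>/2, which leaves a summable series. Choosing the growth
  rate after \<delta> is possible because \<open>grows\<close> quantifies over all positive
  rates.\<close>

lemma mu_of_in_E_dual:
  fixes m :: "('m::finite \<Rightarrow> int) \<Rightarrow> complex"
  assumes m: "grows m"
  shows "mu_of m \<in> E_dual \<omega>"
  unfolding E_dual_def
proof (intro CollectI conjI ballI allI impI)
  fix f g :: "real^'m \<Rightarrow> complex" assume fg: "f \<in> E_roumieu \<omega>" "g \<in> E_roumieu \<omega>"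
  show "mu_of m (\<lambda>x. f x + g x) = mu_of m f + mu_of m g"
    unfolding mu_of_def E_roumieu_add(2)[OF fg] distrib_left
    using E_roumieu_add(1)[OF fg] fg
      infsum_add[OF summable_pairing(2)[OF m] summable_pairing(2)[OF m], OF E_roumieu_imp_decays(1)[OF fg(1)]
       E_roumieu_imp_decays(1)[OF fg(2)]] by simp
next
  fix f :: "real^'m \<Rightarrow> complex" and c assume f: "f \<in> E_roumieu \<omega>"
  have "(\<Sum>\<^sub>\<infinity>k. m (\<lambda>i. - k i) * (c * fc f k)) = c * (\<Sum>\<^sub>\<infinity>k. m (\<lambda>i. - k i) * fc f k)"
    by (subst infsum_cmult_right' [symmetric]) (simp add: mult_ac)
  then show "mu_of m (\<lambda>x. c * f x) = c * mu_of m f"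
    using E_roumieu_cmult[OF f, of c] f by (simp add: mu_of_def)
next
  fix f :: "real^'m \<Rightarrow> complex" assume "f \<notin> E_roumieu \<omega>"
  then show "mu_of m f = 0" by (simp add: mu_of_def)
next
  fix n :: nat assume n: "1 \<le> n"
  let ?lam = "1 / real n"
  have lam: "?lam > 0" using n by simp
  obtain K \<delta> where K: "K > 0" "\<delta> > 0" "\<And>f k. f \<in> (E_step \<omega> ?lam :: (real^'m \<Rightarrow> complex) set) \<Longrightarrow>
      cmod (fc f k) \<le> rnorm \<omega> ?lam f * K * exp (- \<delta> * \<omega> (nrm k))"
    using fc_decay[OF lam, where 'm='m] by blast
  obtain C where C: "C \<ge> 0" "\<And>k. cmod (m k) \<le> C * exp (\<delta> / 2 * \<omega> (nrm k))"
    using m K(2) unfolding grows_def by (metis half_gt_zero)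
  let ?Z = "\<Sum>\<^sub>\<infinity>k::'m \<Rightarrow> int. exp (- (\<delta> / 2) * \<omega> (nrm k))"
  show "\<exists>C. \<forall>f\<in>E_step \<omega> ?lam. cmod (mu_of m f) \<le> C * rnorm \<omega> ?lam f"
  proof (intro exI[of _ "C * K * ?Z"] ballI)
    fix f :: "real^'m \<Rightarrow> complex" assume f: "f \<in> E_step \<omega> ?lam"
    then have fE: "f \<in> E_roumieu \<omega>" using lam unfolding E_roumieu_def by blast
    let ?R = "rnorm \<omega> ?lam f"
    have "cmod (\<Sum>\<^sub>\<infinity>k. m (\<lambda>i. - k i) * fc f k) \<le> (\<Sum>\<^sub>\<infinity>k. cmod (m (\<lambda>i. - k i) * fc f k))"
      by (rule norm_infsum_bound[OF summable_pairing(1)[OF m E_roumieu_imp_decays(1)[OF fE]]])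
    also have "\<dots> \<le> (\<Sum>\<^sub>\<infinity>k::'m \<Rightarrow> int. C * K * ?R * exp (- (\<delta> / 2) * \<omega> (nrm k)))"
    proof (rule infsum_mono)
      show "(\<lambda>k. cmod (m (\<lambda>i. - k i) * fc f k)) summable_on UNIV"
        by (rule summable_pairing(1)[OF m E_roumieu_imp_decays(1)[OF fE]])
      show "(\<lambda>k::'m \<Rightarrow> int. C * K * ?R * exp (- (\<delta> / 2) * \<omega> (nrm k))) summable_on UNIV"
        using K by (intro summable_on_cmult_right summable_on_weight) auto
      fix k :: "'m \<Rightarrow> int"
      have "cmod (m (\<lambda>i. - k i) * fc f k) \<le> (C * exp (\<delta> / 2 * \<omega> (nrm k))) * (?R * K * exp (- \<delta> * \<omega> (nrm k)))"
        unfolding norm_mult using C(1) C(2)[of "\<lambda>i. - k i"] K(3)[OF f] by (intro mult_mono) auto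
      also have "\<dots> = C * K * ?R * exp (\<delta> / 2 * \<omega> (nrm k) + - \<delta> * \<omega> (nrm k))" by (simp only: exp_add mult_ac)
      also have "\<delta> / 2 * \<omega> (nrm k) + - \<delta> * \<omega> (nrm k) = - (\<delta> / 2) * \<omega> (nrm k)" by simp
      finally show "cmod (m (\<lambda>i. - k i) * fc f k) \<le> C * K * ?R * exp (- (\<delta> / 2) * \<omega> (nrm k))" .
    qed
    also have "\<dots> = C * K * ?Z * ?R" by (subst infsum_cmult_right') (simp add: mult_ac)
    finally show "cmod (mu_of m f) \<le> C * K * ?Z * ?R" using fE by (simp add: mu_of_def)
  qed
qed

lemma torus_integral_pairing:
  fixes c :: "('m::finite \<Rightarrow> int) \<Rightarrow> complex"
  assumes c: "decays c" and \<phi>: "\<phi> \<in> E_roumieu \<omega>"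
  shows "torus_integral (\<lambda>v. Ffun c v * \<phi> v) = of_real ((2 * pi) ^ CARD('m)) * mu_of c \<phi>"
proof -
  let ?V = "complex_of_real ((2 * pi) ^ CARD('m))"
  note p = E_roumieu_imp_decays[OF \<phi>]
  have cp: "continuous_on UNIV \<phi>" by (subst p(2)) (rule continuous_on_Ffun[OF decays_summable[OF p(1)]])
  have bp: "norm (\<phi> x) \<le> (\<Sum>\<^sub>\<infinity>k. norm (fc \<phi> k))" for x
    by (subst p(2)) (rule norm_Ffun_le[OF decays_summable[OF p(1)]])
  have "torus_integral (\<lambda>v. \<phi> v * Ffun c v) = (\<Sum>\<^sub>\<infinity>k. c k * torus_integral (\<lambda>x. \<phi> x * ee k x))"
    by (rule torus_integral_mult_Ffun[OF decays_summable[OF c] cp bp])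
  also have "\<dots> = (\<Sum>\<^sub>\<infinity>k. (\<lambda>k. c (\<lambda>i. - k i) * torus_integral (\<lambda>x. \<phi> x * ee (\<lambda>i. - k i) x)) (\<lambda>i. - k i))"
    by simp
  also have "\<dots> = (\<Sum>\<^sub>\<infinity>k. c (\<lambda>i. - k i) * torus_integral (\<lambda>x. \<phi> x * ee (\<lambda>i. - k i) x))"
    by (rule infsum_reindex_bij_betw) (rule bij_betw_byWitness[where f'="\<lambda>k i. - k i"], auto)
  also have "\<dots> = (\<Sum>\<^sub>\<infinity>k. ?V * (c (\<lambda>i. - k i) * fc \<phi> k))"
    by (rule infsum_cong) (simp add: fc_def)
  also have "\<dots> = ?V * mu_of c \<phi>" using \<phi> by (simp add: mu_of_def infsum_cmult_right')
  finally show ?thesis by (simp add: mult.commute)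
qed

end

section \<open>Fourier coefficients in the single variable t, and convolution in the first
  frequency\<close>

definition fc1 :: "(real \<Rightarrow> complex) \<Rightarrow> int \<Rightarrow> complex" where
  "fc1 u \<tau> = fc (\<lambda>v::real^1. u (v $ 1)) (\<lambda>_. \<tau>)"

lemma bij_int_fun1: "bij_betw (\<lambda>\<tau>. (\<lambda>_::1. \<tau>)) (UNIV :: int set) UNIV"
proof -
  have "(\<lambda>_. k 1) = k" for k :: "1 \<Rightarrow> int" by (rule ext) (metis num1_eq1)
  then show ?thesis by (intro bij_betw_byWitness[where f'="\<lambda>k. k 1"]) auto
qed

lemma ee_fun1: "ee (\<lambda>_::1. \<tau>) v = cis (of_int \<tau> * v $ 1)"
  by (simp add: ee_def)

lemma nrm_fun1: "nrm (\<lambda>_::1. \<tau>) = 1 + \<bar>of_int \<tau>\<bar>"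
  by (simp add: nrm_def)

lemma Ffun_fun1: "Ffun c (v :: real^1) = (\<Sum>\<^sub>\<infinity>\<tau>. c (\<lambda>_. \<tau>) * cis (of_int \<tau> * v $ 1))"
  unfolding Ffun_def using infsum_reindex_bij_betw[OF bij_int_fun1, of "\<lambda>k. c k * ee k v"]
  by (simp add: ee_fun1)

context weight
begin

lemma summable_on_weight_int: "0 < \<delta> \<Longrightarrow> (\<lambda>\<sigma>::int. exp (- \<delta> * \<omega> (1 + \<bar>of_int \<sigma>\<bar>))) summable_on UNIV"
  using summable_on_weight[of \<delta>, where 'm=1]
    summable_on_reindex_bij_betw[OF bij_int_fun1, of "\<lambda>k. exp (- \<delta> * \<omega> (nrm k))"]
  by (simp add: nrm_fun1)

lemma lift_T1_expansion:
  assumes "lift_T1 q \<in> E_roumieu \<omega>"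
  shows "\<exists>C \<delta>. 0 \<le> C \<and> 0 < \<delta> \<and> (\<forall>\<tau>. cmod (fc1 (\<lambda>t. of_real (q t)) \<tau>) \<le> C * exp (- \<delta> * \<omega> (1 + \<bar>of_int \<tau>\<bar>)))"
    and "(\<lambda>\<tau>. cmod (fc1 (\<lambda>t. of_real (q t)) \<tau>)) summable_on UNIV"
    and "of_real (q t) = (\<Sum>\<^sub>\<infinity>\<tau>. fc1 (\<lambda>t. of_real (q t)) \<tau> * cis (of_int \<tau> * t))"
proof -
  have fc1: "fc1 (\<lambda>t. of_real (q t)) \<tau> = fc (lift_T1 q) (\<lambda>_. \<tau>)" for \<tau>
    by (simp add: fc1_def lift_T1_def [abs_def])
  note d = E_roumieu_imp_decays[OF assms]
  show "\<exists>C \<delta>. 0 \<le> C \<and> 0 < \<delta> \<and> (\<forall>\<tau>. cmod (fc1 (\<lambda>t. of_real (q t)) \<tau>) \<le> C * exp (- \<delta> * \<omega> (1 + \<bar>of_int \<tau>\<bar>)))"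
    using d(1) unfolding decays_def fc1 by (metis nrm_fun1)
  show "(\<lambda>\<tau>. cmod (fc1 (\<lambda>t. of_real (q t)) \<tau>)) summable_on UNIV"
    unfolding fc1 using summable_on_reindex_bij_betw[OF bij_int_fun1, of "\<lambda>k. cmod (fc (lift_T1 q) k)"]
      decays_summable[OF d(1)] by blast
  have "of_real (q t) = lift_T1 q (\<chi> i. t)" by (simp add: lift_T1_def)
  also have "\<dots> = Ffun (fc (lift_T1 q)) (\<chi> i. t)" using d(2) by simp
  also have "\<dots> = (\<Sum>\<^sub>\<infinity>\<tau>. fc1 (\<lambda>t. of_real (q t)) \<tau> * cis (of_int \<tau> * t))"
    unfolding fc1 Ffun_fun1 by simp
  finally show "of_real (q t) = (\<Sum>\<^sub>\<infinity>\<tau>. fc1 (\<lambda>t. of_real (q t)) \<tau> * cis (of_int \<tau> * t))" .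
qed

end

definition conv :: "(int \<Rightarrow> complex) \<Rightarrow> (('n option \<Rightarrow> int) \<Rightarrow> complex) \<Rightarrow> ('n option \<Rightarrow> int) \<Rightarrow> complex" where
  "conv p w k = (\<Sum>\<^sub>\<infinity>\<sigma>. p \<sigma> * w (k(None := k None - \<sigma>)))"

text \<open>Fubini for a double series that is dominated by a product after substituting k = l +
  \<sigma> in the index \<open>None\<close>. It moves the shift of a convolution from one factor to
  the other.\<close>

lemma infsum_conv_shift:
  fixes G :: "int \<Rightarrow> ('n::finite option \<Rightarrow> int) \<Rightarrow> complex"
  assumes G: "\<And>\<sigma> k. cmod (G \<sigma> k) \<le> P \<sigma> * Q (k(None := k None - \<sigma>))"
    and P: "P summable_on UNIV" and Q: "Q summable_on UNIV"
  shows "(\<Sum>\<^sub>\<infinity>k. \<Sum>\<^sub>\<infinity>\<sigma>. G \<sigma> k) = (\<Sum>\<^sub>\<infinity>l. \<Sum>\<^sub>\<infinity>\<sigma>. G \<sigma> (l(None := l None + \<sigma>)))"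
    and "(\<lambda>l. \<Sum>\<^sub>\<infinity>\<sigma>. G \<sigma> (l(None := l None + \<sigma>))) summable_on UNIV"
    and "(\<lambda>k. \<Sum>\<^sub>\<infinity>\<sigma>. G \<sigma> k) summable_on UNIV"
proof -
  let ?G = "\<lambda>\<sigma> l. G \<sigma> (l(None := l None + \<sigma>))"
  have bnd: "cmod (?G \<sigma> l) \<le> P \<sigma> * Q l" for \<sigma> l
    using G[of \<sigma> "l(None := l None + \<sigma>)"] by simp
  have bij: "bij_betw (\<lambda>l. l(None := l None + \<sigma>)) UNIV (UNIV :: ('n option \<Rightarrow> int) set)" for \<sigma>
    by (rule bij_betw_byWitness[where f'="\<lambda>l. l(None := l None - \<sigma>)"]) auto
  have bij2: "bij_betw (\<lambda>(\<sigma>, l). (\<sigma>, l(None := l None + \<sigma>))) UNIV (UNIV :: (int \<times> ('n option \<Rightarrow> int)) set)"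
    by (rule bij_betw_byWitness[where f'="\<lambda>(\<sigma>, l). (\<sigma>, l(None := l None - \<sigma>))"]) auto
  have Pa: "(\<lambda>\<sigma>. \<bar>P \<sigma>\<bar>) summable_on UNIV" and Qa: "(\<lambda>\<sigma>. \<bar>Q \<sigma>\<bar>) summable_on UNIV"
    using P Q summable_on_iff_abs_summable_on_real by fastforce+
  have PQ: "(\<lambda>x. norm (case x of (\<sigma>, l) \<Rightarrow> P \<sigma> * Q l)) summable_on (UNIV \<times> UNIV)"
    unfolding Infinite_Sum.abs_summable_on_Sigma_iff
    using Pa Qa by (auto simp: abs_mult infsum_cmult_right' abs_of_nonneg infsum_nonneg intro!: summable_on_cmult_right summable_on_cmult_left)
  have s1: "(\<lambda>(\<sigma>, l). ?G \<sigma> l) summable_on UNIV \<times> UNIV"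
  proof (rule abs_summable_summable, rule Infinite_Sum.abs_summable_on_comparison_test[OF PQ])
    fix x :: "int \<times> ('n option \<Rightarrow> int)"
    show "norm (case x of (\<sigma>, l) \<Rightarrow> ?G \<sigma> l) \<le> norm (case x of (\<sigma>, l) \<Rightarrow> P \<sigma> * Q l)"
      using bnd[of "fst x" "snd x"] by (simp add: case_prod_unfold)
  qed
  then have s2: "(\<lambda>(\<sigma>, k). G \<sigma> k) summable_on UNIV \<times> UNIV"
    using summable_on_reindex_bij_betw[OF bij2, of "\<lambda>(\<sigma>, k). G \<sigma> k"] by (simp add: case_prod_unfold)
  have "(\<Sum>\<^sub>\<infinity>k. \<Sum>\<^sub>\<infinity>\<sigma>. G \<sigma> k) = (\<Sum>\<^sub>\<infinity>\<sigma>. \<Sum>\<^sub>\<infinity>k. G \<sigma> k)"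
    by (rule infsum_swap_banach [symmetric, OF s2])
  also have "\<dots> = (\<Sum>\<^sub>\<infinity>\<sigma>. \<Sum>\<^sub>\<infinity>l. ?G \<sigma> l)"
    by (intro infsum_cong infsum_reindex_bij_betw[OF bij, symmetric])
  also have "\<dots> = (\<Sum>\<^sub>\<infinity>l. \<Sum>\<^sub>\<infinity>\<sigma>. ?G \<sigma> l)" by (rule infsum_swap_banach[OF s1])
  finally show "(\<Sum>\<^sub>\<infinity>k. \<Sum>\<^sub>\<infinity>\<sigma>. G \<sigma> k) = (\<Sum>\<^sub>\<infinity>l. \<Sum>\<^sub>\<infinity>\<sigma>. ?G \<sigma> l)" .
  have sw: "(\<lambda>(l, \<sigma>). F \<sigma> l) summable_on UNIV \<times> UNIV" if "(\<lambda>(\<sigma>, l). F \<sigma> l) summable_on UNIV \<times> UNIV"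
    for F :: "int \<Rightarrow> ('n option \<Rightarrow> int) \<Rightarrow> complex"
  proof -
    have b: "bij_betw prod.swap UNIV (UNIV :: (int \<times> ('n option \<Rightarrow> int)) set)" by (rule bij_swap)
    show ?thesis
      using that summable_on_reindex_bij_betw[OF b, of "\<lambda>(\<sigma>, l). F \<sigma> l"] by (simp add: case_prod_unfold)
  qed
  show "(\<lambda>l. \<Sum>\<^sub>\<infinity>\<sigma>. ?G \<sigma> l) summable_on UNIV" "(\<lambda>k. \<Sum>\<^sub>\<infinity>\<sigma>. G \<sigma> k) summable_on UNIV"
    using summable_on_Sigma_banach[OF sw[OF s1]] summable_on_Sigma_banach[OF sw[OF s2]] by simp_all
qed

lemma mult_Ffun_conv:
  fixes w :: "('n::finite option \<Rightarrow> int) \<Rightarrow> complex"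
  assumes p: "(\<lambda>\<sigma>. cmod (p \<sigma>)) summable_on UNIV" and w: "(\<lambda>k. cmod (w k)) summable_on UNIV"
  shows "(\<Sum>\<^sub>\<infinity>\<sigma>. p \<sigma> * cis (of_int \<sigma> * v $ None)) * Ffun w v = Ffun (conv p w) v"
proof -
  have e: "ee (l(None := l None + \<sigma>)) v = ee l v * cis (of_int \<sigma> * v $ None)" for l \<sigma>
  proof -
    have "(\<Sum>i\<in>UNIV. of_int ((l(None := l None + \<sigma>)) i) * v $ i)
       = (\<Sum>i\<in>UNIV. of_int (l i) * v $ i + (if i = None then of_int \<sigma> * v $ None else 0))"
      by (rule sum.cong) (auto simp: algebra_simps)
    then show ?thesis by (simp add: ee_def sum.distrib cis_mult)
  qed
  have "Ffun (conv p w) v = (\<Sum>\<^sub>\<infinity>k. \<Sum>\<^sub>\<infinity>\<sigma>. p \<sigma> * w (k(None := k None - \<sigma>)) * ee k v)"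
    by (simp add: Ffun_def conv_def infsum_cmult_left')
  also have "\<dots> = (\<Sum>\<^sub>\<infinity>l. \<Sum>\<^sub>\<infinity>\<sigma>. p \<sigma> * w l * ee (l(None := l None + \<sigma>)) v)"
    using infsum_conv_shift(1)[of "\<lambda>\<sigma> k. p \<sigma> * w (k(None := k None - \<sigma>)) * ee k v", OF _ p w]
    by (simp add: norm_mult)
  also have "\<dots> = (\<Sum>\<^sub>\<infinity>l. (w l * ee l v) * (\<Sum>\<^sub>\<infinity>\<sigma>. p \<sigma> * cis (of_int \<sigma> * v $ None)))"
    by (intro infsum_cong, subst infsum_cmult_right' [symmetric], intro infsum_cong) (simp add: e mult_ac)
  also have "\<dots> = (\<Sum>\<^sub>\<infinity>\<sigma>. p \<sigma> * cis (of_int \<sigma> * v $ None)) * Ffun w v"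
    by (subst infsum_cmult_left') (simp add: Ffun_def mult.commute)
  finally show ?thesis by simp
qed

text \<open>Fed into \<open>om_mono\<close> and \<open>om_add\<close>, this splits the weight at k
  between the shifted index and \<sigma>.\<close>

lemma nrm_le_nrm_shift: "nrm k \<le> nrm (k(None := k None - \<sigma>)) + (1 + \<bar>of_int \<sigma>\<bar>)"
  for k :: "'n::finite option \<Rightarrow> int"
  by (auto simp: nrm_def UNIV_option_conv sum.reindex)

section \<open>The operator acting on coefficient sequences, and its transpose\<close>

locale vector_field = weight +
  fixes a b :: "'n::finite \<Rightarrow> real \<Rightarrow> real"
  assumes a_E: "\<And>j. lift_T1 (a j) \<in> E_roumieu \<omega>" and b_E: "\<And>j. lift_T1 (b j) \<in> E_roumieu \<omega>"
begin

definition p :: "'n \<Rightarrow> int \<Rightarrow> complex" where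
  "p j \<sigma> = fc1 (\<lambda>t. of_real (a j t)) \<sigma> + \<i> * fc1 (\<lambda>t. of_real (b j t)) \<sigma>"

text \<open>\<open>Lop\<close> on the Fourier side. The coefficients depend on t alone, so they act
  by convolution in the index \<open>None\<close> and leave the frequency in x untouched.\<close>

definition Lseq :: "(('n option \<Rightarrow> int) \<Rightarrow> complex) \<Rightarrow> ('n option \<Rightarrow> int) \<Rightarrow> complex" where
  "Lseq u k = \<i> * of_int (k None) * u k + (\<Sum>j\<in>UNIV. \<i> * of_int (k (Some j)) * conv (p j) u k)"

lemma p_decay: "\<exists>C \<delta>. 0 \<le> C \<and> 0 < \<delta> \<and> (\<forall>\<sigma>. cmod (p j \<sigma>) \<le> C * exp (- \<delta> * \<omega> (1 + \<bar>of_int \<sigma>\<bar>)))"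
proof -
  obtain A \<delta> where A: "0 \<le> A" "0 < \<delta>" "\<And>\<tau>. cmod (fc1 (\<lambda>t. of_real (a j t)) \<tau>) \<le> A * exp (- \<delta> * \<omega> (1 + \<bar>of_int \<tau>\<bar>))"
    using lift_T1_expansion(1)[OF a_E[of j]] by blast
  obtain B \<eta> where B: "0 \<le> B" "0 < \<eta>" "\<And>\<tau>. cmod (fc1 (\<lambda>t. of_real (b j t)) \<tau>) \<le> B * exp (- \<eta> * \<omega> (1 + \<bar>of_int \<tau>\<bar>))"
    using lift_T1_expansion(1)[OF b_E[of j]] by blast
  show ?thesis
  proof (rule exI[of _ "A + B"], rule exI[of _ "min \<delta> \<eta>"], intro conjI allI)
    fix \<sigma> :: int
    let ?w = "\<omega> (1 + \<bar>of_int \<sigma>\<bar>)"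
    have w: "?w \<ge> 0" by (intro om_nonneg) simp
    have "A * exp (- \<delta> * ?w) \<le> A * exp (- min \<delta> \<eta> * ?w)" "B * exp (- \<eta> * ?w) \<le> B * exp (- min \<delta> \<eta> * ?w)"
      using A(1) B(1) w by (auto intro!: mult_left_mono mult_right_mono)
    then show "cmod (p j \<sigma>) \<le> (A + B) * exp (- min \<delta> \<eta> * ?w)"
      using norm_triangle_ineq[of "fc1 (\<lambda>t. of_real (a j t)) \<sigma>" "\<i> * fc1 (\<lambda>t. of_real (b j t)) \<sigma>"] A(3)[of \<sigma>] B(3)[of \<sigma>]
      unfolding distrib_right p_def by (simp add: norm_mult)
  qed (use A B in auto)
qed

lemma p_summable: "(\<lambda>\<sigma>. cmod (p j \<sigma>)) summable_on UNIV"
proof -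
  obtain C \<delta> where "0 \<le> C" "0 < \<delta>" "\<And>\<sigma>. cmod (p j \<sigma>) \<le> C * exp (- \<delta> * \<omega> (1 + \<bar>of_int \<sigma>\<bar>))"
    using p_decay by blast
  then show ?thesis
    by (intro summable_on_comparison_test[OF summable_on_cmult_right[OF summable_on_weight_int]]) auto
qed

lemma p_expansion: "of_real (a j t) + \<i> * of_real (b j t) = (\<Sum>\<^sub>\<infinity>\<sigma>. p j \<sigma> * cis (of_int \<sigma> * t))"
proof -
  have s: "(\<lambda>\<tau>. fc1 (\<lambda>t. of_real (q t)) \<tau> * cis (of_int \<tau> * t)) summable_on UNIV"
    if "lift_T1 q \<in> E_roumieu \<omega>" for q
    by (rule abs_summable_summable) (use lift_T1_expansion(2)[OF that] in \<open>simp add: norm_mult\<close>)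
  show ?thesis
    unfolding p_def distrib_right mult.assoc
    by (subst infsum_add)
       (auto intro!: s a_E b_E summable_on_cmult_right
          simp: infsum_cmult_right' lift_T1_expansion(3)[OF a_E, symmetric] lift_T1_expansion(3)[OF b_E, symmetric])
qed

text \<open>Of the rate of \<open>p j\<close> one half is spent on transporting the weight from the
  shifted index to k by subadditivity, the other half keeps the sum over \<sigma>
  convergent.\<close>

lemma decays_conv:
  assumes "decays u"
  shows "decays (conv (p j) u)"
proof -
  obtain C1 \<delta>1 where C1: "0 \<le> C1" "0 < \<delta>1" "\<And>\<sigma>. cmod (p j \<sigma>) \<le> C1 * exp (- \<delta>1 * \<omega> (1 + \<bar>of_int \<sigma>\<bar>))"
    using p_decay by blast
  obtain C2 \<delta>2 where C2: "0 \<le> C2" "0 < \<delta>2" "\<And>k. cmod (u k) \<le> C2 * exp (- \<delta>2 * \<omega> (nrm k))"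
    using assms by (auto simp: decays_def)
  define \<delta> where "\<delta> = min (\<delta>1 / 2) \<delta>2"
  have d: "0 < \<delta>" "\<delta> \<le> \<delta>1 / 2" "\<delta> \<le> \<delta>2" using C1 C2 by (auto simp: \<delta>_def)
  let ?w = "\<lambda>\<sigma>::int. \<omega> (1 + \<bar>of_int \<sigma>\<bar>)"
  let ?Z = "\<Sum>\<^sub>\<infinity>\<sigma>::int. exp (- (\<delta>1 / 2) * ?w \<sigma>)"
  have "cmod (conv (p j) u k) \<le> C1 * C2 * ?Z * exp (- \<delta> * \<omega> (nrm k))" for k
  proof -
    let ?c = "C1 * C2 * exp (- \<delta> * \<omega> (nrm k))"
    have t: "cmod (p j \<sigma> * u (k(None := k None - \<sigma>))) \<le> ?c * exp (- (\<delta>1 / 2) * ?w \<sigma>)" for \<sigma>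
    proof -
      let ?n = "nrm (k(None := k None - \<sigma>))"
      have "\<omega> (nrm k) \<le> \<omega> (?n + (1 + \<bar>of_int \<sigma>\<bar>))"
        using nrm_pos[of k] by (intro om_mono nrm_le_nrm_shift) auto
      also have "\<dots> \<le> \<omega> ?n + ?w \<sigma>" using nrm_pos[of "k(None := k None - \<sigma>)"] by (intro om_add) auto
      finally have "\<delta> * \<omega> (nrm k) \<le> \<delta> * \<omega> ?n + \<delta> * ?w \<sigma>"
        using d(1) by (metis distrib_left mult_left_mono less_imp_le)
      also have "\<dots> \<le> \<delta>2 * \<omega> ?n + \<delta>1 / 2 * ?w \<sigma>"
        using d by (intro add_mono mult_right_mono om_nrm_nonneg om_nonneg) auto
      finally have "- \<delta>1 * ?w \<sigma> + - \<delta>2 * \<omega> ?n \<le> - \<delta> * \<omega> (nrm k) + - (\<delta>1 / 2) * ?w \<sigma>" by simp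
      then have ex: "exp (- \<delta>1 * ?w \<sigma> + - \<delta>2 * \<omega> ?n) \<le> exp (- \<delta> * \<omega> (nrm k) + - (\<delta>1 / 2) * ?w \<sigma>)" by simp
      have "cmod (p j \<sigma> * u (k(None := k None - \<sigma>))) \<le> (C1 * exp (- \<delta>1 * ?w \<sigma>)) * (C2 * exp (- \<delta>2 * \<omega> ?n))"
        unfolding norm_mult by (intro mult_mono C1 C2) (use C1 in auto)
      also have "\<dots> = C1 * C2 * exp (- \<delta>1 * ?w \<sigma> + - \<delta>2 * \<omega> ?n)" by (simp only: exp_add mult_ac)
      also have "\<dots> \<le> C1 * C2 * exp (- \<delta> * \<omega> (nrm k) + - (\<delta>1 / 2) * ?w \<sigma>)"
        by (intro mult_left_mono ex) (use C1 C2 in auto)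
      finally show ?thesis by (simp only: exp_add mult_ac)
    qed
    have sm: "(\<lambda>\<sigma>. ?c * exp (- (\<delta>1 / 2) * ?w \<sigma>)) summable_on UNIV"
      using C1 by (intro summable_on_cmult_right summable_on_weight_int) auto
    have sn: "(\<lambda>\<sigma>. cmod (p j \<sigma> * u (k(None := k None - \<sigma>)))) summable_on UNIV"
      by (rule summable_on_comparison_test[OF sm t]) simp
    have "cmod (conv (p j) u k) \<le> (\<Sum>\<^sub>\<infinity>\<sigma>. cmod (p j \<sigma> * u (k(None := k None - \<sigma>))))"
      unfolding conv_def by (rule norm_infsum_bound[OF sn])
    also have "\<dots> \<le> (\<Sum>\<^sub>\<infinity>\<sigma>. ?c * exp (- (\<delta>1 / 2) * ?w \<sigma>))"
      by (rule infsum_mono[OF sn sm t])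
    also have "\<dots> = ?c * ?Z" by (rule infsum_cmult_right')
    finally show ?thesis by (simp add: mult_ac)
  qed
  moreover have "?Z \<ge> 0" by (intro infsum_nonneg) auto
  ultimately show ?thesis
    unfolding decays_def using C1 C2 d by (intro exI[of _ "C1 * C2 * ?Z"] exI[of _ \<delta>]) auto
qed

lemma decays_Lseq: "decays u \<Longrightarrow> decays (Lseq u)"
  unfolding Lseq_def [abs_def]
  by (intro decays_add decays_sum decays_mult_index decays_conv) auto

lemma conv_mult_index:
  "conv q (\<lambda>k. \<i> * of_int (k (Some j)) * u k) k = \<i> * of_int (k (Some j)) * conv q u k"
  unfolding conv_def infsum_cmult_right' [symmetric] by (simp add: mult_ac)

lemma Lop_Ffun:
  assumes "decays u"
  shows "Lop a b (Ffun u) = Ffun (Lseq u)"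
proof
  fix v
  have "Lop a b (Ffun u) v = Ffun (\<lambda>k. \<i> * of_int (k None) * u k) v +
      (\<Sum>j\<in>UNIV. Ffun (conv (p j) (\<lambda>k. \<i> * of_int (k (Some j)) * u k)) v)"
    unfolding Lop_def pd_Ffun[OF assms] p_expansion
    by (simp add: mult_Ffun_conv[OF p_summable decays_summable[OF decays_mult_index[OF assms]]])
  also have "\<dots> = Ffun (Lseq u) v"
    unfolding Lseq_def [abs_def] conv_mult_index
    by (subst Ffun_add Ffun_sum; (intro decays_sum decays_mult_index decays_conv assms)?; simp add: Ffun_sum decays_mult_index decays_conv assms)
  finally show "Lop a b (Ffun u) v = Ffun (Lseq u) v" .
qed

lemma Lop_E_roumieu:
  assumes "\<phi> \<in> E_roumieu \<omega>"
  shows "Lop a b \<phi> \<in> E_roumieu \<omega>" "fc (Lop a b \<phi>) = Lseq (fc \<phi>)"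
proof -
  note p = E_roumieu_imp_decays[OF assms]
  have "Lop a b \<phi> = Ffun (Lseq (fc \<phi>))" by (subst p(2)) (rule Lop_Ffun[OF p(1)])
  then show "Lop a b \<phi> \<in> E_roumieu \<omega>" "fc (Lop a b \<phi>) = Lseq (fc \<phi>)"
    by (simp_all add: Ffun_in_E_roumieu fc_Ffun_decays decays_Lseq p(1))
qed

text \<open>Transpose equals minus the operator: derivatives are odd under the reflection of k, and
  the coefficients commute with the x-derivatives. The analytic content is the exchange of sums when
  m merely grows.\<close>

lemma mu_of_Lop:
  assumes m: "grows m" and \<phi>: "\<phi> \<in> E_roumieu \<omega>"
  shows "mu_of m (Lop a b \<phi>) = - mu_of (Lseq m) \<phi>"
proof -
  let ?f = "fc \<phi>"
  note f = E_roumieu_imp_decays(1)[OF \<phi>]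
  have swap: "(\<Sum>\<^sub>\<infinity>k. m (\<lambda>i. - k i) * (\<i> * of_int (k (Some j)) * conv (p j) ?f k))
      = - (\<Sum>\<^sub>\<infinity>k. \<i> * of_int (- k (Some j)) * conv (p j) m (\<lambda>i. - k i) * ?f k)"
    and summ: "(\<lambda>k. \<i> * of_int (- k (Some j)) * conv (p j) m (\<lambda>i. - k i) * ?f k) summable_on UNIV" for j
  proof -
    obtain C \<delta> where C: "0 \<le> C" "0 < \<delta>" "\<And>\<sigma>. cmod (p j \<sigma>) \<le> C * exp (- \<delta> * \<omega> (1 + \<bar>of_int \<sigma>\<bar>))"
      using p_decay by blast
    obtain D \<eta> where D: "0 \<le> D" "0 < \<eta>" "\<And>k. cmod (\<i> * of_int (k (Some j)) * ?f k) \<le> D * exp (- \<eta> * \<omega> (nrm k))"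
      using decays_mult_index[OF f, of "Some j"] by (auto simp: decays_def)
    \<comment> \<open>The growth rate of m is chosen last: the weight at k splits between the
      shifted index and \<sigma>, and each of the two decaying factors can spare half of its
      rate.\<close>
    define \<epsilon> where "\<epsilon> = min (\<delta> / 2) (\<eta> / 2)"
    have e: "0 < \<epsilon>" "\<epsilon> \<le> \<delta> / 2" "\<epsilon> \<le> \<eta> / 2" using C D by (auto simp: \<epsilon>_def)
    obtain M where M: "0 \<le> M" "\<And>k. cmod (m k) \<le> M * exp (\<epsilon> * \<omega> (nrm k))"
      using m e(1) unfolding grows_def by blast
    let ?w = "\<lambda>\<sigma>::int. \<omega> (1 + \<bar>of_int \<sigma>\<bar>)"
    let ?G = "\<lambda>\<sigma> k. m (\<lambda>i. - k i) * (p j \<sigma> * (\<i> * of_int (k (Some j)) * ?f (k(None := k None - \<sigma>))))"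
    let ?P = "\<lambda>\<sigma>. M * C * exp (- (\<delta> / 2) * ?w \<sigma>)" and ?Q = "\<lambda>k :: 'n option \<Rightarrow> int. D * exp (- (\<eta> / 2) * \<omega> (nrm k))"
    have bd: "cmod (?G \<sigma> k) \<le> ?P \<sigma> * ?Q (k(None := k None - \<sigma>))" for \<sigma> k
    proof -
      let ?l = "k(None := k None - \<sigma>)"
      have "\<omega> (nrm k) \<le> \<omega> (nrm ?l + (1 + \<bar>of_int \<sigma>\<bar>))"
        using nrm_pos[of k] by (intro om_mono nrm_le_nrm_shift) auto
      also have "\<dots> \<le> \<omega> (nrm ?l) + ?w \<sigma>" using nrm_pos[of ?l] by (intro om_add) auto
      finally have "\<epsilon> * \<omega> (nrm k) \<le> \<epsilon> * \<omega> (nrm ?l) + \<epsilon> * ?w \<sigma>"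
        using e(1) by (metis distrib_left mult_left_mono less_imp_le)
      also have "\<dots> \<le> \<eta> / 2 * \<omega> (nrm ?l) + \<delta> / 2 * ?w \<sigma>"
        using e by (intro add_mono mult_right_mono om_nrm_nonneg om_nonneg) auto
      finally have "\<epsilon> * \<omega> (nrm k) + - \<delta> * ?w \<sigma> + - \<eta> * \<omega> (nrm ?l) \<le> - (\<delta> / 2) * ?w \<sigma> + - (\<eta> / 2) * \<omega> (nrm ?l)"
        by simp
      then have ex: "exp (\<epsilon> * \<omega> (nrm k) + - \<delta> * ?w \<sigma> + - \<eta> * \<omega> (nrm ?l)) \<le> exp (- (\<delta> / 2) * ?w \<sigma> + - (\<eta> / 2) * \<omega> (nrm ?l))"
        by simp
      have "cmod (?G \<sigma> k) \<le> (M * exp (\<epsilon> * \<omega> (nrm k))) * ((C * exp (- \<delta> * ?w \<sigma>)) * (D * exp (- \<eta> * \<omega> (nrm ?l))))"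
        unfolding norm_mult[of "m _"] norm_mult[of "p j \<sigma>"]
        using M(2)[of "\<lambda>i. - k i"] D(3)[of ?l] C(1) D(1) M(1)
        by (intro mult_mono C(3)) auto
      also have "\<dots> = M * C * D * exp (\<epsilon> * \<omega> (nrm k) + - \<delta> * ?w \<sigma> + - \<eta> * \<omega> (nrm ?l))" by (simp only: exp_add mult_ac)
      also have "\<dots> \<le> M * C * D * exp (- (\<delta> / 2) * ?w \<sigma> + - (\<eta> / 2) * \<omega> (nrm ?l))"
        by (intro mult_left_mono ex) (use C D M in auto)
      finally show ?thesis by (simp only: exp_add mult_ac)
    qed
    have P: "?P summable_on UNIV" and Q: "?Q summable_on UNIV"
      using C D by (intro summable_on_cmult_right summable_on_weight summable_on_weight_int; simp)+
    have e1: "m (\<lambda>i. - k i) * (\<i> * of_int (k (Some j)) * conv (p j) ?f k) = (\<Sum>\<^sub>\<infinity>\<sigma>. ?G \<sigma> k)" for k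
      unfolding conv_def infsum_cmult_right' [symmetric] by (simp add: mult_ac)
    have e2: "(\<Sum>\<^sub>\<infinity>\<sigma>. ?G \<sigma> (l(None := l None + \<sigma>))) = - (\<i> * of_int (- l (Some j)) * conv (p j) m (\<lambda>i. - l i) * ?f l)" for l
    proof -
      have u: "(\<lambda>i. - (if i = None then l None + \<sigma> else l i)) = (\<lambda>i. - l i)(None := - l None - \<sigma>)" for \<sigma>
        by (auto simp: fun_eq_iff)
      have "(\<Sum>\<^sub>\<infinity>\<sigma>. ?G \<sigma> (l(None := l None + \<sigma>)))
         = (\<Sum>\<^sub>\<infinity>\<sigma>. (\<i> * of_int (l (Some j)) * ?f l) * (p j \<sigma> * m ((\<lambda>i. - l i)(None := - l None - \<sigma>))))"
        by (rule infsum_cong) (simp add: u mult_ac)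
      also have "\<dots> = (\<i> * of_int (l (Some j)) * ?f l) * conv (p j) m (\<lambda>i. - l i)"
        unfolding conv_def by (rule infsum_cmult_right')
      finally show ?thesis by simp
    qed
    show "(\<Sum>\<^sub>\<infinity>k. m (\<lambda>i. - k i) * (\<i> * of_int (k (Some j)) * conv (p j) ?f k))
      = - (\<Sum>\<^sub>\<infinity>k. \<i> * of_int (- k (Some j)) * conv (p j) m (\<lambda>i. - k i) * ?f k)"
      using infsum_conv_shift(1)[OF bd P Q] unfolding e1 e2 infsum_uminus .
    show "(\<lambda>k. \<i> * of_int (- k (Some j)) * conv (p j) m (\<lambda>i. - k i) * ?f k) summable_on UNIV"
      using infsum_conv_shift(2)[OF bd P Q] unfolding e2 summable_on_uminus .
  qed
  have s0: "(\<lambda>k. m (\<lambda>i. - k i) * (\<i> * of_int (k None) * ?f k)) summable_on UNIV"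
    by (rule summable_pairing(2)[OF m decays_mult_index[OF f]])
  have s1: "(\<lambda>k. m (\<lambda>i. - k i) * (\<i> * of_int (k (Some j)) * conv (p j) ?f k)) summable_on UNIV" for j
    by (rule summable_pairing(2)[OF m decays_mult_index[OF decays_conv[OF f]]])
  have "mu_of m (Lop a b \<phi>) = (\<Sum>\<^sub>\<infinity>k. m (\<lambda>i. - k i) * (\<i> * of_int (k None) * ?f k) +
     (\<Sum>j\<in>UNIV. m (\<lambda>i. - k i) * (\<i> * of_int (k (Some j)) * conv (p j) ?f k)))"
    using Lop_E_roumieu[OF \<phi>] by (simp add: mu_of_def Lseq_def distrib_left sum_distrib_left)
  also have "\<dots> = (\<Sum>\<^sub>\<infinity>k. m (\<lambda>i. - k i) * (\<i> * of_int (k None) * ?f k)) +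
     (\<Sum>j\<in>UNIV. \<Sum>\<^sub>\<infinity>k. m (\<lambda>i. - k i) * (\<i> * of_int (k (Some j)) * conv (p j) ?f k))"
    by (simp only: infsum_add[OF s0 infsum_finite_sum(1)[OF finite s1]] infsum_finite_sum(2)[OF finite s1])
  also have "(\<lambda>k. m (\<lambda>i. - k i) * (\<i> * of_int (k None) * ?f k)) = (\<lambda>k. - (\<i> * of_int (- k None) * m (\<lambda>i. - k i) * ?f k))"
    by (simp add: mult_ac)
  also have "(\<Sum>\<^sub>\<infinity>k. - (\<i> * of_int (- k None) * m (\<lambda>i. - k i) * ?f k)) +
     (\<Sum>j\<in>UNIV. \<Sum>\<^sub>\<infinity>k. m (\<lambda>i. - k i) * (\<i> * of_int (k (Some j)) * conv (p j) ?f k))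
    = - ((\<Sum>\<^sub>\<infinity>k. \<i> * of_int (- k None) * m (\<lambda>i. - k i) * ?f k) +
     (\<Sum>j\<in>UNIV. \<Sum>\<^sub>\<infinity>k. \<i> * of_int (- k (Some j)) * conv (p j) m (\<lambda>i. - k i) * ?f k))"
    unfolding swap by (simp only: infsum_uminus sum_negf) simp
  also have "(\<Sum>\<^sub>\<infinity>k. \<i> * of_int (- k None) * m (\<lambda>i. - k i) * ?f k) +
     (\<Sum>j\<in>UNIV. \<Sum>\<^sub>\<infinity>k. \<i> * of_int (- k (Some j)) * conv (p j) m (\<lambda>i. - k i) * ?f k) = mu_of (Lseq m) \<phi>"
  proof -
    have s0': "(\<lambda>k. \<i> * of_int (- k None) * m (\<lambda>i. - k i) * ?f k) summable_on UNIV"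
      using summable_on_uminus[of "\<lambda>k. m (\<lambda>i. - k i) * (\<i> * of_int (k None) * ?f k)" UNIV] s0
      by (simp add: mult_ac)
    have "mu_of (Lseq m) \<phi> = (\<Sum>\<^sub>\<infinity>k. Lseq m (\<lambda>i. - k i) * ?f k)"
      using \<phi> by (simp add: mu_of_def)
    also have "\<dots> = (\<Sum>\<^sub>\<infinity>k. \<i> * of_int (- k None) * m (\<lambda>i. - k i) * ?f k +
      (\<Sum>j\<in>UNIV. \<i> * of_int (- k (Some j)) * conv (p j) m (\<lambda>i. - k i) * ?f k))"
      unfolding Lseq_def distrib_right sum_distrib_right by (rule refl)
    also have "\<dots> = (\<Sum>\<^sub>\<infinity>k. \<i> * of_int (- k None) * m (\<lambda>i. - k i) * ?f k) +
      (\<Sum>j\<in>UNIV. \<Sum>\<^sub>\<infinity>k. \<i> * of_int (- k (Some j)) * conv (p j) m (\<lambda>i. - k i) * ?f k)"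
      by (simp only: infsum_add[OF s0' infsum_finite_sum(1)[OF finite summ]] infsum_finite_sum(2)[OF finite summ])
    finally show ?thesis by simp
  qed
  finally show ?thesis .
qed

end

section \<open>Slices and the regularity estimate\<close>

lemma fc1_norm_le:
  assumes "continuous_on UNIV u" "\<And>t. cmod (u t) \<le> B"
  shows "cmod (fc1 u \<tau>) \<le> B"
  unfolding fc1_def using assms by (intro norm_fc_le continuous_on_compose2[OF assms(1)] continuous_intros) auto

lemma continuous_on_fun1: "continuous_on UNIV u \<Longrightarrow> continuous_on UNIV (\<lambda>v::real^1. u (v $ 1) :: complex)"
  by (rule continuous_on_compose2[of UNIV u]) (auto intro!: continuous_intros)

lemma periodic_torus_fun1:
  assumes "\<And>t. u (t + 2 * pi) = u t"
  shows "periodic_torus (\<lambda>v::real^1. u (v $ 1) :: complex)"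
  unfolding periodic_torus_def
proof (intro allI)
  fix i :: 1 and x :: "real^1"
  have "i = 1" by (metis num1_eq1)
  then show "u ((x + (2 * pi) *\<^sub>R axis i 1) $ 1) = u (x $ 1)" using assms by (simp add: axis_def)
qed

lemma fc1_derivative:
  assumes cu: "continuous_on UNIV u" and cg: "continuous_on UNIV g" and per: "\<And>t. u (t + 2 * pi) = u t"
    and der: "\<And>t. (u has_vector_derivative g t) (at t)"
  shows "fc1 g \<tau> = \<i> * of_int \<tau> * fc1 u \<tau>"
  unfolding fc1_def
proof (rule fc_derivative[where i=1])
  fix x :: "real^1"
  have "((\<lambda>s. x $ 1 + s) has_vector_derivative 1) (at 0)" by (auto intro!: derivative_eq_intros)
  from vector_diff_chain_at[OF this, of u "g (x $ 1)"] der[of "x $ 1"]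
  show "((\<lambda>s. u ((x + s *\<^sub>R axis 1 1) $ 1)) has_vector_derivative g (x $ 1)) (at 0)"
    by (simp add: o_def axis_def)
qed (intro continuous_on_fun1 cu cg periodic_torus_fun1 per)+

lemma fc1_add:
  assumes "continuous_on UNIV u" "continuous_on UNIV v"
  shows "fc1 (\<lambda>t. u t + v t) \<tau> = fc1 u \<tau> + fc1 v \<tau>"
proof -
  have "torus_integral (\<lambda>x::real^1. u (x $ 1) * ee (\<lambda>i. - \<tau>) x + v (x $ 1) * ee (\<lambda>i. - \<tau>) x)
    = torus_integral (\<lambda>x::real^1. u (x $ 1) * ee (\<lambda>i. - \<tau>) x) + torus_integral (\<lambda>x::real^1. v (x $ 1) * ee (\<lambda>i. - \<tau>) x)"
  proof -
    have c: "continuous_on UNIV (\<lambda>x::real^1. w (x $ 1) * ee (\<lambda>i. - \<tau>) x)" if "continuous_on UNIV w" for w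
      by (rule continuous_on_mult[OF continuous_on_fun1[OF that] continuous_on_ee])
    show ?thesis
      unfolding torus_integral_def
      by (rule integral_add[OF integrable_torus[OF c[OF assms(1)]] integrable_torus[OF c[OF assms(2)]]])
  qed
  then show ?thesis by (simp add: fc1_def fc_def distrib_right add_divide_distrib)
qed

lemma fc1_cmult: "fc1 (\<lambda>t. c * u t) \<tau> = c * fc1 u \<tau>"
  unfolding fc1_def fc_def torus_integral_def mult.assoc by (simp only: integral_mult_right times_divide_eq_right)

lemma fc1_zero: "fc1 (\<lambda>t. 0) \<tau> = 0"
  by (simp add: fc1_def fc_def torus_integral_def)

lemma fc1_sum:
  "finite A \<Longrightarrow> (\<And>j. j \<in> A \<Longrightarrow> continuous_on UNIV (u j)) \<Longrightarrow> fc1 (\<lambda>t. \<Sum>j\<in>A. u j t) \<tau> = (\<Sum>j\<in>A. fc1 (u j) \<tau>)"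
  by (induction A rule: finite_induct) (simp_all add: fc1_zero fc1_add continuous_on_sum)

lemma fc1_mult_series:
  assumes p: "(\<lambda>\<sigma>. cmod (p \<sigma>)) summable_on UNIV" and u: "continuous_on UNIV u" "\<And>t. cmod (u t) \<le> B"
  shows "fc1 (\<lambda>t. (\<Sum>\<^sub>\<infinity>\<sigma>. p \<sigma> * cis (of_int \<sigma> * t)) * u t) \<tau> = (\<Sum>\<^sub>\<infinity>\<sigma>. p \<sigma> * fc1 u (\<tau> - \<sigma>))"
proof -
  let ?h = "\<lambda>\<sigma> v::real^1. p \<sigma> * (cis (of_int \<sigma> * v $ 1) * u (v $ 1) * ee (\<lambda>i. - \<tau>) v)"
  have "torus_integral (\<lambda>v. \<Sum>\<^sub>\<infinity>\<sigma>. ?h \<sigma> v) = (\<Sum>\<^sub>\<infinity>\<sigma>. torus_integral (?h \<sigma>))"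
  proof (rule torus_integral_infsum(2))
    show "continuous_on UNIV (?h \<sigma>)" for \<sigma>
      by (intro continuous_intros continuous_on_fun1 u)
    show "cmod (?h \<sigma> v) \<le> B * cmod (p \<sigma>)" for \<sigma> v
      using mult_left_mono[OF u(2)[of "v $ 1"], of "cmod (p \<sigma>)"] by (simp add: norm_mult mult.commute)
    show "(\<lambda>\<sigma>. B * cmod (p \<sigma>)) summable_on UNIV" by (rule summable_on_cmult_right[OF p])
  qed
  also have "(\<lambda>v. \<Sum>\<^sub>\<infinity>\<sigma>. ?h \<sigma> v) = (\<lambda>v. (\<Sum>\<^sub>\<infinity>\<sigma>. p \<sigma> * cis (of_int \<sigma> * v $ 1)) * u (v $ 1) * ee (\<lambda>i. - \<tau>) v)"
    by (simp add: fun_eq_iff mult.assoc flip: infsum_cmult_left')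
  finally have 1: "fc1 (\<lambda>t. (\<Sum>\<^sub>\<infinity>\<sigma>. p \<sigma> * cis (of_int \<sigma> * t)) * u t) \<tau>
      = (\<Sum>\<^sub>\<infinity>\<sigma>. torus_integral (?h \<sigma>)) / of_real (2 * pi)"
    by (simp add: fc1_def fc_def)
  have "torus_integral (?h \<sigma>) = of_real (2 * pi) * (p \<sigma> * fc1 u (\<tau> - \<sigma>))" for \<sigma>
  proof -
    have "cis (of_int \<sigma> * v $ 1) * u (v $ 1) * ee (\<lambda>i. - \<tau>) v = u (v $ 1) * ee (\<lambda>i. - (\<tau> - \<sigma>)) v" for v :: "real^1"
    proof -
      have "cis (of_int \<sigma> * v $ 1) * ee (\<lambda>i. - \<tau>) v = ee (\<lambda>i. - (\<tau> - \<sigma>)) v"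
        by (simp add: ee_fun1 cis_mult algebra_simps)
      then show ?thesis by (simp add: mult_ac)
    qed
    then have "torus_integral (?h \<sigma>) = p \<sigma> * torus_integral (\<lambda>v::real^1. u (v $ 1) * ee (\<lambda>i. - (\<tau> - \<sigma>)) v)"
      unfolding torus_integral_def by (simp only: integral_mult_right)
    then show ?thesis by (simp add: fc1_def fc_def)
  qed
  then show ?thesis unfolding 1 by (simp add: infsum_cmult_right' del: of_real_mult)
qed

text \<open>Serves as a lower bound for the coefficient sum of a function known to be large at one
  point.\<close>

lemma norm_le_infsum_fc1:
  assumes c: "continuous_on UNIV u" and per: "\<And>t. u (t + 2 * pi) = u t"
    and s: "(\<lambda>\<tau>. cmod (fc1 u \<tau>)) summable_on UNIV"
  shows "cmod (u t) \<le> (\<Sum>\<^sub>\<infinity>\<tau>. cmod (fc1 u \<tau>))"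
proof -
  let ?U = "\<lambda>v::real^1. u (v $ 1)"
  have k1: "(\<lambda>_. k 1) = k" for k :: "1 \<Rightarrow> int" by (rule ext) (metis num1_eq1)
  have s': "(\<lambda>k. cmod (fc ?U k)) summable_on UNIV"
    using s summable_on_reindex_bij_betw[OF bij_int_fun1, of "\<lambda>k. cmod (fc ?U k)"] by (simp add: fc1_def)
  have "?U = Ffun (fc ?U)"
    by (rule fourier_inversion[OF continuous_on_fun1[OF c] periodic_torus_fun1[of u, OF per] s'])
  then have "u t = Ffun (fc ?U) (\<chi> i. t)" by (metis vec_lambda_beta)
  then have "cmod (u t) \<le> (\<Sum>\<^sub>\<infinity>k. cmod (fc ?U k))" using norm_Ffun_le[OF s'] by simp
  also have "\<dots> = (\<Sum>\<^sub>\<infinity>\<tau>. cmod (fc1 u \<tau>))"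
    using infsum_reindex_bij_betw[OF bij_int_fun1, of "\<lambda>k. cmod (fc ?U k)"] by (simp add: fc1_def)
  finally show ?thesis .
qed

lemma series_fc1:
  fixes c :: "int \<Rightarrow> complex"
  assumes s: "(\<lambda>\<tau>. cmod (c \<tau>)) summable_on UNIV"
  defines "u \<equiv> \<lambda>t::real. \<Sum>\<^sub>\<infinity>\<tau>. c \<tau> * cis (of_int \<tau> * t)"
  shows "continuous_on UNIV u" "\<And>t. u (t + 2 * pi) = u t" "fc1 u \<tau> = c \<tau>"
    "\<And>t. cmod (u t) \<le> (\<Sum>\<^sub>\<infinity>\<tau>. cmod (c \<tau>))"
proof -
  let ?c = "\<lambda>k::1 \<Rightarrow> int. c (k 1)"
  have s': "(\<lambda>k. cmod (?c k)) summable_on UNIV"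
    using s summable_on_reindex_bij_betw[OF bij_int_fun1, of "\<lambda>k. cmod (?c k)"] by simp
  have F: "Ffun ?c v = u (v $ 1)" for v :: "real^1" by (simp add: Ffun_fun1 u_def)
  have ut: "u t = Ffun ?c (\<chi> i. t)" for t by (simp add: F)
  have "continuous_on UNIV (\<lambda>t. Ffun ?c (\<chi> i. t))"
    by (rule continuous_on_compose2[OF continuous_on_Ffun[OF s']]) (auto intro!: continuous_intros)
  then show "continuous_on UNIV u" by (simp add: F)
  show "u (t + 2 * pi) = u t" for t
  proof -
    have "cis (of_int \<tau> * (t + 2 * pi)) = cis (of_int \<tau> * t)" for \<tau>
      using cis_multiple_2pi[of "of_int \<tau>"] by (simp add: distrib_left mult.commute flip: cis_mult)
    then show ?thesis by (simp add: u_def)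
  qed
  show "fc1 u \<tau> = c \<tau>"
    using fc_Ffun[OF s', of "\<lambda>_. \<tau>"] by (simp add: fc1_def F [abs_def])
  show "cmod (u t) \<le> (\<Sum>\<^sub>\<infinity>\<tau>. cmod (c \<tau>))" for t
    using norm_Ffun_le[OF s', of "\<chi> i. t"] infsum_reindex_bij_betw[OF bij_int_fun1, of "\<lambda>k. cmod (?c k)"]
    by (simp add: F)
qed

section \<open>Slices of the operator at a fixed frequency in x\<close>

definition join :: "int \<Rightarrow> ('n \<Rightarrow> int) \<Rightarrow> 'n option \<Rightarrow> int" where
  "join \<tau> \<xi> = case_option \<tau> \<xi>"

lemma join_simps [simp]: "join \<tau> \<xi> None = \<tau>" "join \<tau> \<xi> (Some j) = \<xi> j" "(join \<tau> \<xi>)(None := \<sigma>) = join \<sigma> \<xi>"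
  by (auto simp: join_def fun_eq_iff split: option.split)

lemma join_split: "join (k None) (\<lambda>j. k (Some j)) = k"
  by (auto simp: join_def fun_eq_iff split: option.split)

lemma nrm_join: "nrm (join \<tau> \<xi>) = nrm \<xi> + \<bar>of_int \<tau>\<bar>" for \<xi> :: "'n::finite \<Rightarrow> int"
  by (simp add: nrm_def UNIV_option_conv sum.reindex)

lemma one_le_abs_of_int: "k \<noteq> 0 \<Longrightarrow> 1 \<le> \<bar>real_of_int k\<bar>"
  by (simp flip: of_int_abs)

context vector_field
begin

definition Lxi :: "('n \<Rightarrow> int) \<Rightarrow> (int \<Rightarrow> complex) \<Rightarrow> int \<Rightarrow> complex" where
  "Lxi \<xi> w \<tau> = \<i> * of_int \<tau> * w \<tau> + (\<Sum>j\<in>UNIV. \<i> * of_int (\<xi> j) * (\<Sum>\<^sub>\<infinity>\<sigma>. p j \<sigma> * w (\<tau> - \<sigma>)))"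

lemma Lseq_join: "Lseq u (join \<tau> \<xi>) = Lxi \<xi> (\<lambda>\<tau>. u (join \<tau> \<xi>)) \<tau>"
  by (simp add: Lseq_def Lxi_def conv_def)

definition px :: "('n \<Rightarrow> int) \<Rightarrow> real \<Rightarrow> complex" where
  "px \<xi> t = (\<Sum>j\<in>UNIV. of_int (\<xi> j) * (of_real (a j t) + \<i> * of_real (b j t)))"

lemma continuous_periodic:
  assumes "lift_T1 q \<in> E_roumieu \<omega>"
  shows "continuous_on UNIV q" "q (t + 2 * pi) = q t"
proof -
  note e = lift_T1_expansion(3)[OF assms] and s = series_fc1[OF lift_T1_expansion(2)[OF assms]]
  define Q where "Q t = (\<Sum>\<^sub>\<infinity>\<tau>. fc1 (\<lambda>t. of_real (q t)) \<tau> * cis (of_int \<tau> * t))" for t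
  have q: "q = (\<lambda>t. Re (Q t))" unfolding Q_def e [symmetric] by simp
  have "continuous_on UNIV Q" "\<And>t. Q (t + 2 * pi) = Q t"
    using s(1,2) unfolding Q_def .
  then show "continuous_on UNIV q" "q (t + 2 * pi) = q t"
    unfolding q by (auto intro!: continuous_intros)
qed

lemmas a_props = continuous_periodic[OF a_E] and b_props = continuous_periodic[OF b_E]

lemma px_props: "continuous_on UNIV (px \<xi>)" "px \<xi> (t + 2 * pi) = px \<xi> t"
  unfolding px_def by (intro continuous_intros a_props b_props) (simp add: a_props b_props)

text \<open>Converts periodic solutions of the ODE into solutions of the sliced sequence equation.
  Only a sup bound on u goes in; decay of its coefficients is left to
  \<open>regularity\<close>.\<close>

lemma Lxi_fc1:
  assumes cu: "continuous_on UNIV u" and cf: "continuous_on UNIV f" and per: "\<And>t. u (t + 2 * pi) = u t"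
    and B: "\<And>t. cmod (u t) \<le> B"
    and der: "\<And>t. (u has_vector_derivative f t - \<i> * px \<xi> t * u t) (at t)"
  shows "Lxi \<xi> (fc1 u) \<tau> = fc1 f \<tau>"
proof -
  let ?s = "\<lambda>j t. \<Sum>\<^sub>\<infinity>\<sigma>. p j \<sigma> * cis (of_int \<sigma> * t)"
  let ?h = "\<lambda>t. \<Sum>j\<in>UNIV. (\<i> * of_int (\<xi> j)) * (?s j t * u t)"
  have h: "\<i> * px \<xi> t * u t = ?h t" for t
    unfolding px_def p_expansion by (simp add: sum_distrib_left sum_distrib_right mult_ac)
  have ch: "continuous_on UNIV ?h"
    by (intro continuous_intros series_fc1(1)[OF p_summable] cu)
  have "fc1 (\<lambda>t. f t - \<i> * px \<xi> t * u t) \<tau> = \<i> * of_int \<tau> * fc1 u \<tau>"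
    by (rule fc1_derivative[OF cu _ per der]) (intro continuous_intros cf cu px_props)
  moreover have "fc1 (\<lambda>t. (f t - \<i> * px \<xi> t * u t) + ?h t) \<tau> = fc1 (\<lambda>t. f t - \<i> * px \<xi> t * u t) \<tau> + fc1 ?h \<tau>"
    by (rule fc1_add) (intro continuous_intros cf cu px_props, rule ch)
  moreover have "fc1 ?h \<tau> = (\<Sum>j\<in>UNIV. \<i> * of_int (\<xi> j) * (\<Sum>\<^sub>\<infinity>\<sigma>. p j \<sigma> * fc1 u (\<tau> - \<sigma>)))"
  proof -
    have "fc1 ?h \<tau> = (\<Sum>j\<in>UNIV. fc1 (\<lambda>t. (\<i> * of_int (\<xi> j)) * (?s j t * u t)) \<tau>)"
      by (rule fc1_sum) (auto intro!: continuous_intros series_fc1(1)[OF p_summable] cu)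
    also have "\<dots> = (\<Sum>j\<in>UNIV. \<i> * of_int (\<xi> j) * (\<Sum>\<^sub>\<infinity>\<sigma>. p j \<sigma> * fc1 u (\<tau> - \<sigma>)))"
      unfolding fc1_cmult by (simp only: fc1_mult_series[OF p_summable cu B])
    finally show ?thesis .
  qed
  ultimately show ?thesis by (simp add: Lxi_def h)
qed

text \<open>Ellipticity where \<open>|\<tau>|\<close> dominates \<open>|\<xi>|\<close>: the weighted supremum of \<open>w\<close> over that region is
  absorbed; truncating the weight at height \<open>R\<close> makes it finite beforehand.\<close>

lemma regularity:
  obtains M \<delta>1 where "1 \<le> M" "0 < \<delta>1"
    "\<And>\<delta> \<xi> w S F \<eta> \<tau>. 0 < \<delta> \<Longrightarrow> \<delta> \<le> \<delta>1 \<Longrightarrow> 0 \<le> F \<Longrightarrow> cmod \<eta> \<le> nrm \<xi> \<Longrightarrow> (\<And>\<tau>. cmod (w \<tau>) \<le> S) \<Longrightarrow>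
     (\<And>\<tau>. cmod (Lxi \<xi> w \<tau> - \<i> * \<eta> * w \<tau>) \<le> F * exp (- \<delta> * \<omega> (1 + \<bar>of_int \<tau>\<bar>))) \<Longrightarrow>
     cmod (w \<tau>) \<le> 2 * (F + S * exp (\<delta> * \<omega> (1 + M * nrm \<xi>))) * exp (- \<delta> * \<omega> (1 + \<bar>of_int \<tau>\<bar>))"
proof -
  let ?w = "\<lambda>\<sigma>::int. \<omega> (1 + \<bar>of_int \<sigma>\<bar>)"
  have w0: "0 \<le> ?w \<sigma>" for \<sigma> by (intro om_nonneg) simp
  obtain C d where Cd: "\<And>j. 0 \<le> C j" "\<And>j. 0 < d j" "\<And>j \<sigma>. cmod (p j \<sigma>) \<le> C j * exp (- d j * ?w \<sigma>)"
    using p_decay by metis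
  \<comment> \<open>Half of the smallest decay rate of the coefficients: one half compensates the
    factor exp(\<delta>1 \<omega>) in the sum \<open>A\<close> below, the other half makes that sum
    finite.\<close>
  define \<delta>1 where "\<delta>1 = Min (range d) / 2"
  have "Min (range d) \<in> range d" by (rule Min_in) auto
  then have d1: "0 < \<delta>1" using Cd(2) by (auto simp: \<delta>1_def)
  have d1': "2 * \<delta>1 \<le> d j" for j by (simp add: \<delta>1_def)
  define Ps where "Ps \<sigma> = (\<Sum>j\<in>UNIV. cmod (p j \<sigma>))" for \<sigma>
  define Cs where "Cs = (\<Sum>j\<in>UNIV. C j)"
  have Ps0: "0 \<le> Ps \<sigma>" for \<sigma> by (simp add: Ps_def sum_nonneg)
  have Ps: "Ps \<sigma> * exp (\<delta>1 * ?w \<sigma>) \<le> Cs * exp (- \<delta>1 * ?w \<sigma>)" for \<sigma>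
  proof -
    have "cmod (p j \<sigma>) \<le> C j * exp (- (2 * \<delta>1) * ?w \<sigma>)" for j
      using Cd(1)[of j] mult_right_mono[OF d1'[of j] w0[of \<sigma>]]
      by (intro order_trans[OF Cd(3)] mult_left_mono) auto
    then have "Ps \<sigma> \<le> Cs * exp (- (2 * \<delta>1) * ?w \<sigma>)"
      unfolding Ps_def Cs_def sum_distrib_right by (intro sum_mono)
    then have "Ps \<sigma> * exp (\<delta>1 * ?w \<sigma>) \<le> Cs * exp (- (2 * \<delta>1) * ?w \<sigma>) * exp (\<delta>1 * ?w \<sigma>)"
      by (intro mult_right_mono) auto
    also have "\<dots> = Cs * exp (- \<delta>1 * ?w \<sigma>)" by (simp add: mult.assoc flip: exp_add)
    finally show ?thesis .
  qed
  have PsS: "(\<lambda>\<sigma>. Ps \<sigma> * exp (\<delta>1 * ?w \<sigma>)) summable_on UNIV"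
    by (rule summable_on_comparison_test[OF summable_on_cmult_right[OF summable_on_weight_int[OF d1]] Ps])
       (simp add: Ps0)
  define A where "A = (\<Sum>\<^sub>\<infinity>\<sigma>. Ps \<sigma> * exp (\<delta>1 * ?w \<sigma>))"
  have A0: "0 \<le> A" unfolding A_def by (intro infsum_nonneg) (simp add: Ps0)
  \<comment> \<open>Chosen so that X T (1 + A) = M X T / 2 with X = nrm \<xi>: where |\<tau>|
    exceeds M X, the supremum T on the right is absorbed with factor one half.\<close>
  define M where "M = 2 * (A + 1)"
  have M1: "M \<ge> 1" using A0 by (simp add: M_def)
  show ?thesis
  proof (rule that[OF M1 d1])
    fix \<delta> :: real and \<xi> :: "'n \<Rightarrow> int" and w :: "int \<Rightarrow> complex" and S F :: real and \<eta> :: complex and \<tau>0 :: int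
    assume d0: "0 < \<delta>" "\<delta> \<le> \<delta>1" and F: "0 \<le> F" and eta: "cmod \<eta> \<le> nrm \<xi>" and S: "\<And>\<tau>. cmod (w \<tau>) \<le> S"
      and eq: "\<And>\<tau>. cmod (Lxi \<xi> w \<tau> - \<i> * \<eta> * w \<tau>) \<le> F * exp (- \<delta> * ?w \<tau>)"
    note d = conjI[OF d0]
    let ?X = "nrm \<xi>"
    have X: "1 \<le> ?X" by (rule nrm_ge_one)
    \<comment> \<open>The truncation height is the weight at \<open>\<tau>0\<close>, the index to be
      estimated, so nothing changes there; the truncated weight still passes through the convolution
      by \<open>hsub\<close>.\<close>
    define R where "R = ?w \<tau>0"
    define h where "h \<tau> = min (?w \<tau>) R" for \<tau> :: int
    have h0: "0 \<le> h \<tau>" "h \<tau> \<le> R" "h \<tau> \<le> ?w \<tau>" for \<tau> using w0 by (auto simp: h_def R_def)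
    have hsub: "h \<tau> \<le> ?w \<sigma> + h (\<tau> - \<sigma>)" for \<tau> \<sigma>
    proof -
      have "?w \<tau> \<le> \<omega> ((1 + \<bar>of_int (\<tau> - \<sigma>)\<bar>) + (1 + \<bar>of_int \<sigma>\<bar>))" by (intro om_mono) auto
      also have "\<dots> \<le> ?w (\<tau> - \<sigma>) + ?w \<sigma>" by (intro om_add) auto
      finally show ?thesis using w0[of \<sigma>] by (auto simp: h_def)
    qed
    have S0: "0 \<le> S" by (rule order_trans[OF norm_ge_zero S])
    define N where "N \<tau> = exp (\<delta> * h \<tau>) * cmod (w \<tau>)" for \<tau>
    have Nb: "N \<tau> \<le> exp (\<delta> * R) * S" for \<tau>
      unfolding N_def using h0[of \<tau>] d S S0 by (intro mult_mono) auto
    then have bdd: "bdd_above (range N)" by (rule bdd_aboveI2)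
    have N0: "0 \<le> N \<tau>" for \<tau> by (simp add: N_def)
    define T where "T = (SUP \<tau>. N \<tau>)"
    have NT: "N \<tau> \<le> T" for \<tau> unfolding T_def by (intro cSUP_upper bdd) auto
    have T0: "0 \<le> T" by (rule order_trans[OF N0 NT])
    let ?E = "exp (\<delta> * \<omega> (1 + M * ?X))"
    have step: "N \<tau> \<le> (F + S * ?E) + T / 2" for \<tau>
    proof (cases "\<bar>of_int \<tau>\<bar> \<le> M * ?X")
      case True
      have "?w \<tau> \<le> \<omega> (1 + M * ?X)" using True by (intro om_mono) auto
      then have "\<delta> * h \<tau> \<le> \<delta> * \<omega> (1 + M * ?X)"
        using d h0(3)[of \<tau>] by (intro mult_left_mono) auto
      then have "N \<tau> \<le> ?E * S" unfolding N_def using S by (intro mult_mono) auto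
      then show ?thesis using F T0 by (simp add: mult.commute)
    next
      case False
      have wle: "cmod (w (\<tau> - \<sigma>)) \<le> T * exp (- \<delta> * h \<tau>) * exp (\<delta>1 * ?w \<sigma>)" for \<sigma>
      proof -
        have "\<delta> * h \<tau> \<le> \<delta> * ?w \<sigma> + \<delta> * h (\<tau> - \<sigma>)"
          using hsub[of \<tau> \<sigma>] d by (metis distrib_left mult_left_mono less_imp_le)
        moreover have "\<delta> * ?w \<sigma> \<le> \<delta>1 * ?w \<sigma>" using d w0 by (intro mult_right_mono) auto
        ultimately have "- \<delta> * h (\<tau> - \<sigma>) \<le> - \<delta> * h \<tau> + \<delta>1 * ?w \<sigma>" by simp
        then have ex: "exp (- \<delta> * h (\<tau> - \<sigma>)) \<le> exp (- \<delta> * h \<tau> + \<delta>1 * ?w \<sigma>)" by simp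
        have "cmod (w (\<tau> - \<sigma>)) = N (\<tau> - \<sigma>) * exp (- \<delta> * h (\<tau> - \<sigma>))"
          by (simp add: N_def exp_minus divide_simps)
        also have "\<dots> \<le> T * exp (- \<delta> * h \<tau> + \<delta>1 * ?w \<sigma>)"
          by (intro mult_mono NT ex T0) auto
        finally show ?thesis by (simp only: exp_add mult.assoc)
      qed
      let ?Y = "T * exp (- \<delta> * h \<tau>)"
      have Y0: "0 \<le> ?Y" using T0 by simp
      have conv: "(\<Sum>j\<in>UNIV. cmod (\<Sum>\<^sub>\<infinity>\<sigma>. p j \<sigma> * w (\<tau> - \<sigma>))) \<le> ?Y * A"
      proof -
        have sj: "(\<lambda>\<sigma>. cmod (p j \<sigma> * w (\<tau> - \<sigma>))) summable_on UNIV" for j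
        proof (rule summable_on_comparison_test[OF summable_on_cmult_right[OF p_summable[of j], of S]])
          show "cmod (p j \<sigma> * w (\<tau> - \<sigma>)) \<le> S * cmod (p j \<sigma>)" for \<sigma>
            using mult_left_mono[OF S[of "\<tau> - \<sigma>"], of "cmod (p j \<sigma>)"] by (simp add: norm_mult mult.commute)
        qed simp
        have "(\<Sum>j\<in>UNIV. cmod (\<Sum>\<^sub>\<infinity>\<sigma>. p j \<sigma> * w (\<tau> - \<sigma>))) \<le> (\<Sum>j\<in>UNIV. \<Sum>\<^sub>\<infinity>\<sigma>. cmod (p j \<sigma> * w (\<tau> - \<sigma>)))"
          by (intro sum_mono norm_infsum_bound sj)
        also have "\<dots> = (\<Sum>\<^sub>\<infinity>\<sigma>. \<Sum>j\<in>UNIV. cmod (p j \<sigma> * w (\<tau> - \<sigma>)))"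
          by (rule infsum_finite_sum(2) [symmetric]) (auto intro: sj)
        also have "\<dots> \<le> (\<Sum>\<^sub>\<infinity>\<sigma>. ?Y * (Ps \<sigma> * exp (\<delta>1 * ?w \<sigma>)))"
        proof (rule infsum_mono)
          show "(\<lambda>\<sigma>. \<Sum>j\<in>UNIV. cmod (p j \<sigma> * w (\<tau> - \<sigma>))) summable_on UNIV"
            by (rule infsum_finite_sum(1)) (auto intro: sj)
          show "(\<lambda>\<sigma>. ?Y * (Ps \<sigma> * exp (\<delta>1 * ?w \<sigma>))) summable_on UNIV"
            by (rule summable_on_cmult_right[OF PsS])
          show "(\<Sum>j\<in>UNIV. cmod (p j \<sigma> * w (\<tau> - \<sigma>))) \<le> ?Y * (Ps \<sigma> * exp (\<delta>1 * ?w \<sigma>))" for \<sigma>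
            using mult_left_mono[OF wle[of \<sigma>] Ps0[of \<sigma>]]
            unfolding norm_mult Ps_def sum_distrib_right [symmetric] by (simp add: mult_ac)
        qed
        also have "\<dots> = ?Y * A" unfolding A_def by (rule infsum_cmult_right')
        finally show ?thesis .
      qed
      have xi: "\<bar>real_of_int (\<xi> j)\<bar> \<le> ?X" for j using nrm_ge[of \<xi> j] by linarith
      \<comment> \<open>The equation solved for i \<tau> w(\<tau>). The term with \<eta> is of the
        same order as the convolution terms because |\<eta>| \<le> nrm \<xi>.\<close>
      have "\<bar>of_int \<tau>\<bar> * cmod (w \<tau>) = cmod ((Lxi \<xi> w \<tau> - \<i> * \<eta> * w \<tau>) + \<i> * \<eta> * w \<tau>
          - (\<Sum>j\<in>UNIV. \<i> * of_int (\<xi> j) * (\<Sum>\<^sub>\<infinity>\<sigma>. p j \<sigma> * w (\<tau> - \<sigma>))))"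
        by (simp add: Lxi_def norm_mult)
      also have "\<dots> \<le> F * exp (- \<delta> * ?w \<tau>) + ?X * cmod (w \<tau>) + ?X * (?Y * A)"
      proof -
        have "cmod (\<i> * \<eta> * w \<tau>) \<le> ?X * cmod (w \<tau>)"
          using mult_right_mono[OF eta norm_ge_zero[of "w \<tau>"]] by (simp add: norm_mult)
        moreover have "cmod (\<Sum>j\<in>UNIV. \<i> * of_int (\<xi> j) * (\<Sum>\<^sub>\<infinity>\<sigma>. p j \<sigma> * w (\<tau> - \<sigma>))) \<le> ?X * (?Y * A)"
        proof -
          have "cmod (\<Sum>j\<in>UNIV. \<i> * of_int (\<xi> j) * (\<Sum>\<^sub>\<infinity>\<sigma>. p j \<sigma> * w (\<tau> - \<sigma>)))
             \<le> (\<Sum>j\<in>UNIV. ?X * cmod (\<Sum>\<^sub>\<infinity>\<sigma>. p j \<sigma> * w (\<tau> - \<sigma>)))"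
            by (intro sum_norm_le) (simp add: norm_mult mult_right_mono xi)
          also have "\<dots> \<le> ?X * (?Y * A)"
            unfolding sum_distrib_left [symmetric] using X by (intro mult_left_mono conv) auto
          finally show ?thesis .
        qed
        moreover have "cmod (x + y - z) \<le> cmod x + cmod y + cmod z" for x y z :: complex
          by (rule order_trans[OF norm_triangle_ineq4 add_right_mono[OF norm_triangle_ineq]])
        ultimately show ?thesis
          using eq[of \<tau>] by (meson add_mono order_trans)
      qed
      finally have "\<bar>of_int \<tau>\<bar> * cmod (w \<tau>) * exp (\<delta> * h \<tau>)
         \<le> (F * exp (- \<delta> * ?w \<tau>) + ?X * cmod (w \<tau>) + ?X * (?Y * A)) * exp (\<delta> * h \<tau>)"
        by (intro mult_right_mono) auto
      then have "\<bar>of_int \<tau>\<bar> * N \<tau> \<le> F * (exp (- \<delta> * ?w \<tau>) * exp (\<delta> * h \<tau>)) + ?X * N \<tau>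
          + ?X * (T * A * (exp (- \<delta> * h \<tau>) * exp (\<delta> * h \<tau>)))"
        by (simp add: N_def algebra_simps)
      also have "exp (- \<delta> * h \<tau>) * exp (\<delta> * h \<tau>) = 1" by (simp flip: exp_add)
      also have "F * (exp (- \<delta> * ?w \<tau>) * exp (\<delta> * h \<tau>)) \<le> F * 1"
        using F d h0(3)[of \<tau>] by (intro mult_left_mono) (auto simp flip: exp_add simp: mult_left_mono)
      also have "?X * N \<tau> \<le> ?X * T" using X NT by (intro mult_left_mono) auto
      finally have a1: "\<bar>of_int \<tau>\<bar> * N \<tau> \<le> F + ?X * T * (1 + A)" by (simp add: algebra_simps)
      have tau: "\<bar>of_int \<tau>\<bar> > M * ?X" using False by simp
      have MX: "1 \<le> M * ?X" using mult_mono[OF M1 X] M1 by simp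
      have "M * ?X * N \<tau> \<le> F + ?X * T * (1 + A)"
        using mult_right_mono[of "M * ?X" "\<bar>of_int \<tau>\<bar>" "N \<tau>"] tau N0[of \<tau>] a1 by linarith
      also have "\<dots> \<le> F * (M * ?X) + (M * ?X) * (T / 2)"
        using mult_left_mono[OF MX F] by (simp add: M_def algebra_simps)
      finally have "M * ?X * N \<tau> \<le> M * ?X * (F + T / 2)" by (simp add: algebra_simps)
      then have "N \<tau> \<le> F + T / 2" using MX by (meson mult_le_cancel_left_pos less_le_trans zero_less_one)
      moreover have "0 \<le> S * ?E" using S0 by simp
      ultimately show ?thesis by linarith
    qed
    have "T \<le> (F + S * ?E) + T / 2" unfolding T_def
      by (rule cSUP_least) (use step in \<open>auto simp: T_def\<close>)
    then have "T \<le> 2 * (F + S * ?E)" by (simp add: field_simps)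
    then have "N \<tau>0 \<le> 2 * (F + S * ?E)" by (rule order_trans[OF NT])
    then have "N \<tau>0 * exp (- \<delta> * ?w \<tau>0) \<le> 2 * (F + S * ?E) * exp (- \<delta> * ?w \<tau>0)"
      by (intro mult_right_mono) auto
    moreover have "N \<tau>0 * exp (- \<delta> * ?w \<tau>0) = cmod (w \<tau>0)"
      by (simp add: N_def h_def R_def exp_minus divide_simps)
    ultimately show "cmod (w \<tau>0) \<le> 2 * (F + S * ?E) * exp (- \<delta> * ?w \<tau>0)" by (simp only:)
  qed
qed

end

section \<open>Periodic solutions of the sliced equation\<close>

lemma antiderivative_exists:
  fixes g :: "real \<Rightarrow> complex"
  assumes "continuous_on UNIV g"
  obtains G where "\<And>t. (G has_vector_derivative g t) (at t)"
proof
  fix t :: real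
  let ?N = "\<bar>t\<bar> + 1"
  have "((\<lambda>u. LBINT y=ereal 0..ereal u. g y) has_vector_derivative g t) (at t within {- ?N..?N})"
    by (rule interval_integral_FTC2) (auto intro: continuous_on_subset[OF assms])
  moreover have "at t within {- ?N..?N} = at t" by (rule at_within_interior) auto
  ultimately show "((\<lambda>u. LBINT y=ereal 0..ereal u. g y) has_vector_derivative g t) (at t)" by simp
qed

lemma has_vector_derivative_shift:
  fixes F :: "real \<Rightarrow> complex"
  assumes "(F has_vector_derivative D) (at (t + h))"
  shows "((\<lambda>t. F (t + h)) has_vector_derivative D) (at t)"
proof -
  have "((\<lambda>t. t + h) has_vector_derivative 1) (at t)" by (auto intro!: derivative_eq_intros)
  from vector_diff_chain_at[OF this assms] show ?thesis by (simp add: o_def)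
qed

lemma has_vector_derivative_exp_comp:
  fixes P :: "real \<Rightarrow> complex"
  assumes "(P has_vector_derivative D) (at t)"
  shows "((\<lambda>t. exp (c * P t)) has_vector_derivative c * D * exp (c * P t)) (at t)"
proof -
  have "(exp has_field_derivative exp (c * P t)) (at (c * P t))" by (rule DERIV_exp)
  from field_vector_diff_chain_at[OF has_vector_derivative_mult_right[OF assms, of c] this]
  show ?thesis by (simp add: o_def mult_ac)
qed

text \<open>Integrating factor: with G a primitive of exp(i P) f, the candidate is exp(-i P) times
  the integral of exp(i P) f over the preceding period, divided by 1 - q. The multiplier q = exp(-i
  c) of the homogeneous equation must differ from 1.\<close>

lemma periodic_ode_solution:
  fixes P p f :: "real \<Rightarrow> complex"
  assumes p: "\<And>t. (P has_vector_derivative p t) (at t)" and P: "\<And>t. P (t + 2 * pi) = P t + c"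
    and f: "continuous_on UNIV f" "\<And>t. f (t + 2 * pi) = f t" and q: "exp (- \<i> * c) \<noteq> 1"
  obtains u where "\<And>t. (u has_vector_derivative f t - \<i> * p t * u t) (at t)" "\<And>t. u (t + 2 * pi) = u t"
proof -
  let ?q = "exp (- \<i> * c)"
  have Pc: "continuous_on UNIV P"
    using p by (intro continuous_at_imp_continuous_on) (auto intro: has_vector_derivative_continuous)
  have "continuous_on UNIV (\<lambda>t. exp (\<i> * P t) * f t)" by (intro continuous_intros Pc f)
  then obtain G where G: "\<And>t. (G has_vector_derivative exp (\<i> * P t) * f t) (at t)"
    using antiderivative_exists by blast
  have Pm: "P (t - 2 * pi) = P t - c" "f (t - 2 * pi) = f t" for t
    using P[of "t - 2 * pi"] f(2)[of "t - 2 * pi"] by auto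
  have Gm: "((\<lambda>t. G (t - 2 * pi)) has_vector_derivative ?q * (exp (\<i> * P t) * f t)) (at t)" for t
  proof -
    have "exp (\<i> * P (t + - (2 * pi))) * f (t + - (2 * pi)) = ?q * (exp (\<i> * P t) * f t)"
      by (simp add: Pm right_diff_distrib exp_diff exp_minus divide_inverse)
    then show ?thesis using has_vector_derivative_shift[OF G, where h="- (2 * pi)" and t=t] by simp
  qed
  \<comment> \<open>Both terms have the same derivative, so increments of G over consecutive periods
    are in ratio q. This cancels the factor q that exp(-i P) picks up over a period and makes u
    periodic.\<close>
  have Gdiff: "((\<lambda>t. ?q * G t - G (t - 2 * pi)) has_vector_derivative 0) (at t within UNIV)" for t
    using has_vector_derivative_diff[OF has_vector_derivative_mult_right[OF G, of ?q] Gm] by simp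
  obtain K where K: "\<And>t. ?q * G t - G (t - 2 * pi) = K"
    using has_vector_derivative_zero_constant[OF convex_UNIV Gdiff] by auto
  define u where "u t = exp (- \<i> * P t) * (G t - G (t - 2 * pi)) / (1 - ?q)" for t
  show ?thesis
  proof (rule that)
    fix t
    have "((\<lambda>t. exp (- \<i> * P t) * (G t - G (t - 2 * pi))) has_vector_derivative
       exp (- \<i> * P t) * (exp (\<i> * P t) * f t - ?q * (exp (\<i> * P t) * f t))
       + (- \<i> * p t * exp (- \<i> * P t)) * (G t - G (t - 2 * pi))) (at t)"
      by (rule has_vector_derivative_mult[OF has_vector_derivative_exp_comp[OF p] has_vector_derivative_diff[OF G Gm]])
    from has_vector_derivative_divide[OF this, of "1 - ?q"]
    have "(u has_vector_derivative (exp (- \<i> * P t) * (exp (\<i> * P t) * f t - ?q * (exp (\<i> * P t) * f t))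
       + (- \<i> * p t * exp (- \<i> * P t)) * (G t - G (t - 2 * pi))) / (1 - ?q)) (at t)"
      by (simp add: u_def [abs_def])
    moreover have "exp (- \<i> * P t) * (exp (\<i> * P t) * f t - ?q * (exp (\<i> * P t) * f t)) = (1 - ?q) * f t"
      by (simp add: exp_minus field_simps)
    ultimately show "(u has_vector_derivative f t - \<i> * p t * u t) (at t)"
      using q by (simp add: u_def add_divide_distrib diff_divide_distrib mult.assoc)
    have "?q * (G (t + 2 * pi) - G t) = G t - G (t - 2 * pi)"
      using K[of t] K[of "t + 2 * pi"] by (simp add: algebra_simps)
    moreover have "exp (- \<i> * P (t + 2 * pi)) = ?q * exp (- \<i> * P t)"
      by (simp add: P distrib_left exp_diff exp_minus divide_inverse)
    ultimately show "u (t + 2 * pi) = u t" by (simp add: u_def mult_ac)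
  qed
qed

text \<open>The function s \<mapsto> exp(i (P s - P t)) u(s) has derivative exp(i (P s - P t)) f(s);
  it is integrated over the period after or before t. Both directions are kept so that one can
  choose the side on which Im P stays above Im P t and the exponential is bounded.\<close>

lemma periodic_ode_bound:
  fixes P p f u :: "real \<Rightarrow> complex"
  assumes p: "\<And>t. (P has_vector_derivative p t) (at t)"
    and u: "\<And>t. (u has_vector_derivative f t - \<i> * p t * u t) (at t)" "\<And>t. u (t + 2 * pi) = u t"
    and h: "h = 2 * pi \<or> h = - 2 * pi"
    and B: "\<And>s. min t (t + h) \<le> s \<Longrightarrow> s \<le> max t (t + h) \<Longrightarrow> cmod (exp (\<i> * (P s - P t)) * f s) \<le> B"
  shows "cmod (exp (\<i> * (P (t + h) - P t)) - 1) * cmod (u t) \<le> 2 * pi * B"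
proof -
  define H where "H s = exp (\<i> * (P s - P t)) * u s" for s
  have dH: "(H has_vector_derivative exp (\<i> * (P s - P t)) * f s) (at s)" for s
  proof -
    have "((\<lambda>s. P s - P t) has_vector_derivative p s) (at s)"
      using has_vector_derivative_diff[OF p[of s] has_vector_derivative_const[of "P t"]] by simp
    from has_vector_derivative_mult[OF has_vector_derivative_exp_comp[OF this, of \<i>] u(1)[of s]]
    show ?thesis by (simp add: H_def [abs_def] algebra_simps)
  qed
  have hp: "max t (t + h) - min t (t + h) = 2 * pi" unfolding max_def min_def using h pi_gt_zero by (smt (verit))
  have "min t (t + h) \<le> max t (t + h)" by simp
  moreover have "0 \<le> B" using order_trans[OF norm_ge_zero B[of t]] by simp
  ultimately have "cmod (H (max t (t + h)) - H (min t (t + h))) \<le> B * (max t (t + h) - min t (t + h))"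
    by (rule norm_increment_le) (use B dH in \<open>auto intro: has_vector_derivative_at_within\<close>)
  then have "cmod (H (t + h) - H t) \<le> 2 * pi * B"
    unfolding hp by (cases "h \<ge> 0") (auto simp: max_def min_def norm_minus_commute mult.commute)
  moreover have "u (t + h) = u t" using h u(2)[of t] u(2)[of "t - 2 * pi"] by auto
  then have "H (t + h) - H t = (exp (\<i> * (P (t + h) - P t)) - 1) * u t" by (simp add: H_def algebra_simps)
  ultimately show ?thesis by (simp add: norm_mult)
qed

text \<open>For |w| < 1/2 the logarithm of 1 + w has modulus at most 2 |w|, and division by 2 pi
  more than compensates the factor 2.\<close>

lemma near_integer_if_exp_near_one:
  assumes "cmod (exp (2 * of_real pi * \<i> * z) - 1) < 1 / 2"
  obtains \<tau> :: int where "cmod (z - of_int \<tau>) \<le> cmod (exp (2 * of_real pi * \<i> * z) - 1)"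
proof -
  define w where "w = exp (2 * of_real pi * \<i> * z) - 1"
  have w: "cmod w < 1 / 2" using assms by (simp add: w_def)
  have "exp (Ln (1 + w)) = exp (2 * of_real pi * \<i> * z)"
    by (subst exp_Ln) (auto simp: w_def)
  then obtain n :: int where n: "2 * of_real pi * \<i> * z = Ln (1 + w) + (of_int (2 * n) * pi) * \<i>"
    unfolding exp_eq by (metis exp_eq)
  have "2 * of_real pi * \<i> * (z - of_int n) = Ln (1 + w)" using n by (simp add: algebra_simps)
  then have "2 * pi * cmod (z - of_int n) = cmod (Ln (1 + w))"
    by (metis norm_mult norm_ii norm_of_real norm_numeral mult.right_neutral abs_of_pos pi_gt_zero)
  also have "\<dots> \<le> 2 * cmod w" by (rule norm_Ln_le[OF w])
  finally have "pi * cmod (z - of_int n) \<le> cmod w" by simp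
  moreover have "cmod (z - of_int n) \<le> pi * cmod (z - of_int n)"
    using pi_gt3 by (simp add: mult_le_cancel_right1)
  ultimately show ?thesis using that[of n] by (simp add: w_def)
qed

section \<open>Primitives of the sliced symbol, its mean, and small divisors\<close>

lemma integral_mean_T1: "integral {0..2 * pi} q = 2 * pi * mean_T1 q"
  by (simp add: mean_T1_def)

context vector_field
begin

text \<open>The mean of \<open>px \<xi>\<close> over a period, that is <\<xi>, \<alpha>_0 + i
  \<beta>_0>.\<close>

definition Zx :: "('n \<Rightarrow> int) \<Rightarrow> complex" where
  "Zx \<xi> = (\<Sum>j\<in>UNIV. of_int (\<xi> j) * (of_real (mean_T1 (a j)) + \<i> * of_real (mean_T1 (b j))))"

text \<open>A primitive of \<open>px \<xi>\<close>. Its additive constant is immaterial, hence the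
  arbitrary choice.\<close>

definition Px :: "('n \<Rightarrow> int) \<Rightarrow> real \<Rightarrow> complex" where
  "Px \<xi> = (SOME P. \<forall>t. (P has_vector_derivative px \<xi> t) (at t))"

lemma Px_derivative: "(Px \<xi> has_vector_derivative px \<xi> t) (at t)"
proof -
  obtain P where "\<And>t. (P has_vector_derivative px \<xi> t) (at t)"
    using antiderivative_exists[OF px_props(1)] by blast
  then have "\<exists>P. \<forall>t. (P has_vector_derivative px \<xi> t) (at t)" by blast
  from someI_ex[OF this] show ?thesis unfolding Px_def by blast
qed

lemma Px_shift: "Px \<xi> (t + 2 * pi) = Px \<xi> t + 2 * of_real pi * Zx \<xi>"
proof -
  have dz: "((\<lambda>t. Px \<xi> (t + 2 * pi) - Px \<xi> t) has_vector_derivative 0) (at t within UNIV)" for t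
    using has_vector_derivative_diff[OF has_vector_derivative_shift[OF Px_derivative[of \<xi> "t + 2 * pi"]] Px_derivative[of \<xi> t]]
    by (simp add: px_props)
  obtain K where K: "\<And>t. Px \<xi> (t + 2 * pi) - Px \<xi> t = K"
    using has_vector_derivative_zero_constant[OF convex_UNIV dz] by auto
  have ia: "q integrable_on {0..2 * pi}" if "continuous_on UNIV q" for q :: "real \<Rightarrow> real"
    by (intro integrable_continuous_real continuous_on_subset[OF that]) auto
  have hi: "((\<lambda>t. complex_of_real (q t)) has_integral of_real (2 * pi * mean_T1 q)) {0..2 * pi}"
    if "continuous_on UNIV q" for q
    using has_integral_linear[OF integrable_integral[OF ia[OF that]], of complex_of_real] bounded_linear_of_real
    unfolding integral_mean_T1 by (simp add: o_def)
  have i1: "(px \<xi> has_integral (\<Sum>j\<in>UNIV. of_int (\<xi> j) * (of_real (2 * pi * mean_T1 (a j)) + \<i> * of_real (2 * pi * mean_T1 (b j))))) {0..2 * pi}"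
    unfolding px_def [abs_def]
    by (intro has_integral_sum has_integral_mult_right has_integral_add hi a_props b_props) auto
  have i2: "(px \<xi> has_integral (Px \<xi> (2 * pi) - Px \<xi> 0)) {0..2 * pi}"
    by (intro fundamental_theorem_of_calculus) (auto intro: has_vector_derivative_at_within Px_derivative)
  have "Px \<xi> (2 * pi) - Px \<xi> 0 = (\<Sum>j\<in>UNIV. of_int (\<xi> j) * (of_real (2 * pi * mean_T1 (a j)) + \<i> * of_real (2 * pi * mean_T1 (b j))))"
    by (rule has_integral_unique[OF i2 i1])
  also have "\<dots> = 2 * of_real pi * Zx \<xi>" by (simp add: Zx_def sum_distrib_left algebra_simps)
  finally have "K = 2 * of_real pi * Zx \<xi>" using K[of 0] by simp
  then show ?thesis using K[of t] by (simp add: algebra_simps)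
qed

lemma Im_px: "Im (px \<xi> t) = (\<Sum>j\<in>UNIV. of_int (\<xi> j) * b j t)"
  by (simp add: px_def)

lemma norm_Zx_le: "\<exists>C\<ge>0. \<forall>\<xi>. cmod (Zx \<xi>) \<le> C * nrm \<xi>"
proof (intro exI conjI allI)
  let ?c = "\<lambda>j. cmod (of_real (mean_T1 (a j)) + \<i> * of_real (mean_T1 (b j)))"
  show "0 \<le> (\<Sum>j\<in>UNIV. ?c j)" by (simp add: sum_nonneg)
  fix \<xi> :: "'n \<Rightarrow> int"
  have "cmod (Zx \<xi>) \<le> (\<Sum>j\<in>UNIV. nrm \<xi> * ?c j)"
    unfolding Zx_def
  proof (rule sum_norm_le)
    fix j
    have "\<bar>real_of_int (\<xi> j)\<bar> \<le> nrm \<xi>" using nrm_ge[of \<xi> j] by linarith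
    then show "cmod (of_int (\<xi> j) * (of_real (mean_T1 (a j)) + \<i> * of_real (mean_T1 (b j)))) \<le> nrm \<xi> * ?c j"
      by (simp add: norm_mult mult_right_mono)
  qed
  then show "cmod (Zx \<xi>) \<le> (\<Sum>j\<in>UNIV. ?c j) * nrm \<xi>" by (simp add: sum_distrib_left mult.commute)
qed

lemma euclid_le_nrm: "sqrt (real_of_int \<tau> ^ 2 + (\<Sum>j\<in>UNIV. real_of_int (\<xi> j) ^ 2)) \<le> nrm (join \<tau> \<xi>)"
  for \<xi> :: "'n \<Rightarrow> int"
proof -
  have "real_of_int \<tau> ^ 2 + (\<Sum>j\<in>UNIV. real_of_int (\<xi> j) ^ 2) = (\<Sum>i\<in>UNIV. real_of_int (join \<tau> \<xi> i) ^ 2)"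
    by (simp add: UNIV_option_conv sum.reindex)
  then have "sqrt (real_of_int \<tau> ^ 2 + (\<Sum>j\<in>UNIV. real_of_int (\<xi> j) ^ 2)) = L2_set (\<lambda>i. real_of_int (join \<tau> \<xi> i)) UNIV"
    by (simp add: L2_set_def)
  also have "\<dots> \<le> (\<Sum>i\<in>UNIV. \<bar>real_of_int (join \<tau> \<xi> i)\<bar>)" by (rule L2_set_le_sum_abs)
  finally show ?thesis by (simp add: nrm_def)
qed

text \<open>If exp(2 pi i z) is close to 1, then z is close to an integer \<tau>, and |\<tau>| is
  then at most (D + 1) nrm \<xi>; so the weight at (\<tau>, \<xi>) in (EDC) is controlled by the
  weight at \<xi> alone. The sign \<sigma> covers both directions of integration over a
  period.\<close>

lemma EDC_exp_bound:
  assumes EDC: "EDC1 \<omega> (\<lambda>j. mean_T1 (a j)) (\<lambda>j. mean_T1 (b j))" and e: "0 < \<epsilon>"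
  shows "\<exists>C>0. \<forall>\<xi>. (\<exists>j. \<xi> j \<noteq> 0) \<longrightarrow> (\<forall>\<sigma>\<in>{1, -1}. C * exp (- \<epsilon> * \<omega> (nrm \<xi>)) \<le> cmod (exp (\<sigma> * (2 * of_real pi * \<i> * Zx \<xi>)) - 1))"
proof -
  obtain D where D: "D \<ge> 0" "\<And>\<xi>. cmod (Zx \<xi>) \<le> D * nrm \<xi>" using norm_Zx_le by blast
  \<comment> \<open>The divisor D + 3 comes from nrm (\<tau>, \<xi>) \<le> (D + 2) nrm \<xi> and the
    additional 1 of \<open>om_mult\<close>.\<close>
  define \<epsilon>' where "\<epsilon>' = \<epsilon> / (D + 3)"
  have e': "\<epsilon>' > 0" using e D by (simp add: \<epsilon>'_def)
  obtain C where C: "C > 0" "\<And>(\<tau>::int) (\<xi>::'n \<Rightarrow> int). (\<tau> \<noteq> 0 \<or> (\<exists>j. \<xi> j \<noteq> 0)) \<Longrightarrow>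
        C * exp (- \<epsilon>' * \<omega> (sqrt (real_of_int \<tau> ^ 2 + (\<Sum>j\<in>UNIV. real_of_int (\<xi> j) ^ 2)))) \<le> cmod (of_int \<tau> + Zx \<xi>)"
    using EDC[unfolded EDC1_def, rule_format, OF e'] unfolding Zx_def by blast
  have key: "min (1 / 2) C * exp (- \<epsilon> * \<omega> (nrm \<xi>)) \<le> cmod (exp (2 * of_real pi * \<i> * (\<sigma> * Zx \<xi>)) - 1)"
    if xi: "\<exists>j. \<xi> j \<noteq> 0" and sg: "\<sigma> = 1 \<or> \<sigma> = -1" for \<xi> \<sigma>
  proof (cases "cmod (exp (2 * of_real pi * \<i> * (\<sigma> * Zx \<xi>)) - 1) < 1 / 2")
    case True
    then obtain \<tau> :: int where t: "cmod (\<sigma> * Zx \<xi> - of_int \<tau>) \<le> cmod (exp (2 * of_real pi * \<i> * (\<sigma> * Zx \<xi>)) - 1)"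
      by (rule near_integer_if_exp_near_one)
    obtain \<tau>' :: int where t': "cmod (\<sigma> * Zx \<xi> - of_int \<tau>) = cmod (of_int \<tau>' + Zx \<xi>)" "\<bar>\<tau>'\<bar> = \<bar>\<tau>\<bar>"
    proof (cases "\<sigma> = 1")
      case True
      then show ?thesis using that[of "- \<tau>"] by simp
    next
      case False
      then have "\<sigma> * Zx \<xi> - of_int \<tau> = - (of_int \<tau> + Zx \<xi>)" using sg by auto
      then show ?thesis using that[of \<tau>] by (simp only: norm_minus_cancel)
    qed
    have "cmod (of_int \<tau>' + Zx \<xi>) < 1 / 2" using t t' True by linarith
    then have "\<bar>real_of_int \<tau>'\<bar> \<le> cmod (Zx \<xi>) + 1 / 2"
      using norm_triangle_ineq4[of "of_int \<tau>' + Zx \<xi>" "Zx \<xi>"] by simp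
    also have "\<dots> \<le> D * nrm \<xi> + nrm \<xi>" using D(2)[of \<xi>] nrm_ge_one[of \<xi>] by linarith
    finally have "nrm (join \<tau>' \<xi>) \<le> (D + 2) * nrm \<xi>" unfolding nrm_join by (simp add: algebra_simps)
    then have le: "sqrt (real_of_int \<tau>' ^ 2 + (\<Sum>j\<in>UNIV. real_of_int (\<xi> j) ^ 2)) \<le> (D + 2) * nrm \<xi>"
      using euclid_le_nrm[of \<tau>' \<xi>] by linarith
    have "\<omega> (sqrt (real_of_int \<tau>' ^ 2 + (\<Sum>j\<in>UNIV. real_of_int (\<xi> j) ^ 2))) \<le> \<omega> ((D + 2) * nrm \<xi>)"
      by (intro om_mono le real_sqrt_ge_zero add_nonneg_nonneg sum_nonneg) auto
    also have "\<dots> \<le> (D + 2 + 1) * \<omega> (nrm \<xi>)" using D nrm_pos[of \<xi>] by (intro om_mult) auto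
    finally have "\<epsilon>' * \<omega> (sqrt (real_of_int \<tau>' ^ 2 + (\<Sum>j\<in>UNIV. real_of_int (\<xi> j) ^ 2))) \<le> \<epsilon>' * ((D + 3) * \<omega> (nrm \<xi>))"
      using e' by (intro mult_left_mono) (auto simp: algebra_simps)
    also have "\<dots> = \<epsilon> * \<omega> (nrm \<xi>)" using D by (simp add: \<epsilon>'_def add_nonneg_eq_0_iff)
    finally have "exp (- \<epsilon> * \<omega> (nrm \<xi>)) \<le> exp (- \<epsilon>' * \<omega> (sqrt (real_of_int \<tau>' ^ 2 + (\<Sum>j\<in>UNIV. real_of_int (\<xi> j) ^ 2))))"
      by simp
    then have "min (1 / 2) C * exp (- \<epsilon> * \<omega> (nrm \<xi>)) \<le> C * exp (- \<epsilon>' * \<omega> (sqrt (real_of_int \<tau>' ^ 2 + (\<Sum>j\<in>UNIV. real_of_int (\<xi> j) ^ 2))))"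
      using C(1) by (intro mult_mono) auto
    also have "\<dots> \<le> cmod (of_int \<tau>' + Zx \<xi>)" using xi by (intro C(2)) auto
    finally show ?thesis using t t' by linarith
  next
    case False
    have "exp (- \<epsilon> * \<omega> (nrm \<xi>)) \<le> 1" using e om_nrm_nonneg[of \<xi>] by simp
    then have "min (1 / 2) C * exp (- \<epsilon> * \<omega> (nrm \<xi>)) \<le> 1 / 2 * 1" using C(1) by (intro mult_mono) auto
    then show ?thesis using False by linarith
  qed
  have "C > 0 \<Longrightarrow> min (1 / 2) C > 0" by simp
  moreover have "2 * of_real pi * \<i> * (\<sigma> * Zx \<xi>) = \<sigma> * (2 * of_real pi * \<i> * Zx \<xi>)" for \<sigma> \<xi> by simp
  ultimately show ?thesis using C(1) key by (intro exI[of _ "min (1 / 2) C"]) (metis insertE singletonD)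
qed

end

section \<open>Sufficiency\<close>

context weight
begin

definition delta :: "('m::finite \<Rightarrow> int) \<Rightarrow> ('m \<Rightarrow> int) \<Rightarrow> complex" where
  "delta k l = (if l = k then 1 else 0)"

lemma decays_delta: "decays (delta k)"
  unfolding decays_def
proof (rule exI[of _ "exp (\<omega> (nrm k))"], rule exI[of _ 1], intro conjI allI)
  fix l show "cmod (delta k l) \<le> exp (\<omega> (nrm k)) * exp (- 1 * \<omega> (nrm l))"
    by (simp add: delta_def flip: exp_add)
qed auto

lemma infsum_delta: "(\<Sum>\<^sub>\<infinity>l. f l * delta k l) = f k"
proof -
  have "(\<Sum>\<^sub>\<infinity>l. f l * delta k l) = (\<Sum>\<^sub>\<infinity>l\<in>{k}. f l * delta k l)"
    by (rule infsum_cong_neutral) (auto simp: delta_def)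
  then show ?thesis by (simp add: delta_def)
qed

lemma Ffun_delta: "Ffun (delta k) = ee k"
  using infsum_delta[of "\<lambda>l. ee l _" k] by (auto simp: Ffun_def fun_eq_iff mult.commute)

lemma ee_in_E_roumieu: "ee k \<in> E_roumieu \<omega>" and fc_ee: "fc (ee k) = delta k"
  using Ffun_in_E_roumieu[OF decays_delta[of k]] fc_Ffun_decays[OF decays_delta[of k]] by (simp_all add: Ffun_delta)

lemma mu_of_ee: "mu_of m (ee k) = m (\<lambda>i. - k i)"
  using ee_in_E_roumieu[of k] infsum_delta[of "\<lambda>l. m (\<lambda>i. - l i)" k] by (simp add: mu_of_def fc_ee)

lemma mu_of_delta_zero: "\<phi> \<in> E_roumieu \<omega> \<Longrightarrow> mu_of (delta (\<lambda>_. 0)) \<phi> = fc \<phi> (\<lambda>_. 0)"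
proof -
  assume "\<phi> \<in> E_roumieu \<omega>"
  moreover have "delta (\<lambda>_. 0) (\<lambda>i. - k i) = delta (\<lambda>_. 0) k" for k :: "'a \<Rightarrow> int"
    by (auto simp: delta_def fun_eq_iff)
  ultimately show ?thesis using infsum_delta[of "fc \<phi>" "\<lambda>_. 0"] by (simp add: mu_of_def mult.commute)
qed

lemma mu_of_add_cmult:
  assumes "grows m" "grows m'" "\<phi> \<in> E_roumieu \<omega>"
  shows "mu_of (\<lambda>k. m k + c * m' k) \<phi> = mu_of m \<phi> + c * mu_of m' \<phi>"
proof -
  note d = E_roumieu_imp_decays(1)[OF assms(3)]
  note s = summable_pairing(2)[OF assms(1) d] and s' = summable_pairing(2)[OF assms(2) d]
  show ?thesis
    using assms(3) infsum_add[OF s summable_on_cmult_right[OF s', of c]]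
    by (simp add: mu_of_def distrib_right mult.assoc infsum_cmult_right')
qed

lemma E_dual_linear:
  assumes "\<mu> \<in> E_dual \<omega>" "f \<in> E_roumieu \<omega>" "g \<in> E_roumieu \<omega>"
  shows "\<mu> (\<lambda>x. f x + c * g x) = \<mu> f + c * \<mu> g"
  using assms E_roumieu_cmult(1)[OF assms(3), of c] by (simp add: E_dual_def)

text \<open>The weight of the joint index lies between half the sum and the sum of the weights of
  its two parts: the lower bound is monotonicity and costs half of the rate, the upper bound is
  subadditivity and costs nothing.\<close>

lemma exp_join_le:
  fixes \<xi> :: "'n::finite \<Rightarrow> int"
  assumes "0 < \<delta>"
  shows "exp (- \<delta> * \<omega> (nrm (join \<tau> \<xi>))) \<le> exp (- (\<delta> / 2) * \<omega> (nrm \<xi>)) * exp (- (\<delta> / 2) * \<omega> (1 + \<bar>of_int \<tau>\<bar>))"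
    and "exp (- \<delta> * \<omega> (nrm \<xi>)) * exp (- \<delta> * \<omega> (1 + \<bar>of_int \<tau>\<bar>)) \<le> exp (- \<delta> * \<omega> (nrm (join \<tau> \<xi>)))"
proof -
  have "\<omega> (nrm \<xi>) \<le> \<omega> (nrm (join \<tau> \<xi>))" "\<omega> (1 + \<bar>of_int \<tau>\<bar>) \<le> \<omega> (nrm (join \<tau> \<xi>))"
    using nrm_ge_one[of \<xi>] by (auto intro!: om_mono simp: nrm_join)
  then have "\<omega> (nrm \<xi>) + \<omega> (1 + \<bar>of_int \<tau>\<bar>) \<le> 2 * \<omega> (nrm (join \<tau> \<xi>))" by simp
  from mult_left_mono[OF this, of "\<delta> / 2"] assms
  show "exp (- \<delta> * \<omega> (nrm (join \<tau> \<xi>))) \<le> exp (- (\<delta> / 2) * \<omega> (nrm \<xi>)) * exp (- (\<delta> / 2) * \<omega> (1 + \<bar>of_int \<tau>\<bar>))"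
    by (simp add: algebra_simps flip: exp_add)
  have "\<omega> (nrm (join \<tau> \<xi>)) \<le> \<omega> (nrm \<xi> + (1 + \<bar>of_int \<tau>\<bar>))"
    unfolding nrm_join using nrm_ge_one[of \<xi>] by (intro om_mono) auto
  also have "\<dots> \<le> \<omega> (nrm \<xi>) + \<omega> (1 + \<bar>of_int \<tau>\<bar>)"
    using nrm_ge_one[of \<xi>] by (intro om_add) auto
  finally have "\<omega> (nrm (join \<tau> \<xi>)) \<le> \<omega> (nrm \<xi>) + \<omega> (1 + \<bar>of_int \<tau>\<bar>)" .
  from mult_left_mono[OF this, of \<delta>] assms
  show "exp (- \<delta> * \<omega> (nrm \<xi>)) * exp (- \<delta> * \<omega> (1 + \<bar>of_int \<tau>\<bar>)) \<le> exp (- \<delta> * \<omega> (nrm (join \<tau> \<xi>)))"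
    by (simp add: algebra_simps flip: exp_add)
qed

end

section \<open>Imaginary part of one sign: solving every slice with uniform bounds\<close>

context vector_field
begin

text \<open>A b_j with nonzero factor hands its constant sign on to g, and every combination <\<xi>,
  b> is again a multiple of g.\<close>

lemma Im_px_sign:
  assumes ns: "\<And>j. \<not> changes_sign (b j)" and bg: "\<And>j. b j = (\<lambda>t. c j * g t)"
  shows "(\<forall>t. Im (px \<xi> t) \<ge> 0) \<or> (\<forall>t. Im (px \<xi> t) \<le> 0)"
proof -
  have I: "Im (px \<xi> t) = (\<Sum>j\<in>UNIV. of_int (\<xi> j) * c j) * g t" for t
    by (simp add: Im_px bg sum_distrib_right mult.assoc)
  show ?thesis
  proof (cases "\<forall>j. c j = 0")
    case True
    then show ?thesis by (simp add: I)
  next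
    case False
    then obtain j where j: "c j \<noteq> 0" by auto
    have "(\<forall>t. g t \<ge> 0) \<or> (\<forall>t. g t \<le> 0)"
    proof (rule ccontr)
      assume "\<not> ?thesis"
      then obtain s t where "g s < 0" "g t > 0" by (auto simp: not_le)
      then have "changes_sign (b j)"
        unfolding changes_sign_def bg using j
        by (cases "c j > 0") (auto simp: mult_less_0_iff zero_less_mult_iff not_less)
      then show False using ns by blast
    qed
    then show ?thesis unfolding I
      by (cases "(\<Sum>j\<in>UNIV. of_int (\<xi> j) * c j) \<ge> 0") (auto simp: mult_le_0_iff zero_le_mult_iff)
  qed
qed

lemma Im_Px_mono:
  assumes "\<And>t. Im (px \<xi> t) \<ge> 0" "s \<le> t"
  shows "Im (Px \<xi> s) \<le> Im (Px \<xi> t)"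
proof (rule DERIV_nonneg_imp_nondecreasing[OF assms(2)])
  fix r
  have "((\<lambda>t. Im (Px \<xi> t)) has_vector_derivative Im (px \<xi> r)) (at r)"
    using bounded_linear.has_vector_derivative[OF bounded_linear_Im Px_derivative] .
  then show "\<exists>y. ((\<lambda>t. Im (Px \<xi> t)) has_real_derivative y) (at r) \<and> 0 \<le> y"
    using assms(1) by (auto simp: has_real_derivative_iff_has_vector_derivative)
qed

lemma Im_Px_antimono:
  assumes "\<And>t. Im (px \<xi> t) \<le> 0" "s \<le> t"
  shows "Im (Px \<xi> t) \<le> Im (Px \<xi> s)"
proof (rule DERIV_nonpos_imp_nonincreasing[OF assms(2)])
  fix r
  have "((\<lambda>t. Im (Px \<xi> t)) has_vector_derivative Im (px \<xi> r)) (at r)"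
    using bounded_linear.has_vector_derivative[OF bounded_linear_Im Px_derivative] .
  then show "\<exists>y. ((\<lambda>t. Im (Px \<xi> t)) has_real_derivative y) (at r) \<and> y \<le> 0"
    using assms(1) by (auto simp: has_real_derivative_iff_has_vector_derivative)
qed

lemma Px_shift_minus: "Px \<xi> (t - 2 * pi) = Px \<xi> t - 2 * of_real pi * Zx \<xi>"
  using Px_shift[of \<xi> "t - 2 * pi"] by simp

text \<open>On a slice the data decay in \<xi> at rate \<delta>/2; (EDC) with \<epsilon> =
  \<delta>/4 costs half of that. The remaining \<delta>/4 pays for the factor exp(\<delta>'
  \<omega>(1 + M nrm \<xi>)) of \<open>regularity\<close>, which is why \<delta>' is taken with
  \<delta>' (M + 2) \<le> \<delta>/8.\<close>

lemma slice_solution: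
  assumes sign: "\<And>\<xi>. (\<forall>t. Im (px \<xi> t) \<ge> 0) \<or> (\<forall>t. Im (px \<xi> t) \<le> 0)"
    and EDC: "EDC1 \<omega> (\<lambda>j. mean_T1 (a j)) (\<lambda>j. mean_T1 (b j))" and f: "decays f"
  shows "\<exists>K \<delta>. 0 \<le> K \<and> 0 < \<delta> \<and> (\<forall>\<xi>. (\<exists>j. \<xi> j \<noteq> 0) \<longrightarrow> (\<exists>w. (\<forall>\<tau>. Lxi \<xi> w \<tau> = f (join \<tau> \<xi>)) \<and>
      (\<forall>\<tau>. cmod (w \<tau>) \<le> K * exp (- \<delta> * \<omega> (nrm (join \<tau> \<xi>))))))"
proof (rule regularity)
  fix M \<delta>1 :: real
  assume M: "1 \<le> M" "0 < \<delta>1" "\<And>\<delta> \<xi> w S F \<eta> \<tau>. 0 < \<delta> \<Longrightarrow> \<delta> \<le> \<delta>1 \<Longrightarrow> 0 \<le> F \<Longrightarrow> cmod \<eta> \<le> nrm \<xi> \<Longrightarrow> (\<And>\<tau>. cmod (w \<tau>) \<le> S) \<Longrightarrow>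
     (\<And>\<tau>. cmod (Lxi \<xi> w \<tau> - \<i> * \<eta> * w \<tau>) \<le> F * exp (- \<delta> * \<omega> (1 + \<bar>of_int \<tau>\<bar>))) \<Longrightarrow>
     cmod (w \<tau>) \<le> 2 * (F + S * exp (\<delta> * \<omega> (1 + M * nrm \<xi>))) * exp (- \<delta> * \<omega> (1 + \<bar>of_int \<tau>\<bar>))"
  obtain F \<delta> where F: "0 \<le> F" "0 < \<delta>" "\<And>k. cmod (f k) \<le> F * exp (- \<delta> * \<omega> (nrm k))"
    using f by (auto simp: decays_def)
  have d4: "0 < \<delta> / 4" using F by simp
  obtain C where C: "C > 0" "\<And>\<xi> \<sigma>. (\<exists>j. \<xi> j \<noteq> 0) \<Longrightarrow> \<sigma> \<in> {1, -1} \<Longrightarrow>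
     C * exp (- (\<delta> / 4) * \<omega> (nrm \<xi>)) \<le> cmod (exp (\<sigma> * (2 * of_real pi * \<i> * Zx \<xi>)) - 1)"
    using EDC_exp_bound[OF EDC d4] by blast
  define Z where "Z = (\<Sum>\<^sub>\<infinity>\<tau>::int. exp (- (\<delta> / 2) * \<omega> (1 + \<bar>of_int \<tau>\<bar>)))"
  have Z: "0 \<le> Z" unfolding Z_def by (intro infsum_nonneg) simp
  define S where "S = 2 * pi * F * Z / C"
  have S: "0 \<le> S" using F Z C by (simp add: S_def)
  define \<delta>' where "\<delta>' = min \<delta>1 (\<delta> / (8 * (M + 2)))"
  have d': "0 < \<delta>'" "\<delta>' \<le> \<delta>1" using M F by (auto simp: \<delta>'_def)
  have "\<delta>' \<le> \<delta> / (8 * (M + 2))" by (simp add: \<delta>'_def)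
  then have d'M: "\<delta>' * (M + 2) \<le> \<delta> / 8" using M by (simp add: field_simps)
  have "\<delta>' * 1 \<le> \<delta>' * (M + 2)" using d' M by (intro mult_left_mono) auto
  then have d'8: "\<delta>' \<le> \<delta> / 8" using d'M by linarith
  define K where "K = 2 * (F + S)"
  show ?thesis
  proof (rule exI[of _ K], rule exI[of _ \<delta>'], intro conjI allI impI)
    show "0 \<le> K" "0 < \<delta>'" using F S d' by (auto simp: K_def)
    fix \<xi> :: "'n \<Rightarrow> int" assume xi: "\<exists>j. \<xi> j \<noteq> 0"
    let ?n = "\<omega> (nrm \<xi>)" and ?w = "\<lambda>\<tau>::int. \<omega> (1 + \<bar>of_int \<tau>\<bar>)"
    have n0: "0 \<le> ?n" by (rule om_nrm_nonneg)
    have fb: "cmod (f (join \<tau> \<xi>)) \<le> F * exp (- (\<delta> / 2) * ?n) * exp (- (\<delta> / 2) * ?w \<tau>)" for \<tau>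
      using order_trans[OF F(3) mult_left_mono[OF exp_join_le(1)[OF F(2)] F(1)]] by (simp add: mult.assoc)
    have fsb: "(\<lambda>\<tau>. F * exp (- (\<delta> / 2) * ?n) * exp (- (\<delta> / 2) * ?w \<tau>)) summable_on UNIV"
      using F by (intro summable_on_cmult_right summable_on_weight_int) auto
    have fs: "(\<lambda>\<tau>. cmod (f (join \<tau> \<xi>))) summable_on UNIV"
      by (rule summable_on_comparison_test[OF fsb fb]) simp
    have fsum: "(\<Sum>\<^sub>\<infinity>\<tau>. cmod (f (join \<tau> \<xi>))) \<le> F * Z * exp (- (\<delta> / 2) * ?n)"
    proof -
      have "(\<Sum>\<^sub>\<infinity>\<tau>. cmod (f (join \<tau> \<xi>))) \<le> (\<Sum>\<^sub>\<infinity>\<tau>::int. F * exp (- (\<delta> / 2) * ?n) * exp (- (\<delta> / 2) * ?w \<tau>))"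
        by (rule infsum_mono[OF fs fsb fb])
      also have "\<dots> = F * exp (- (\<delta> / 2) * ?n) * Z" unfolding Z_def by (rule infsum_cmult_right')
      finally show ?thesis by (simp add: mult_ac)
    qed
    define g where "g t = (\<Sum>\<^sub>\<infinity>\<tau>. f (join \<tau> \<xi>) * cis (of_int \<tau> * t))" for t
    have g: "continuous_on UNIV g" "\<And>t. g (t + 2 * pi) = g t" "\<And>\<tau>. fc1 g \<tau> = f (join \<tau> \<xi>)"
      "\<And>t. cmod (g t) \<le> F * Z * exp (- (\<delta> / 2) * ?n)"
      using series_fc1[OF fs] order_trans[OF series_fc1(4)[OF fs] fsum] unfolding g_def by blast+
    have pos: "0 < C * exp (- (\<delta> / 4) * ?n)" using C by simp
    have "exp (- \<i> * (2 * of_real pi * Zx \<xi>)) \<noteq> 1"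
      using C(2)[OF xi, of "-1"] pos by (auto simp: mult_ac)
    then obtain u where u: "\<And>t. (u has_vector_derivative g t - \<i> * px \<xi> t * u t) (at t)" "\<And>t. u (t + 2 * pi) = u t"
      using periodic_ode_solution[OF Px_derivative[of \<xi>] Px_shift[of \<xi>] g(1,2)] by blast
    have uc: "continuous_on UNIV u"
      using u(1) by (intro continuous_at_imp_continuous_on) (auto intro: has_vector_derivative_continuous)
    have ub: "cmod (u t) \<le> S * exp (- (\<delta> / 4) * ?n)" for t
    proof -
      \<comment> \<open>The side of integration follows the sign of Im px, forward if it is
        nonnegative and backward if nonpositive; then |exp(i (Px s - Px t))| \<le> 1
        throughout.\<close>
      have "\<exists>\<sigma>\<in>{1, -1}. cmod (exp (\<sigma> * (2 * of_real pi * \<i> * Zx \<xi>)) - 1) * cmod (u t) \<le> 2 * pi * (F * Z * exp (- (\<delta> / 2) * ?n))"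
        using sign[of \<xi>]
      proof
        assume pos: "\<forall>t. 0 \<le> Im (px \<xi> t)"
        have "cmod (exp (\<i> * (Px \<xi> (t + 2 * pi) - Px \<xi> t)) - 1) * cmod (u t) \<le> 2 * pi * (F * Z * exp (- (\<delta> / 2) * ?n))"
        proof (rule periodic_ode_bound[OF Px_derivative u])
          fix s assume s: "min t (t + 2 * pi) \<le> s" "s \<le> max t (t + 2 * pi)"
          have "t \<le> s" using s pi_gt_zero by (simp add: min_def split: if_splits)
          then have "cmod (exp (\<i> * (Px \<xi> s - Px \<xi> t))) \<le> 1"
            using Im_Px_mono[of \<xi> t s] pos by simp
          from mult_mono[OF this g(4)[of s]]
          show "cmod (exp (\<i> * (Px \<xi> s - Px \<xi> t)) * g s) \<le> F * Z * exp (- (\<delta> / 2) * ?n)"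
            by (simp add: norm_mult)
        qed simp
        moreover have e: "\<i> * (Px \<xi> (t + 2 * pi) - Px \<xi> t) = 1 * (2 * of_real pi * \<i> * Zx \<xi>)"
          by (simp add: Px_shift)
        ultimately show ?thesis unfolding e by blast
      next
        assume neg: "\<forall>t. Im (px \<xi> t) \<le> 0"
        have "cmod (exp (\<i> * (Px \<xi> (t + - 2 * pi) - Px \<xi> t)) - 1) * cmod (u t) \<le> 2 * pi * (F * Z * exp (- (\<delta> / 2) * ?n))"
        proof (rule periodic_ode_bound[OF Px_derivative u])
          fix s assume s: "min t (t + - 2 * pi) \<le> s" "s \<le> max t (t + - 2 * pi)"
          have "s \<le> t" using s pi_gt_zero by (simp add: max_def split: if_splits)
          then have "cmod (exp (\<i> * (Px \<xi> s - Px \<xi> t))) \<le> 1"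
            using Im_Px_antimono[of \<xi> s t] neg by simp
          from mult_mono[OF this g(4)[of s]]
          show "cmod (exp (\<i> * (Px \<xi> s - Px \<xi> t)) * g s) \<le> F * Z * exp (- (\<delta> / 2) * ?n)"
            by (simp add: norm_mult)
        qed simp
        moreover have e: "\<i> * (Px \<xi> (t + - 2 * pi) - Px \<xi> t) = - 1 * (2 * of_real pi * \<i> * Zx \<xi>)"
          using Px_shift_minus[of \<xi> t] by simp
        ultimately show ?thesis unfolding e by blast
      qed
      then obtain \<sigma> where sg: "\<sigma> \<in> {1, -1}" "cmod (exp (\<sigma> * (2 * of_real pi * \<i> * Zx \<xi>)) - 1) * cmod (u t) \<le> 2 * pi * (F * Z * exp (- (\<delta> / 2) * ?n))"
        by blast
      have "C * exp (- (\<delta> / 4) * ?n) * cmod (u t) \<le> 2 * pi * (F * Z * exp (- (\<delta> / 2) * ?n))"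
        by (rule order_trans[OF mult_right_mono[OF C(2)[OF xi sg(1)] norm_ge_zero] sg(2)])
      also have "\<dots> = C * exp (- (\<delta> / 4) * ?n) * (S * exp (- (\<delta> / 4) * ?n))"
      proof -
        have "exp (- (\<delta> / 2) * ?n) = exp (- (\<delta> / 4) * ?n) * exp (- (\<delta> / 4) * ?n)" by (simp flip: exp_add)
        then show ?thesis using C(1) by (simp add: S_def)
      qed
      finally show ?thesis using pos by (rule mult_left_le_imp_le)
    qed
    have L: "Lxi \<xi> (fc1 u) \<tau> = f (join \<tau> \<xi>)" for \<tau>
      using Lxi_fc1[OF uc g(1) u(2) ub u(1)] g(3) by simp
    have "cmod (fc1 u \<tau>) \<le> K * exp (- \<delta>' * \<omega> (nrm (join \<tau> \<xi>)))" for \<tau>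
    proof -
      let ?F = "F * exp (- (\<delta> / 2) * ?n)" and ?S = "S * exp (- (\<delta> / 4) * ?n)"
      have "cmod (fc1 u \<tau>) \<le> 2 * (?F + ?S * exp (\<delta>' * \<omega> (1 + M * nrm \<xi>))) * exp (- \<delta>' * ?w \<tau>)"
      proof (rule M(3))
        show "0 < \<delta>'" "\<delta>' \<le> \<delta>1" "0 \<le> ?F" using d' F by auto
        show "cmod 0 \<le> nrm \<xi>" using nrm_pos[of \<xi>] by simp
        show "cmod (fc1 u \<tau>) \<le> ?S" for \<tau> by (rule fc1_norm_le[OF uc ub])
        have "?F * exp (- (\<delta> / 2) * ?w \<tau>) \<le> ?F * exp (- \<delta>' * ?w \<tau>)" for \<tau>
        proof -
          have "\<delta>' * ?w \<tau> \<le> \<delta> / 2 * ?w \<tau>" using d'8 F(2) by (intro mult_right_mono om_nonneg) auto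
          then show ?thesis using F(1) by (intro mult_left_mono) auto
        qed
        then show "cmod (Lxi \<xi> (fc1 u) \<tau> - \<i> * 0 * fc1 u \<tau>) \<le> ?F * exp (- \<delta>' * ?w \<tau>)" for \<tau>
          using order_trans[OF fb] by (simp add: L)
      qed
      also have "\<dots> \<le> K * exp (- \<delta>' * ?n) * exp (- \<delta>' * ?w \<tau>)"
      proof (rule mult_right_mono)
        have "1 + M * nrm \<xi> \<le> (M + 1) * nrm \<xi>" using nrm_ge_one[of \<xi>] by (simp add: algebra_simps)
        then have "\<omega> (1 + M * nrm \<xi>) \<le> \<omega> ((M + 1) * nrm \<xi>)" using M nrm_pos[of \<xi>] by (intro om_mono) auto
        also have "\<dots> \<le> (M + 1 + 1) * ?n" using M nrm_pos[of \<xi>] by (intro om_mult) auto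
        finally have "\<delta>' * \<omega> (1 + M * nrm \<xi>) \<le> \<delta>' * ((M + 2) * ?n)"
          using d' by (intro mult_left_mono) (auto simp: algebra_simps)
        also have "\<dots> \<le> \<delta> / 8 * ?n" using mult_right_mono[OF d'M n0] by (simp add: mult.assoc)
        finally have "- (\<delta> / 4) * ?n + \<delta>' * \<omega> (1 + M * nrm \<xi>) \<le> - (\<delta> / 8) * ?n" by simp
        also have "\<dots> \<le> - \<delta>' * ?n" using mult_right_mono[OF d'8 n0] by simp
        finally have "exp (- (\<delta> / 4) * ?n + \<delta>' * \<omega> (1 + M * nrm \<xi>)) \<le> exp (- \<delta>' * ?n)" by simp
        from mult_left_mono[OF this S]
        have 1: "?S * exp (\<delta>' * \<omega> (1 + M * nrm \<xi>)) \<le> S * exp (- \<delta>' * ?n)" by (simp only: exp_add mult.assoc)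
        have "\<delta>' \<le> \<delta> / 2" using d'8 F by linarith
        from mult_right_mono[OF this n0] have 2: "?F \<le> F * exp (- \<delta>' * ?n)"
          using F(1) by (intro mult_left_mono) auto
        show "2 * (?F + ?S * exp (\<delta>' * \<omega> (1 + M * nrm \<xi>))) \<le> K * exp (- \<delta>' * ?n)"
          using 1 2 unfolding K_def by (simp add: algebra_simps)
      qed simp
      also have "\<dots> \<le> K * exp (- \<delta>' * \<omega> (nrm (join \<tau> \<xi>)))"
        using mult_left_mono[OF exp_join_le(2)[OF d'(1), of \<xi> \<tau>], of K] F S by (simp add: K_def mult.assoc)
      finally show ?thesis .
    qed
    then show "\<exists>w. (\<forall>\<tau>. Lxi \<xi> w \<tau> = f (join \<tau> \<xi>)) \<and> (\<forall>\<tau>. cmod (w \<tau>) \<le> K * exp (- \<delta>' * \<omega> (nrm (join \<tau> \<xi>))))"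
      using L by blast
  qed
qed

text \<open>The index 0 is a genuine obstruction, as \<open>Lseq\<close> always vanishes there.
  Solvability and hypoellipticity are both derived from this one property.\<close>

definition onto :: bool where
  "onto \<longleftrightarrow> (\<forall>f. decays f \<longrightarrow> f (\<lambda>_. 0) = 0 \<longrightarrow> (\<exists>w. decays w \<and> Lseq w = f))"

lemma onto_if_conditions:
  assumes sign: "\<And>\<xi>. (\<forall>t. Im (px \<xi> t) \<ge> 0) \<or> (\<forall>t. Im (px \<xi> t) \<le> 0)"
    and EDC: "EDC1 \<omega> (\<lambda>j. mean_T1 (a j)) (\<lambda>j. mean_T1 (b j))"
  shows onto
  unfolding onto_def
proof (intro allI impI)
  fix f :: "('n option \<Rightarrow> int) \<Rightarrow> complex"
  assume f: "decays f" and f0: "f (\<lambda>_. 0) = 0"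
  obtain K \<delta> W where K: "0 \<le> K" "0 < \<delta>"
    "\<And>\<xi>. (\<exists>j. \<xi> j \<noteq> 0) \<Longrightarrow> (\<forall>\<tau>. Lxi \<xi> (W \<xi>) \<tau> = f (join \<tau> \<xi>)) \<and> (\<forall>\<tau>. cmod (W \<xi> \<tau>) \<le> K * exp (- \<delta> * \<omega> (nrm (join \<tau> \<xi>))))"
    using slice_solution[OF sign EDC f] by metis
  \<comment> \<open>On the slice \<xi> = 0 the operator is multiplication by i \<tau>. At \<tau> = 0
    the division by zero yields the value 0, and the equation holds there because f vanishes at
    index 0.\<close>
  define w where "w k = (if \<exists>j. k (Some j) \<noteq> 0 then W (\<lambda>j. k (Some j)) (k None) else f k / (\<i> * of_int (k None)))" for k
  have wj: "w (join \<tau> \<xi>) = (if \<exists>j. \<xi> j \<noteq> 0 then W \<xi> \<tau> else f (join \<tau> \<xi>) / (\<i> * of_int \<tau>))" for \<tau> \<xi>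
    by (simp add: w_def)
  have "decays w"
  proof -
    obtain F \<eta> where F: "0 \<le> F" "0 < \<eta>" "\<And>k. cmod (f k) \<le> F * exp (- \<eta> * \<omega> (nrm k))"
      using f by (auto simp: decays_def)
    have "cmod (w (join \<tau> \<xi>)) \<le> (K + F) * exp (- min \<delta> \<eta> * \<omega> (nrm (join \<tau> \<xi>)))" for \<tau> \<xi>
    proof -
      let ?n = "\<omega> (nrm (join \<tau> \<xi>))"
      have n: "0 \<le> ?n" by (rule om_nrm_nonneg)
      have k: "K * exp (- \<delta> * ?n) \<le> (K + F) * exp (- min \<delta> \<eta> * ?n)"
        using K(1) F(1) n by (intro mult_mono) (auto intro!: mult_right_mono)
      have l: "F * exp (- \<eta> * ?n) \<le> (K + F) * exp (- min \<delta> \<eta> * ?n)"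
        using K(1) F(1) n by (intro mult_mono) (auto intro!: mult_right_mono)
      show ?thesis
      proof (cases "\<exists>j. \<xi> j \<noteq> 0")
        case True
        then show ?thesis using K(3)[OF True] order_trans[OF _ k] by (simp add: wj)
      next
        case False
        have "cmod (f (join \<tau> \<xi>) / (\<i> * of_int \<tau>)) \<le> cmod (f (join \<tau> \<xi>))"
        proof (cases "\<tau> = 0")
          case False
          then show ?thesis using one_le_abs_of_int[of \<tau>] by (simp add: norm_divide norm_mult divide_le_eq mult_le_cancel_left1)
        qed simp
        then show ?thesis using F(3)[of "join \<tau> \<xi>"] l False by (simp add: wj)
      qed
    qed
    then have "cmod (w k) \<le> (K + F) * exp (- min \<delta> \<eta> * \<omega> (nrm k))" for k by (metis join_split)
    then show ?thesis unfolding decays_def using K F by (intro exI[of _ "K + F"] exI[of _ "min \<delta> \<eta>"]) auto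
  qed
  moreover have "Lseq w (join \<tau> \<xi>) = f (join \<tau> \<xi>)" for \<tau> \<xi>
  proof (cases "\<exists>j. \<xi> j \<noteq> 0")
    case True
    then show ?thesis using K(3)[OF True] by (simp add: Lseq_join wj)
  next
    case False
    then have "\<xi> = (\<lambda>_. 0)" by auto
    moreover have "join 0 (\<lambda>_::'n. 0) = (\<lambda>_. 0)" by (auto simp: join_def fun_eq_iff split: option.split)
    ultimately show ?thesis using False f0 by (simp add: Lseq_join Lxi_def wj)
  qed
  then have "Lseq w k = f k" for k by (metis join_split)
  ultimately show "\<exists>w. decays w \<and> Lseq w = f" by blast
qed

section \<open>From surjectivity to hypoellipticity and solvability\<close>

lemma Lseq_zero: "Lseq u (\<lambda>_. 0) = 0"
  by (simp add: Lseq_def)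

lemma onto_Lop:
  assumes onto "f \<in> E_roumieu \<omega>" "fc f (\<lambda>_. 0) = 0"
  obtains \<psi> where "\<psi> \<in> E_roumieu \<omega>" "Lop a b \<psi> = f"
proof -
  note d = E_roumieu_imp_decays[OF assms(2)]
  obtain w where w: "decays w" "Lseq w = fc f" using assms(1,3) d(1) unfolding onto_def by blast
  have "Lop a b (Ffun w) = f" using Lop_Ffun[OF w(1)] w(2) d(2) by simp
  then show ?thesis using that Ffun_in_E_roumieu[OF w(1)] by blast
qed

lemma Lop_const: "Lop a b (\<lambda>x. c) = (\<lambda>x. 0)"
  by (simp add: Lop_def pd_def fun_eq_iff)

lemma one_in_E_roumieu: "(\<lambda>x::real^('n option). 1) \<in> E_roumieu \<omega>" "fc (\<lambda>x::real^('n option). 1) = delta (\<lambda>_. 0)"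
  using ee_in_E_roumieu[of "\<lambda>_::'n option. 0"] fc_ee[of "\<lambda>_::'n option. 0"] by (simp_all add: ee_zero [abs_def])

text \<open>Range plus constants is everything, so a functional is determined by its values on the
  range and on the constant 1.\<close>

lemma mean_zero_split:
  assumes onto "\<phi> \<in> E_roumieu \<omega>"
  obtains \<psi> where "\<psi> \<in> E_roumieu \<omega>" "\<phi> = (\<lambda>x. Lop a b \<psi> x + fc \<phi> (\<lambda>_. 0) * 1)"
proof -
  let ?c = "fc \<phi> (\<lambda>_. 0)"
  have "(\<lambda>x. \<phi> x + (- ?c) * 1) \<in> E_roumieu \<omega>" "fc (\<lambda>x. \<phi> x + (- ?c) * 1) (\<lambda>_. 0) = 0"
    using E_roumieu_add[OF assms(2) E_roumieu_cmult(1)[OF one_in_E_roumieu(1), of "- ?c"]]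
      E_roumieu_cmult(2)[OF one_in_E_roumieu(1), of "- ?c"] one_in_E_roumieu(2)
    by (simp_all add: delta_def)
  then obtain \<psi> where p: "\<psi> \<in> E_roumieu \<omega>" "Lop a b \<psi> = (\<lambda>x. \<phi> x + (- ?c) * 1)"
    by (rule onto_Lop[OF assms(1)])
  then have "\<phi> = (\<lambda>x. Lop a b \<psi> x + ?c * 1)" by (simp add: fun_eq_iff)
  then show ?thesis using that p(1) by blast
qed

text \<open>A smooth solution w of L w = g induces a functional that agrees with \<mu> on the range
  of L. By \<open>mean_zero_split\<close> the two differ by a multiple of the mean, which is itself
  given by a constant function.\<close>

lemma hypoelliptic_if_onto:
  assumes onto
  shows "globally_hypoelliptic \<omega> a b"
  unfolding globally_hypoelliptic_def
proof (intro ballI impI)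
  fix \<mu> :: "(real^('n option) \<Rightarrow> complex) \<Rightarrow> complex"
  assume mu: "\<mu> \<in> E_dual \<omega>"
    and "\<exists>g\<in>E_roumieu \<omega>. \<forall>\<phi>\<in>E_roumieu \<omega>. \<mu> (\<lambda>v. - Lop a b \<phi> v) = torus_integral (\<lambda>v. g v * \<phi> v)"
  then obtain g where g: "g \<in> E_roumieu \<omega>" "\<And>\<phi>. \<phi> \<in> E_roumieu \<omega> \<Longrightarrow> \<mu> (\<lambda>v. - Lop a b \<phi> v) = torus_integral (\<lambda>v. g v * \<phi> v)"
    by blast
  let ?V = "complex_of_real ((2 * pi) ^ CARD('n option))"
  have V: "?V \<noteq> 0" by simp
  let ?o = "\<lambda>x::real^('n option). 1 :: complex" and ?d = "delta (\<lambda>_::'n option. 0)"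
  note dg = E_roumieu_imp_decays[OF g(1)]
  have zero: "\<mu> (\<lambda>x. 0) = 0"
    using E_dual_linear[OF mu one_in_E_roumieu(1) one_in_E_roumieu(1), of "-1"] by simp
  have "fc g (\<lambda>_. 0) = 0"
    using g(2)[OF one_in_E_roumieu(1)] zero by (simp add: Lop_const fc_def)
  then obtain w where w: "decays w" "Lseq w = fc g" using assms dg(1) unfolding onto_def by blast
  \<comment> \<open>The discrepancy on constants; entered as a correction of the coefficient at
    index 0 it makes the two functionals agree there as well.\<close>
  define \<kappa> where "\<kappa> = \<mu> ?o - ?V * mu_of w ?o"
  define m where "m k = w k + \<kappa> / ?V * ?d k" for k
  have dm: "decays m" unfolding m_def by (intro decays_add w decays_cmult decays_delta)
  note gw = decays_imp_grows[OF w(1)] and gd = decays_imp_grows[OF decays_delta]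
  have "\<mu> \<phi> = torus_integral (\<lambda>v. Ffun m v * \<phi> v)" if phi: "\<phi> \<in> E_roumieu \<omega>" for \<phi>
  proof -
    obtain \<psi> where psi: "\<psi> \<in> E_roumieu \<omega>" "\<phi> = (\<lambda>x. Lop a b \<psi> x + fc \<phi> (\<lambda>_. 0) * 1)"
      by (rule mean_zero_split[OF assms phi])
    note lp = Lop_E_roumieu(1)[OF psi(1)]
    let ?c = "fc \<phi> (\<lambda>_. 0)"
    have lin: "\<nu> \<phi> = \<nu> (Lop a b \<psi>) + ?c * \<nu> ?o" if "\<nu> \<in> E_dual \<omega>" for \<nu>
      using E_dual_linear[OF that lp one_in_E_roumieu(1), of ?c] psi(2) by simp
    have "\<mu> (\<lambda>v. c * Lop a b \<psi> v) = c * \<mu> (Lop a b \<psi>)" for c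
      using mu lp by (simp add: E_dual_def)
    from this[of "-1"] have "\<mu> (Lop a b \<psi>) = - torus_integral (\<lambda>v. g v * \<psi> v)"
      using g(2)[OF psi(1)] by simp
    also have "torus_integral (\<lambda>v. g v * \<psi> v) = ?V * mu_of (Lseq w) \<psi>"
      using torus_integral_pairing[OF dg(1) psi(1)] dg(2) w(2) by simp
    also have "- (?V * mu_of (Lseq w) \<psi>) = ?V * mu_of w (Lop a b \<psi>)"
      using mu_of_Lop[OF gw psi(1)] by simp
    finally have "\<mu> \<phi> = ?V * mu_of w (Lop a b \<psi>) + ?c * \<mu> ?o" using lin[OF mu] by simp
    also have "\<dots> = ?V * mu_of w \<phi> + ?c * \<kappa>"
      unfolding lin[OF mu_of_in_E_dual[OF gw]] \<kappa>_def by (simp add: algebra_simps)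
    also have "\<dots> = ?V * (mu_of w \<phi> + \<kappa> / ?V * mu_of ?d \<phi>)"
      using V mu_of_delta_zero[OF phi] by (simp add: distrib_left)
    also have "\<dots> = ?V * mu_of m \<phi>"
      unfolding m_def [abs_def] by (simp only: mu_of_add_cmult[OF gw gd phi])
    also have "\<dots> = torus_integral (\<lambda>v. Ffun m v * \<phi> v)" by (rule torus_integral_pairing[OF dm phi, symmetric])
    finally show ?thesis .
  qed
  then show "\<exists>h\<in>E_roumieu \<omega>. \<forall>\<phi>\<in>E_roumieu \<omega>. \<mu> \<phi> = torus_integral (\<lambda>v. h v * \<phi> v)"
    using Ffun_in_E_roumieu[OF dm] by blast
qed

text \<open>The range is the kernel of the mean, a continuous functional, hence closed; elements of
  the kernel of the transpose vanish on it and are therefore multiples of the mean.\<close>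

lemma solvable_if_onto:
  assumes onto
  shows "strongly_solvable \<omega> a b"
  unfolding strongly_solvable_def
proof
  let ?d = "delta (\<lambda>_::'n option. 0)"
  let ?E = "E_roumieu \<omega> :: (real^('n option) \<Rightarrow> complex) set"
  have im: "Lop a b ` ?E = {f \<in> ?E. fc f (\<lambda>_. 0) = 0}"
  proof (intro set_eqI iffI)
    fix f assume "f \<in> Lop a b ` ?E"
    then show "f \<in> {f \<in> ?E. fc f (\<lambda>_. 0) = 0}" using Lop_E_roumieu Lseq_zero by auto
  next
    fix f assume "f \<in> {f \<in> ?E. fc f (\<lambda>_. 0) = 0}"
    then show "f \<in> Lop a b ` ?E" using onto_Lop[OF assms] by blast
  qed
  show "lb_closed \<omega> (Lop a b ` ?E)"
    unfolding im lb_closed_def lb_open_def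
  proof (intro conjI ballI)
    fix f assume f: "f \<in> ?E - {f \<in> ?E. fc f (\<lambda>_. 0) = 0}"
    let ?c = "cmod (fc f (\<lambda>_. 0))"
    have c: "?c > 0" using f by auto
    \<comment> \<open>An absolutely convex neighbourhood on which the mean moves by at most half of
      |fc f 0|, so it cannot reach 0 from f.\<close>
    let ?U = "{g \<in> ?E. cmod (fc g (\<lambda>_. 0)) \<le> ?c / 2}"
    have "lb_zero_nbhd \<omega> ?U"
      unfolding lb_zero_nbhd_def
    proof (intro conjI ballI allI impI)
      fix g h :: "real^('n option) \<Rightarrow> complex" and \<alpha> \<beta> :: complex
      assume g: "g \<in> ?U" and h: "h \<in> ?U" and ab: "cmod \<alpha> + cmod \<beta> \<le> 1"
      have E: "(\<lambda>x. \<alpha> * g x + \<beta> * h x) \<in> ?E" "fc (\<lambda>x. \<alpha> * g x + \<beta> * h x) = (\<lambda>k. \<alpha> * fc g k + \<beta> * fc h k)"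
        using E_roumieu_add[OF E_roumieu_cmult(1)[of g \<alpha>] E_roumieu_cmult(1)[of h \<beta>]]
          E_roumieu_cmult(2)[of g \<alpha>] E_roumieu_cmult(2)[of h \<beta>] g h by auto
      have "cmod (\<alpha> * fc g (\<lambda>_. 0)) \<le> cmod \<alpha> * (?c / 2)"
        using g unfolding norm_mult by (intro mult_left_mono) auto
      moreover have "cmod (\<beta> * fc h (\<lambda>_. 0)) \<le> cmod \<beta> * (?c / 2)"
        using h unfolding norm_mult by (intro mult_left_mono) auto
      ultimately have "cmod (\<alpha> * fc g (\<lambda>_. 0) + \<beta> * fc h (\<lambda>_. 0)) \<le> cmod \<alpha> * (?c / 2) + cmod \<beta> * (?c / 2)"
        by (intro order_trans[OF norm_triangle_ineq] add_mono)
      also have "\<dots> = (cmod \<alpha> + cmod \<beta>) * (?c / 2)" by (simp add: algebra_simps)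
      also have "\<dots> \<le> 1 * (?c / 2)" using ab c by (intro mult_right_mono) auto
      finally show "(\<lambda>x. \<alpha> * g x + \<beta> * h x) \<in> ?U" using E by simp
    next
      fix k :: nat assume k: "1 \<le> k"
      then have lam: "0 < 1 / real k" by simp
      obtain K \<delta> where K: "K > 0" "\<delta> > 0" "\<And>f l. f \<in> (E_step \<omega> (1 / real k) :: (real^('n option) \<Rightarrow> complex) set) \<Longrightarrow>
        cmod (fc f l) \<le> rnorm \<omega> (1 / real k) f * K * exp (- \<delta> * \<omega> (nrm l))"
        using fc_decay[OF lam, where 'm="'n option"] by blast
      show "\<exists>r>0. \<forall>f\<in>E_step \<omega> (1 / real k). rnorm \<omega> (1 / real k) f < r \<longrightarrow> f \<in> ?U"
      proof (intro exI[of _ "?c / 2 / K"] conjI ballI impI)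
        show "0 < ?c / 2 / K" using c K by simp
        fix h :: "real^('n option) \<Rightarrow> complex" assume h: "h \<in> E_step \<omega> (1 / real k)" "rnorm \<omega> (1 / real k) h < ?c / 2 / K"
        let ?l = "\<lambda>_::'n option. 0 :: int"
        have R: "0 \<le> rnorm \<omega> (1 / real k) h" by (rule rnorm_nonneg[OF h(1)])
        have "exp (- \<delta> * \<omega> (nrm ?l)) \<le> 1" using K(2) om_nrm_nonneg[of ?l] by simp
        then have "rnorm \<omega> (1 / real k) h * K * exp (- \<delta> * \<omega> (nrm ?l)) \<le> rnorm \<omega> (1 / real k) h * K * 1"
          using R K(1) by (intro mult_left_mono) auto
        then have "cmod (fc h ?l) \<le> rnorm \<omega> (1 / real k) h * K" using K(3)[OF h(1), of ?l] by simp
        also have "\<dots> \<le> ?c / 2" using h(2) K(1) by (simp add: field_simps)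
        finally show "h \<in> ?U" using h(1) lam unfolding E_roumieu_def by blast
      qed
    qed auto
    moreover have "(\<lambda>g x. f x + g x) ` ?U \<subseteq> ?E - {f \<in> ?E. fc f (\<lambda>_. 0) = 0}"
    proof
      fix h assume "h \<in> (\<lambda>g x. f x + g x) ` ?U"
      then obtain g where g: "g \<in> ?U" "h = (\<lambda>x. f x + g x)" by auto
      have E: "h \<in> ?E" "fc h (\<lambda>_. 0) = fc f (\<lambda>_. 0) + fc g (\<lambda>_. 0)"
        using E_roumieu_add[of f g] f g by auto
      have "fc h (\<lambda>_. 0) \<noteq> 0"
      proof
        assume "fc h (\<lambda>_. 0) = 0"
        then have "fc f (\<lambda>_. 0) = - fc g (\<lambda>_. 0)" using E(2) by (simp add: eq_neg_iff_add_eq_0)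
        then have "?c = cmod (fc g (\<lambda>_. 0))" by simp
        then show False using g(1) c by auto
      qed
      then show "h \<in> ?E - {f \<in> ?E. fc f (\<lambda>_. 0) = 0}" using E(1) by auto
    qed
    ultimately show "\<exists>U. lb_zero_nbhd \<omega> U \<and> (\<lambda>g x. f x + g x) ` U \<subseteq> ?E - {f \<in> ?E. fc f (\<lambda>_. 0) = 0}" by blast
  qed auto
  show "fin_dim_span (ker_transpose \<omega> a b)"
    unfolding fin_dim_span_def
  proof (intro exI[of _ "{mu_of ?d}"] conjI ballI)
    have "mu_of ?d (Lop a b \<phi>) = 0" if "\<phi> \<in> ?E" for \<phi>
      using mu_of_delta_zero[OF Lop_E_roumieu(1)[OF that]] Lop_E_roumieu(2)[OF that] Lseq_zero by simp
    then show "{mu_of ?d} \<subseteq> ker_transpose \<omega> a b"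
      using mu_of_in_E_dual[OF decays_imp_grows[OF decays_delta]] by (auto simp: ker_transpose_def)
    fix \<mu> :: "(real^('n option) \<Rightarrow> complex) \<Rightarrow> complex"
    assume "\<mu> \<in> ker_transpose \<omega> a b"
    then have mu: "\<mu> \<in> E_dual \<omega>" "\<And>\<phi>. \<phi> \<in> ?E \<Longrightarrow> \<mu> (Lop a b \<phi>) = 0" by (auto simp: ker_transpose_def)
    have mu_eq: "\<mu> f = \<mu> (\<lambda>x. 1) * mu_of ?d f" for f
    proof (cases "f \<in> ?E")
      case True
      then obtain \<psi> where psi: "\<psi> \<in> ?E" "f = (\<lambda>x. Lop a b \<psi> x + fc f (\<lambda>_. 0) * 1)"
        by (rule mean_zero_split[OF assms])
      then have "\<mu> f = fc f (\<lambda>_. 0) * \<mu> (\<lambda>x. 1)"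
        using E_dual_linear[OF mu(1) Lop_E_roumieu(1)[OF psi(1)] one_in_E_roumieu(1), of "fc f (\<lambda>_. 0)"] mu(2)[OF psi(1)] by simp
      then show ?thesis using mu_of_delta_zero[OF True] by simp
    next
      case False
      then show ?thesis using mu(1) by (simp add: E_dual_def mu_of_def)
    qed
    show "\<exists>c. \<mu> = (\<lambda>f. \<Sum>\<nu>\<in>{mu_of ?d}. c \<nu> * \<nu> f)"
    proof (intro exI[of _ "\<lambda>_. \<mu> (\<lambda>x. 1)"] ext)
      fix f
      have "(\<Sum>\<nu>\<in>{mu_of ?d}. \<mu> (\<lambda>x. 1) * \<nu> f) = \<mu> (\<lambda>x. 1) * mu_of ?d f" by simp
      then show "\<mu> f = (\<Sum>\<nu>\<in>{mu_of ?d}. \<mu> (\<lambda>x. 1) * \<nu> f)" by (rule trans[OF mu_eq sym])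
    qed
  qed simp
qed

end

section \<open>Quasi-solutions obstruct hypoellipticity and solvability\<close>

lemma no_finite_span_of_diagonal:
  fixes \<beta> :: "'i \<Rightarrow> 'x \<Rightarrow> complex"
  assumes "finite I" "infinite X"
    and "\<And>x. x \<in> X \<Longrightarrow> \<exists>c d. d \<noteq> 0 \<and> (\<forall>y\<in>X. (if y = x then d else 0) = (\<Sum>i\<in>I. c i * \<beta> i y))"
  shows False
  using assms
proof (induction I arbitrary: X rule: finite_induct)
  case empty
  then obtain x where "x \<in> X" by (metis finite.emptyI ex_in_conv)
  then show ?case using empty(2)[of x] by auto
next
  case (insert i0 I)
  show ?case
  proof (cases "\<exists>x0\<in>X. \<exists>c d. d \<noteq> 0 \<and> c i0 \<noteq> 0 \<and> (\<forall>y\<in>X. (if y = x0 then d else 0) = (\<Sum>i\<in>insert i0 I. c i * \<beta> i y))")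
    case True
    then obtain x0 c d where x0: "x0 \<in> X" "c i0 \<noteq> 0"
      "\<And>y. y \<in> X \<Longrightarrow> (if y = x0 then d else 0) = (\<Sum>i\<in>insert i0 I. c i * \<beta> i y)"
      by blast
    have elim: "\<beta> i0 y = (\<Sum>i\<in>I. (- c i / c i0) * \<beta> i y)" if "y \<in> X - {x0}" for y
    proof -
      have "0 = c i0 * \<beta> i0 y + (\<Sum>i\<in>I. c i * \<beta> i y)" using x0(3)[of y] that insert.hyps by auto
      then have "\<beta> i0 y = - (\<Sum>i\<in>I. c i * \<beta> i y) / c i0"
        using x0(2) by (simp add: field_simps eq_neg_iff_add_eq_0)
      also have "\<dots> = (\<Sum>i\<in>I. (- c i / c i0) * \<beta> i y)"
        by (simp add: sum_divide_distrib sum_negf)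
      finally show ?thesis .
    qed
    show ?thesis
    proof (rule insert.IH[of "X - {x0}"])
      show "infinite (X - {x0})" using insert.prems(1) by simp
      fix x assume x: "x \<in> X - {x0}"
      then obtain c' d' where c': "d' \<noteq> 0" "\<And>y. y \<in> X \<Longrightarrow> (if y = x then d' else 0) = (\<Sum>i\<in>insert i0 I. c' i * \<beta> i y)"
        using insert.prems(2)[of x] by blast
      have "(if y = x then d' else 0) = (\<Sum>i\<in>I. (c' i - c' i0 * c i / c i0) * \<beta> i y)" if y: "y \<in> X - {x0}" for y
      proof -
        have "(if y = x then d' else 0) = c' i0 * \<beta> i0 y + (\<Sum>i\<in>I. c' i * \<beta> i y)"
          using c'(2)[of y] y insert.hyps by simp
        also have "c' i0 * \<beta> i0 y = (\<Sum>i\<in>I. - (c' i0 * c i / c i0) * \<beta> i y)"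
          unfolding elim[OF y] sum_distrib_left by (intro sum.cong) auto
        finally show ?thesis by (simp add: left_diff_distrib sum_subtractf sum_negf)
      qed
      then show "\<exists>c d. d \<noteq> 0 \<and> (\<forall>y\<in>X - {x0}. (if y = x then d else 0) = (\<Sum>i\<in>I. c i * \<beta> i y))"
        using c'(1) by (intro exI[of _ "\<lambda>i. c' i - c' i0 * c i / c i0"] exI[of _ d']) blast
    qed
  next
    case False
    show ?thesis
    proof (rule insert.IH[of X])
      fix x assume x: "x \<in> X"
      then obtain c d where c: "d \<noteq> 0" "\<forall>y\<in>X. (if y = x then d else 0) = (\<Sum>i\<in>insert i0 I. c i * \<beta> i y)"
        using insert.prems(2)[of x] by blast
      then have "c i0 = 0" using False x by blast
      then show "\<exists>c d. d \<noteq> 0 \<and> (\<forall>y\<in>X. (if y = x then d else 0) = (\<Sum>i\<in>I. c i * \<beta> i y))"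
        using c insert.hyps by (intro exI[of _ c] exI[of _ d]) simp
    qed (rule insert.prems)
  qed
qed

section \<open>Gluing slices into one sequence\<close>

lemma finite_nrm_le: "finite {\<xi> :: 'n::finite \<Rightarrow> int. nrm \<xi> \<le> R}"
proof (rule finite_subset)
  show "{\<xi> :: 'n \<Rightarrow> int. nrm \<xi> \<le> R} \<subseteq> PiE UNIV (\<lambda>_. {- \<lceil>R\<rceil>..\<lceil>R\<rceil>})"
  proof
    fix \<xi> :: "'n \<Rightarrow> int" assume "\<xi> \<in> {\<xi>. nrm \<xi> \<le> R}"
    then have "\<bar>real_of_int (\<xi> j)\<bar> \<le> R" for j using nrm_ge[of \<xi> j] by simp
    then have "\<bar>real_of_int (\<xi> j)\<bar> \<le> of_int \<lceil>R\<rceil>" for j using le_of_int_ceiling[of R] order_trans by blast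
    then have "\<bar>\<xi> j\<bar> \<le> \<lceil>R\<rceil>" for j by (metis of_int_abs of_int_le_iff)
    then have "\<xi> j \<le> \<lceil>R\<rceil> \<and> - \<lceil>R\<rceil> \<le> \<xi> j" for j by (metis abs_le_iff minus_le_iff)
    then show "\<xi> \<in> PiE UNIV (\<lambda>_. {- \<lceil>R\<rceil>..\<lceil>R\<rceil>})" by auto
  qed
qed (intro finite_PiE; simp)

text \<open>Glues a family of slices into a sequence on the full lattice, zero for \<xi> outside
  \<open>S\<close>. A singleton isolates one slice, a finite set gives a truncation.\<close>

definition restr :: "('n \<Rightarrow> int) set \<Rightarrow> (('n \<Rightarrow> int) \<Rightarrow> int \<Rightarrow> complex) \<Rightarrow> ('n option \<Rightarrow> int) \<Rightarrow> complex" where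
  "restr S w k = (if (\<lambda>j. k (Some j)) \<in> S then w (\<lambda>j. k (Some j)) (k None) else 0)"

lemma restr_join: "restr S w (join \<tau> \<xi>) = (if \<xi> \<in> S then w \<xi> \<tau> else 0)"
  by (simp add: restr_def)

context weight
begin

lemma om_unbounded: "\<exists>R\<ge>1. \<omega> R \<ge> B"
proof -
  obtain C where C: "C \<ge> 0" "\<And>t. t \<ge> 1 \<Longrightarrow> 1 * ln t \<le> \<omega> t + C" using ln_le_om[of 1] by auto
  have "B \<le> \<omega> (exp (\<bar>B\<bar> + C))" using C(2)[of "exp (\<bar>B\<bar> + C)"] C(1) by simp
  then show ?thesis using C(1) by (intro exI[of _ "exp (\<bar>B\<bar> + C)"]) simp
qed

end

context vector_field
begin

text \<open>The last clause of \<open>quasi_solutions\<close> keeps \<open>w \<xi>\<close> from decaying in \<open>\<xi>\<close>; it is guarded because the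
  infinite sum of a non-summable family is 0.\<close>

definition quasi_solutions :: "('n \<Rightarrow> int) set \<Rightarrow> (('n \<Rightarrow> int) \<Rightarrow> int \<Rightarrow> complex) \<Rightarrow> bool" where
  "quasi_solutions \<Xi> w \<longleftrightarrow> infinite \<Xi> \<and>
     (\<forall>\<epsilon>>0. \<exists>C\<ge>0. \<forall>\<xi>\<in>\<Xi>. \<forall>\<tau>. cmod (w \<xi> \<tau>) \<le> C * exp (\<epsilon> * \<omega> (nrm \<xi>))) \<and>
     (\<exists>C \<delta>. 0 \<le> C \<and> 0 < \<delta> \<and> (\<forall>\<xi>\<in>\<Xi>. \<forall>\<tau>. cmod (Lxi \<xi> (w \<xi>) \<tau>) \<le> C * exp (- \<delta> * \<omega> (nrm (join \<tau> \<xi>))))) \<and>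
     (\<exists>c>0. \<forall>\<xi>\<in>\<Xi>. (\<lambda>\<tau>. cmod (w \<xi> \<tau>)) summable_on UNIV \<longrightarrow> c \<le> nrm \<xi> * (\<Sum>\<^sub>\<infinity>\<tau>. cmod (w \<xi> \<tau>)))"

lemma quasi_solutions_growth:
  "quasi_solutions \<Xi> w \<Longrightarrow> 0 < \<epsilon> \<Longrightarrow> \<exists>C\<ge>0. \<forall>\<xi>\<in>\<Xi>. \<forall>\<tau>. cmod (w \<xi> \<tau>) \<le> C * exp (\<epsilon> * \<omega> (nrm \<xi>))"
  unfolding quasi_solutions_def by (elim conjE) (drule spec, erule (1) mp)

lemma quasi_solutions_decay:
  "quasi_solutions \<Xi> w \<Longrightarrow> \<exists>C \<delta>. 0 \<le> C \<and> 0 < \<delta> \<and> (\<forall>\<xi>\<in>\<Xi>. \<forall>\<tau>. cmod (Lxi \<xi> (w \<xi>) \<tau>) \<le> C * exp (- \<delta> * \<omega> (nrm (join \<tau> \<xi>))))"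
  unfolding quasi_solutions_def by (elim conjE)

lemma Lxi_zero: "Lxi \<xi> (\<lambda>_. 0) \<tau> = 0"
  by (simp add: Lxi_def)

lemma Lxi_diff:
  assumes "\<And>\<tau>. cmod (u \<tau>) \<le> A" "\<And>\<tau>. cmod (w \<tau>) \<le> B"
  shows "Lxi \<xi> (\<lambda>\<tau>. u \<tau> - w \<tau>) \<tau> = Lxi \<xi> u \<tau> - Lxi \<xi> w \<tau>"
proof -
  have s: "(\<lambda>\<sigma>. p j \<sigma> * v (\<tau> - \<sigma>)) summable_on UNIV" if "\<And>\<tau>. cmod (v \<tau>) \<le> D" for v D j
  proof (rule abs_summable_summable, rule summable_on_comparison_test[OF summable_on_cmult_right[OF p_summable[of j], of D]])
    show "cmod (p j \<sigma> * v (\<tau> - \<sigma>)) \<le> D * cmod (p j \<sigma>)" for \<sigma>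
      using mult_left_mono[OF that[of "\<tau> - \<sigma>"], of "cmod (p j \<sigma>)"] by (simp add: norm_mult mult.commute)
  qed simp
  have "(\<Sum>\<^sub>\<infinity>\<sigma>. p j \<sigma> * (u (\<tau> - \<sigma>) - w (\<tau> - \<sigma>))) = (\<Sum>\<^sub>\<infinity>\<sigma>. p j \<sigma> * u (\<tau> - \<sigma>)) - (\<Sum>\<^sub>\<infinity>\<sigma>. p j \<sigma> * w (\<tau> - \<sigma>))" for j
    unfolding right_diff_distrib by (rule infsum_diff[OF s[OF assms(1)] s[OF assms(2)]])
  then show ?thesis by (simp add: Lxi_def right_diff_distrib sum_subtractf)
qed

lemma Lseq_restr: "Lseq (restr S w) (join \<tau> \<xi>) = (if \<xi> \<in> S then Lxi \<xi> (w \<xi>) \<tau> else 0)"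
  by (simp add: Lseq_join restr_join Lxi_zero)

text \<open>On a slice where w equals v the coefficient sum is O(nrm^-2), by \<open>ln_le_om\<close>
  with constant 4 / \<delta>, while the last clause of \<open>quasi_solutions\<close> keeps it above
  c / nrm. Both can hold for finitely many \<xi> only.\<close>

lemma infinite_nondecay:
  assumes q: "quasi_solutions \<Xi> w" and v: "decays v"
  shows "infinite {\<xi>\<in>\<Xi>. \<exists>\<tau>. w \<xi> \<tau> \<noteq> v (join \<tau> \<xi>)}"
proof
  assume fin: "finite {\<xi>\<in>\<Xi>. \<exists>\<tau>. w \<xi> \<tau> \<noteq> v (join \<tau> \<xi>)}"
  obtain C \<delta> where C: "0 \<le> C" "0 < \<delta>" "\<And>k. cmod (v k) \<le> C * exp (- \<delta> * \<omega> (nrm k))"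
    using v by (auto simp: decays_def)
  obtain c where c: "c > 0" "\<And>\<xi>. \<xi> \<in> \<Xi> \<Longrightarrow> (\<lambda>\<tau>. cmod (w \<xi> \<tau>)) summable_on UNIV \<Longrightarrow> c \<le> nrm \<xi> * (\<Sum>\<^sub>\<infinity>\<tau>. cmod (w \<xi> \<tau>))"
    using q unfolding quasi_solutions_def by blast
  obtain D where D: "D \<ge> 0" "\<And>t. t \<ge> 1 \<Longrightarrow> (4 / \<delta>) * ln t \<le> \<omega> t + D" using ln_le_om[of "4 / \<delta>"] C(2) by auto
  define Z where "Z = (\<Sum>\<^sub>\<infinity>\<tau>::int. exp (- (\<delta> / 2) * \<omega> (1 + \<bar>of_int \<tau>\<bar>)))"
  have Z: "0 \<le> Z" unfolding Z_def by (intro infsum_nonneg) simp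
  define R where "R = C * Z * exp (\<delta> / 2 * D) / c"
  have "nrm \<xi> \<le> R" if xi: "\<xi> \<in> \<Xi>" and eq: "\<And>\<tau>. w \<xi> \<tau> = v (join \<tau> \<xi>)" for \<xi>
  proof -
    let ?n = "nrm \<xi>"
    have le: "cmod (w \<xi> \<tau>) \<le> C * exp (- (\<delta> / 2) * \<omega> ?n) * exp (- (\<delta> / 2) * \<omega> (1 + \<bar>of_int \<tau>\<bar>))" for \<tau>
      unfolding eq using order_trans[OF C(3) mult_left_mono[OF exp_join_le(1)[OF C(2)] C(1)]] by (simp add: mult.assoc)
    have sm: "(\<lambda>\<tau>. C * exp (- (\<delta> / 2) * \<omega> ?n) * exp (- (\<delta> / 2) * \<omega> (1 + \<bar>of_int \<tau>\<bar>))) summable_on UNIV"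
      using C by (intro summable_on_cmult_right summable_on_weight_int) auto
    have s: "(\<lambda>\<tau>. cmod (w \<xi> \<tau>)) summable_on UNIV" by (rule summable_on_comparison_test[OF sm le]) simp
    have "(\<Sum>\<^sub>\<infinity>\<tau>. cmod (w \<xi> \<tau>)) \<le> (\<Sum>\<^sub>\<infinity>\<tau>::int. C * exp (- (\<delta> / 2) * \<omega> ?n) * exp (- (\<delta> / 2) * \<omega> (1 + \<bar>of_int \<tau>\<bar>)))"
      by (rule infsum_mono[OF s sm le])
    also have "\<dots> = C * exp (- (\<delta> / 2) * \<omega> ?n) * Z" unfolding Z_def by (rule infsum_cmult_right')
    finally have 1: "(\<Sum>\<^sub>\<infinity>\<tau>. cmod (w \<xi> \<tau>)) \<le> C * exp (- (\<delta> / 2) * \<omega> ?n) * Z" .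
    have n1: "1 \<le> ?n" by (rule nrm_ge_one)
    have "2 * ln ?n \<le> \<delta> / 2 * \<omega> ?n + \<delta> / 2 * D"
      using mult_left_mono[OF D(2)[OF n1], of "\<delta> / 2"] C(2) by (simp add: algebra_simps)
    then have "exp (- (\<delta> / 2) * \<omega> ?n) \<le> exp (\<delta> / 2 * D - real 2 * ln ?n)" by simp
    also have "\<dots> = exp (\<delta> / 2 * D) / ?n ^ 2" using n1 by (simp only: exp_diff exp_of_nat_mult exp_ln)
    finally have 2: "exp (- (\<delta> / 2) * \<omega> ?n) \<le> exp (\<delta> / 2 * D) / ?n ^ 2" .
    have "c \<le> ?n * (C * exp (- (\<delta> / 2) * \<omega> ?n) * Z)"
      using n1 by (intro order_trans[OF c(2)[OF xi s]] mult_left_mono 1) auto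
    also have "\<dots> \<le> ?n * (C * (exp (\<delta> / 2 * D) / ?n ^ 2) * Z)"
      using n1 C(1) Z by (intro mult_left_mono mult_right_mono 2) auto
    also have "\<dots> = C * Z * exp (\<delta> / 2 * D) / ?n" using n1 by (simp add: power2_eq_square)
    finally show ?thesis using c(1) n1 by (simp add: R_def field_simps)
  qed
  then have "\<Xi> \<subseteq> {\<xi>\<in>\<Xi>. \<exists>\<tau>. w \<xi> \<tau> \<noteq> v (join \<tau> \<xi>)} \<union> {\<xi>. nrm \<xi> \<le> R}" by blast
  then have "finite \<Xi>" by (rule finite_subset) (intro finite_UnI fin finite_nrm_le)
  then show False using q by (simp add: quasi_solutions_def)
qed

lemma grows_restr:
  assumes "quasi_solutions \<Xi> w"
  shows "grows (restr \<Xi> w)"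
  unfolding grows_def
proof (intro allI impI)
  fix \<epsilon> :: real assume e: "\<epsilon> > 0"
  obtain C where C: "C \<ge> 0" "\<And>\<xi> \<tau>. \<xi> \<in> \<Xi> \<Longrightarrow> cmod (w \<xi> \<tau>) \<le> C * exp (\<epsilon> * \<omega> (nrm \<xi>))"
    using quasi_solutions_growth[OF assms e] by blast
  have "cmod (restr \<Xi> w (join \<tau> \<xi>)) \<le> C * exp (\<epsilon> * \<omega> (nrm (join \<tau> \<xi>)))" for \<tau> \<xi>
  proof -
    have "\<omega> (nrm \<xi>) \<le> \<omega> (nrm (join \<tau> \<xi>))" using nrm_pos[of \<xi>] by (intro om_mono) (auto simp: nrm_join)
    then have "C * exp (\<epsilon> * \<omega> (nrm \<xi>)) \<le> C * exp (\<epsilon> * \<omega> (nrm (join \<tau> \<xi>)))" using C(1) e by (intro mult_left_mono) auto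
    then show ?thesis using C(1) order_trans[OF C(2)] by (simp add: restr_join)
  qed
  then show "\<exists>C\<ge>0. \<forall>k. cmod (restr \<Xi> w k) \<le> C * exp (\<epsilon> * \<omega> (nrm k))"
    using C(1) by (metis join_split)
qed

lemma decays_Lseq_restr:
  assumes "quasi_solutions \<Xi> w"
  shows "decays (Lseq (restr \<Xi> w))"
proof -
  obtain C \<delta> where C: "0 \<le> C" "0 < \<delta>" "\<And>\<xi> \<tau>. \<xi> \<in> \<Xi> \<Longrightarrow> cmod (Lxi \<xi> (w \<xi>) \<tau>) \<le> C * exp (- \<delta> * \<omega> (nrm (join \<tau> \<xi>)))"
    using quasi_solutions_decay[OF assms] by blast
  have "cmod (Lseq (restr \<Xi> w) (join \<tau> \<xi>)) \<le> C * exp (- \<delta> * \<omega> (nrm (join \<tau> \<xi>)))" for \<tau> \<xi>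
    using C by (simp add: Lseq_restr)
  then have "cmod (Lseq (restr \<Xi> w) k) \<le> C * exp (- \<delta> * \<omega> (nrm k))" for k by (metis join_split)
  then show ?thesis using C unfolding decays_def by blast
qed

lemma mu_of_cmult: "mu_of (\<lambda>k. c * m k) \<phi> = c * mu_of m \<phi>"
  by (simp add: mu_of_def mult.assoc infsum_cmult_right')

lemma E_dual_uminus:
  assumes "\<mu> \<in> E_dual \<omega>" "f \<in> E_roumieu \<omega>"
  shows "\<mu> (\<lambda>x. - f x) = - \<mu> f"
proof -
  have "\<mu> (\<lambda>x. c * f x) = c * \<mu> f" for c using assms by (simp add: E_dual_def)
  from this[of "-1"] show ?thesis by simp
qed

text \<open>Testing with characters recovers the coefficients of a representing function h, so the
  glued sequence itself would have to decay, against \<open>infinite_nondecay\<close>.\<close>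

lemma not_hypoelliptic:
  assumes q: "quasi_solutions \<Xi> w"
  shows "\<not> globally_hypoelliptic \<omega> a b"
proof
  assume GH: "globally_hypoelliptic \<omega> a b"
  let ?m = "restr \<Xi> w"
  let ?V = "complex_of_real ((2 * pi) ^ CARD('n option))"
  have V: "?V \<noteq> 0" by simp
  note g = grows_restr[OF q]
  \<comment> \<open>The factor 1 / V undoes the volume that \<open>torus_integral_pairing\<close>
    introduces.\<close>
  have dec: "decays (\<lambda>k. 1 / ?V * Lseq ?m k)" by (intro decays_cmult decays_Lseq_restr[OF q])
  have "mu_of ?m (\<lambda>v. - Lop a b \<phi> v) = torus_integral (\<lambda>v. Ffun (\<lambda>k. 1 / ?V * Lseq ?m k) v * \<phi> v)"
    if phi: "\<phi> \<in> E_roumieu \<omega>" for \<phi>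
  proof -
    have "mu_of ?m (\<lambda>v. - Lop a b \<phi> v) = mu_of (Lseq ?m) \<phi>"
      using E_dual_uminus[OF mu_of_in_E_dual[OF g] Lop_E_roumieu(1)[OF phi]] mu_of_Lop[OF g phi] by simp
    also have "\<dots> = ?V * mu_of (\<lambda>k. 1 / ?V * Lseq ?m k) \<phi>" unfolding mu_of_cmult using V by simp
    also have "\<dots> = torus_integral (\<lambda>v. Ffun (\<lambda>k. 1 / ?V * Lseq ?m k) v * \<phi> v)"
      by (rule torus_integral_pairing[OF dec phi, symmetric])
    finally show ?thesis .
  qed
  then obtain h where h: "h \<in> E_roumieu \<omega>" "\<And>\<phi>. \<phi> \<in> E_roumieu \<omega> \<Longrightarrow> mu_of ?m \<phi> = torus_integral (\<lambda>v. h v * \<phi> v)"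
    using GH mu_of_in_E_dual[OF g] Ffun_in_E_roumieu[OF dec] unfolding globally_hypoelliptic_def by blast
  note dh = E_roumieu_imp_decays[OF h(1)]
  have "?m k = ?V * fc h k" for k
  proof -
    have "mu_of ?m (ee (\<lambda>i. - k i)) = ?V * mu_of (fc h) (ee (\<lambda>i. - k i))"
      using h(2)[OF ee_in_E_roumieu] torus_integral_pairing[OF dh(1) ee_in_E_roumieu] dh(2) by simp
    then show ?thesis unfolding mu_of_ee by simp
  qed
  then have m_eq: "?m = (\<lambda>k. ?V * fc h k)" by (rule ext)
  have "decays ?m" unfolding m_eq by (rule decays_cmult[OF dh(1)])
  moreover have "{\<xi> \<in> \<Xi>. \<exists>\<tau>. w \<xi> \<tau> \<noteq> ?m (join \<tau> \<xi>)} = {}" by (simp add: restr_join)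
  ultimately show False using infinite_nondecay[OF q, of ?m] by (metis finite.emptyI)
qed

text \<open>On a fixed slice every weight in \<xi> is a constant, so \<open>regularity\<close>
  yields decay in \<tau> from mere boundedness; finitely many slices add up.\<close>

lemma decays_restr_finite:
  assumes q: "quasi_solutions \<Xi> w" and S: "finite S" "S \<subseteq> \<Xi>"
  shows "decays (restr S w)"
proof (rule regularity)
  fix M \<delta>1 :: real
  assume M: "1 \<le> M" "0 < \<delta>1" "\<And>\<delta> \<xi> w S F \<eta> \<tau>. 0 < \<delta> \<Longrightarrow> \<delta> \<le> \<delta>1 \<Longrightarrow> 0 \<le> F \<Longrightarrow> cmod \<eta> \<le> nrm \<xi> \<Longrightarrow> (\<And>\<tau>. cmod (w \<tau>) \<le> S) \<Longrightarrow>
     (\<And>\<tau>. cmod (Lxi \<xi> w \<tau> - \<i> * \<eta> * w \<tau>) \<le> F * exp (- \<delta> * \<omega> (1 + \<bar>of_int \<tau>\<bar>))) \<Longrightarrow>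
     cmod (w \<tau>) \<le> 2 * (F + S * exp (\<delta> * \<omega> (1 + M * nrm \<xi>))) * exp (- \<delta> * \<omega> (1 + \<bar>of_int \<tau>\<bar>))"
  obtain C \<delta> where C: "0 \<le> C" "0 < \<delta>" "\<And>\<xi> \<tau>. \<xi> \<in> \<Xi> \<Longrightarrow> cmod (Lxi \<xi> (w \<xi>) \<tau>) \<le> C * exp (- \<delta> * \<omega> (nrm (join \<tau> \<xi>)))"
    using quasi_solutions_decay[OF q] by blast
  obtain G where G: "G \<ge> 0" "\<And>\<xi> \<tau>. \<xi> \<in> \<Xi> \<Longrightarrow> cmod (w \<xi> \<tau>) \<le> G * exp (1 * \<omega> (nrm \<xi>))"
    using quasi_solutions_growth[OF q zero_less_one] by blast
  define \<delta>' where "\<delta>' = min \<delta> \<delta>1"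
  have d': "0 < \<delta>'" "\<delta>' \<le> \<delta>1" "\<delta>' \<le> \<delta>" using C M by (auto simp: \<delta>'_def)
  have one: "decays (restr {\<xi>} w)" if xi: "\<xi> \<in> \<Xi>" for \<xi>
  proof -
    let ?w = "\<lambda>\<tau>::int. \<omega> (1 + \<bar>of_int \<tau>\<bar>)"
    define K where "K = 2 * (C + G * exp (1 * \<omega> (nrm \<xi>)) * exp (\<delta>' * \<omega> (1 + M * nrm \<xi>)))"
    have K: "0 \<le> K" using C G by (simp add: K_def)
    have bd: "cmod (w \<xi> \<tau>) \<le> K * exp (- \<delta>' * ?w \<tau>)" for \<tau>
      unfolding K_def
    proof (rule M(3)[OF d'(1,2) C(1), of 0])
      show "cmod 0 \<le> nrm \<xi>" using nrm_pos[of \<xi>] by simp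
      show "cmod (w \<xi> \<tau>) \<le> G * exp (1 * \<omega> (nrm \<xi>))" for \<tau> by (rule G(2)[OF xi])
      fix \<tau>
      have "?w \<tau> \<le> \<omega> (nrm (join \<tau> \<xi>))" using nrm_ge_one[of \<xi>] by (intro om_mono) (auto simp: nrm_join)
      then have "\<delta>' * ?w \<tau> \<le> \<delta> * \<omega> (nrm (join \<tau> \<xi>))" using d' C(2) by (intro mult_mono om_nonneg) auto
      then have "C * exp (- \<delta> * \<omega> (nrm (join \<tau> \<xi>))) \<le> C * exp (- \<delta>' * ?w \<tau>)" using C(1) by (intro mult_left_mono) auto
      then show "cmod (Lxi \<xi> (w \<xi>) \<tau> - \<i> * 0 * w \<xi> \<tau>) \<le> C * exp (- \<delta>' * ?w \<tau>)"
        using order_trans[OF C(3)[OF xi]] by simp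
    qed
    have "cmod (restr {\<xi>} w (join \<tau> \<eta>)) \<le> K * exp (\<delta>' * \<omega> (nrm \<xi>)) * exp (- \<delta>' * \<omega> (nrm (join \<tau> \<eta>)))" for \<tau> \<eta>
    proof (cases "\<eta> = \<xi>")
      case True
      have "exp (- \<delta>' * ?w \<tau>) = exp (\<delta>' * \<omega> (nrm \<xi>)) * (exp (- \<delta>' * \<omega> (nrm \<xi>)) * exp (- \<delta>' * ?w \<tau>))"
        by (simp flip: exp_add)
      also have "\<dots> \<le> exp (\<delta>' * \<omega> (nrm \<xi>)) * exp (- \<delta>' * \<omega> (nrm (join \<tau> \<xi>)))"
        by (intro mult_left_mono exp_join_le(2)[OF d'(1)]) auto
      finally have "K * exp (- \<delta>' * ?w \<tau>) \<le> K * (exp (\<delta>' * \<omega> (nrm \<xi>)) * exp (- \<delta>' * \<omega> (nrm (join \<tau> \<xi>))))"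
        by (intro mult_left_mono K)
      then show ?thesis using order_trans[OF bd] True by (simp add: restr_join mult.assoc)
    next
      case False
      then show ?thesis using K by (simp add: restr_join)
    qed
    then have "cmod (restr {\<xi>} w k) \<le> K * exp (\<delta>' * \<omega> (nrm \<xi>)) * exp (- \<delta>' * \<omega> (nrm k))" for k by (metis join_split)
    then show ?thesis unfolding decays_def using K d'(1)
      by (intro exI[of _ "K * exp (\<delta>' * \<omega> (nrm \<xi>))"] exI[of _ \<delta>']) auto
  qed
  have "restr S w k = (\<Sum>\<xi>\<in>S. restr {\<xi>} w k)" for k
  proof -
    have "(\<Sum>\<xi>\<in>S. restr {\<xi>} w k) = (\<Sum>\<xi>\<in>S. if (\<lambda>j. k (Some j)) = \<xi> then w (\<lambda>j. k (Some j)) (k None) else 0)"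
      by (rule sum.cong) (auto simp: restr_def)
    then show ?thesis using S(1) by (simp add: restr_def)
  qed
  then have "restr S w = (\<lambda>k. \<Sum>\<xi>\<in>S. restr {\<xi>} w k)" by (rule ext)
  then show "decays (restr S w)" using decays_sum[OF S(1), of "\<lambda>\<xi>. restr {\<xi>} w"] one S(2) by auto
qed

text \<open>Finite truncations of the glued sequence decay, so their images lie in the range. These
  images approach the image of the whole family within one Banach step: the tail keeps rate
  \<delta>/2 with a small constant.\<close>

lemma range_contains_if_closed:
  assumes q: "quasi_solutions \<Xi> w" and closed: "lb_closed \<omega> (Lop a b ` E_roumieu \<omega>)"
  shows "Ffun (Lseq (restr \<Xi> w)) \<in> Lop a b ` E_roumieu \<omega>"
proof (rule ccontr)
  let ?E = "E_roumieu \<omega> :: (real^('n option) \<Rightarrow> complex) set"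
  let ?L = "Lseq (restr \<Xi> w)"
  let ?f = "Ffun ?L"
  assume "?f \<notin> Lop a b ` ?E"
  then have "?f \<in> ?E - Lop a b ` ?E" using Ffun_in_E_roumieu[OF decays_Lseq_restr[OF q]] by blast
  then obtain U where U: "lb_zero_nbhd \<omega> U" "(\<lambda>g x. ?f x + g x) ` U \<subseteq> ?E - Lop a b ` ?E"
    using closed unfolding lb_closed_def lb_open_def by blast
  obtain C \<delta> where C: "0 \<le> C" "0 < \<delta>" "\<And>k. cmod (?L k) \<le> C * exp (- \<delta> * \<omega> (nrm k))"
    using decays_Lseq_restr[OF q] by (auto simp: decays_def)
  obtain n :: nat where n: "1 / real n \<le> \<delta> / 4" "1 \<le> n"
  proof -
    obtain n :: nat where "4 / \<delta> < real n" using reals_Archimedean2 by blast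
    moreover have "0 < 4 / \<delta>" using C(2) by simp
    ultimately have "0 < real n" "4 / \<delta> < real n" by linarith+
    then have "1 / real n \<le> \<delta> / 4" "1 \<le> n" using C(2) by (simp_all add: field_simps)
    then show ?thesis using that by blast
  qed
  obtain r where r: "r > 0" "\<And>g. g \<in> E_step \<omega> (1 / real n) \<Longrightarrow> rnorm \<omega> (1 / real n) g < r \<Longrightarrow> g \<in> U"
    using U(1) n(2) unfolding lb_zero_nbhd_def by blast
  define Z where "Z = (\<Sum>\<^sub>\<infinity>k::'n option \<Rightarrow> int. exp (- (\<delta> / 2 / 2) * \<omega> (nrm k)))"
  have Z: "0 \<le> Z" unfolding Z_def by (intro infsum_nonneg) simp
  \<comment> \<open>\<open>Q\<close> exceeds C Z / r, so C Z / Q < r; then \<open>R\<close> is taken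
    so large that the tail factor exp(-(\<delta>/2) \<omega>(R)) is at most 1 / Q.\<close>
  define Q where "Q = C * Z / r + 1"
  have Q: "Q > 0" using C Z r by (simp add: Q_def add_nonneg_pos)
  obtain R where R: "R \<ge> 1" "\<omega> R \<ge> 2 / \<delta> * ln Q" using om_unbounded by blast
  define S where "S = {\<xi>\<in>\<Xi>. nrm \<xi> \<le> R}"
  have S: "finite S" "S \<subseteq> \<Xi>" using finite_nrm_le[of R] by (auto simp: S_def)
  note dS = decays_restr_finite[OF q S]
  define e where "e k = Lseq (restr S w) k + (-1) * ?L k" for k
  define C' where "C' = C * exp (- (\<delta> / 2) * \<omega> R)"
  have C': "0 \<le> C'" using C by (simp add: C'_def)
  have eb: "cmod (e k) \<le> C' * exp (- (\<delta> / 2) * \<omega> (nrm k))" for k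
  proof -
    define \<tau> \<xi> where "\<tau> = k None" and "\<xi> = (\<lambda>j. k (Some j))"
    have k: "k = join \<tau> \<xi>" by (simp add: \<tau>_def \<xi>_def join_split)
    show ?thesis
    proof (cases "\<xi> \<in> \<Xi> \<and> \<xi> \<notin> S")
      case True
      then have "R \<le> nrm \<xi>" by (auto simp: S_def)
      then have "\<omega> R \<le> \<omega> (nrm k)" using R by (intro om_mono) (auto simp: k nrm_join)
      then have "\<delta> / 2 * \<omega> R \<le> \<delta> / 2 * \<omega> (nrm k)" using C(2) by (intro mult_left_mono) auto
      then have "- \<delta> * \<omega> (nrm k) \<le> - (\<delta> / 2) * \<omega> R + - (\<delta> / 2) * \<omega> (nrm k)" by simp
      then have "exp (- \<delta> * \<omega> (nrm k)) \<le> exp (- (\<delta> / 2) * \<omega> R + - (\<delta> / 2) * \<omega> (nrm k))" by simp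
      from mult_left_mono[OF this C(1)]
      have "C * exp (- \<delta> * \<omega> (nrm k)) \<le> C' * exp (- (\<delta> / 2) * \<omega> (nrm k))"
        unfolding C'_def by (simp only: exp_add mult.assoc)
      moreover have "cmod (e k) = cmod (?L k)" using True by (simp add: e_def k Lseq_restr)
      ultimately show ?thesis using C(3)[of k] by linarith
    next
      case False
      then have "e k = 0" using S(2) by (auto simp: e_def k Lseq_restr)
      then show ?thesis using C' by simp
    qed
  qed
  have lam: "0 < 1 / real n" "1 / real n \<le> \<delta> / 2 / 2" using n by auto
  note st = Ffun_in_E_step[OF C' eb lam]
  have "C' * Z < r"
  proof -
    have "ln Q \<le> \<delta> / 2 * \<omega> R" using mult_left_mono[OF R(2), of "\<delta> / 2"] C(2) by simp
    then have "exp (- (\<delta> / 2) * \<omega> R) \<le> exp (- ln Q)" by simp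
    also have "\<dots> = 1 / Q" using Q by (simp add: exp_minus inverse_eq_divide)
    finally have "C' * Z \<le> C * (1 / Q) * Z" unfolding C'_def using C(1) Z by (intro mult_right_mono mult_left_mono) auto
    also have "\<dots> < r" using Q r(1) by (simp add: Q_def field_simps)
    finally show ?thesis .
  qed
  then have "Ffun e \<in> U" using st r(2) unfolding Z_def by force
  then have "(\<lambda>x. ?f x + Ffun e x) \<notin> Lop a b ` ?E" using U(2) by blast
  moreover have "(\<lambda>x. ?f x + Ffun e x) = Ffun (Lseq (restr S w))"
  proof
    fix x
    note dL = decays_Lseq_restr[OF q] and dSL = decays_Lseq[OF dS]
    have "Ffun e x = Ffun (Lseq (restr S w)) x + Ffun (\<lambda>k. (-1) * ?L k) x"
      unfolding e_def [abs_def] by (rule Ffun_add[OF dSL decays_cmult[OF dL]])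
    then show "?f x + Ffun e x = Ffun (Lseq (restr S w)) x" using Ffun_cmult[of "-1" ?L x] by simp
  qed
  moreover have "Ffun (Lseq (restr S w)) = Lop a b (Ffun (restr S w))" by (rule Lop_Ffun[OF dS, symmetric])
  ultimately show False using Ffun_in_E_roumieu[OF dS] by auto
qed

text \<open>Slices of v - w live on disjoint sets of frequencies and solve the homogeneous equation,
  so each gives a kernel element. A character placed at a nonzero entry of each slice separates
  them, and \<open>no_finite_span_of_diagonal\<close> applies.\<close>

lemma not_solvable:
  assumes q: "quasi_solutions \<Xi> w"
  shows "\<not> strongly_solvable \<omega> a b"
proof
  let ?E = "E_roumieu \<omega> :: (real^('n option) \<Rightarrow> complex) set"
  assume SS: "strongly_solvable \<omega> a b"
  then have "Ffun (Lseq (restr \<Xi> w)) \<in> Lop a b ` ?E"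
    using range_contains_if_closed[OF q] unfolding strongly_solvable_def by blast
  then obtain v0 where v0: "v0 \<in> ?E" "Ffun (Lseq (restr \<Xi> w)) = Lop a b v0" by auto
  define v where "v = fc v0"
  have v: "decays v" using E_roumieu_imp_decays[OF v0(1)] by (simp add: v_def)
  have Lv: "Lseq v = Lseq (restr \<Xi> w)"
    using Lop_E_roumieu(2)[OF v0(1)] fc_Ffun_decays[OF decays_Lseq_restr[OF q]] v0(2) by (simp add: v_def)
  define X where "X = {\<xi>\<in>\<Xi>. \<exists>\<tau>. w \<xi> \<tau> \<noteq> v (join \<tau> \<xi>)}"
  have X: "infinite X" unfolding X_def by (rule infinite_nondecay[OF q v])
  define n where "n \<xi> \<tau> = v (join \<tau> \<xi>) - w \<xi> \<tau>" for \<xi> \<tau>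
  obtain C1 where C1: "0 \<le> C1" "\<And>k. cmod (v k) \<le> C1 * exp (- 0 * \<omega> (nrm k))"
  proof -
    obtain C \<delta> where C: "0 \<le> C" "0 < \<delta>" "\<And>k. cmod (v k) \<le> C * exp (- \<delta> * \<omega> (nrm k))"
      using v by (auto simp: decays_def)
    have "C * exp (- \<delta> * \<omega> (nrm k)) \<le> C * 1" for k :: "'n option \<Rightarrow> int"
      using C om_nrm_nonneg[of k] by (intro mult_left_mono) auto
    then show ?thesis using that[of C] C(1) order_trans[OF C(3)] by simp
  qed
  obtain G where G: "G \<ge> 0" "\<And>\<xi> \<tau>. \<xi> \<in> \<Xi> \<Longrightarrow> cmod (w \<xi> \<tau>) \<le> G * exp (1 * \<omega> (nrm \<xi>))"
    using quasi_solutions_growth[OF q zero_less_one] by blast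
  have nb: "cmod (n \<xi> \<tau>) \<le> C1 + G * exp (\<omega> (nrm \<xi>))" if "\<xi> \<in> \<Xi>" for \<xi> \<tau>
    unfolding n_def using order_trans[OF norm_triangle_ineq4 add_mono[OF C1(2) G(2)[OF that]]] by simp
  have Lz: "Lseq (restr {\<xi>} n) = (\<lambda>_. 0)" if xi: "\<xi> \<in> \<Xi>" for \<xi>
  proof -
    have "Lxi \<xi> (n \<xi>) \<tau> = 0" for \<tau>
    proof -
      have "Lxi \<xi> (\<lambda>\<tau>. v (join \<tau> \<xi>) - w \<xi> \<tau>) \<tau> = Lxi \<xi> (\<lambda>\<tau>. v (join \<tau> \<xi>)) \<tau> - Lxi \<xi> (w \<xi>) \<tau>"
        using C1(2) G(2)[OF xi] by (intro Lxi_diff) auto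
      also have "Lxi \<xi> (w \<xi>) \<tau> = Lseq (restr \<Xi> w) (join \<tau> \<xi>)" using xi by (simp add: Lseq_restr)
      also have "\<dots> = Lxi \<xi> (\<lambda>\<tau>. v (join \<tau> \<xi>)) \<tau>" unfolding Lv [symmetric] by (rule Lseq_join)
      finally show ?thesis by (simp add: n_def [abs_def])
    qed
    then have "Lseq (restr {\<xi>} n) (join \<tau> \<eta>) = 0" for \<tau> \<eta> by (simp add: Lseq_restr)
    then show ?thesis by (metis join_split)
  qed
  have gr: "grows (restr {\<xi>} n)" if xi: "\<xi> \<in> \<Xi>" for \<xi>
    unfolding grows_def
  proof (intro allI impI)
    fix \<epsilon> :: real assume e: "0 < \<epsilon>"
    let ?K = "C1 + G * exp (\<omega> (nrm \<xi>))"
    have K: "0 \<le> ?K" using C1 G by simp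
    have "cmod (restr {\<xi>} n k) \<le> ?K * exp (\<epsilon> * \<omega> (nrm k))" for k
    proof -
      have "cmod (restr {\<xi>} n k) \<le> ?K * 1" using nb[OF xi] K by (auto simp: restr_def)
      also have "\<dots> \<le> ?K * exp (\<epsilon> * \<omega> (nrm k))" using K e om_nrm_nonneg[of k] by (intro mult_left_mono) auto
      finally show ?thesis .
    qed
    then show "\<exists>C\<ge>0. \<forall>k. cmod (restr {\<xi>} n k) \<le> C * exp (\<epsilon> * \<omega> (nrm k))" using K by blast
  qed
  have ker: "mu_of (restr {\<xi>} n) \<in> ker_transpose \<omega> a b" if xi: "\<xi> \<in> \<Xi>" for \<xi>
    unfolding ker_transpose_def
    using mu_of_in_E_dual[OF gr[OF xi]] mu_of_Lop[OF gr[OF xi]] by (auto simp: Lz[OF xi] mu_of_def)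
  obtain B where B: "finite B" "\<And>\<mu>. \<mu> \<in> ker_transpose \<omega> a b \<Longrightarrow> \<exists>c. \<mu> = (\<lambda>f. \<Sum>\<nu>\<in>B. c \<nu> * \<nu> f)"
    using SS unfolding strongly_solvable_def fin_dim_span_def by blast
  have "\<exists>t. \<forall>\<xi>\<in>X. n \<xi> (t \<xi>) \<noteq> 0" unfolding X_def n_def by (intro bchoice) (auto, metis)
  then obtain t where t: "\<And>\<xi>. \<xi> \<in> X \<Longrightarrow> n \<xi> (t \<xi>) \<noteq> 0" by blast
  \<comment> \<open>The minus sign compensates the reflection in \<open>mu_of_ee\<close>.\<close>
  define \<phi> where "\<phi> \<xi> = ee (\<lambda>i. - join (t \<xi>) \<xi> i)" for \<xi>
  have ev: "mu_of (restr {\<xi>} n) (\<phi> \<eta>) = (if \<eta> = \<xi> then n \<xi> (t \<xi>) else 0)" for \<xi> \<eta>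
    unfolding \<phi>_def mu_of_ee by (simp add: restr_join)
  show False
  proof (rule no_finite_span_of_diagonal[OF B(1) X, of "\<lambda>\<nu> \<xi>. \<nu> (\<phi> \<xi>)"])
    fix \<xi> assume xi: "\<xi> \<in> X"
    then have "\<xi> \<in> \<Xi>" by (simp add: X_def)
    from B(2)[OF ker[OF this]] obtain c where c: "mu_of (restr {\<xi>} n) = (\<lambda>f. \<Sum>\<nu>\<in>B. c \<nu> * \<nu> f)" by blast
    have "(if \<eta> = \<xi> then n \<xi> (t \<xi>) else 0) = (\<Sum>\<nu>\<in>B. c \<nu> * \<nu> (\<phi> \<eta>))" for \<eta>
      using ev[of \<xi> \<eta>] fun_cong[OF c, of "\<phi> \<eta>"] by simp
    then show "\<exists>c d. d \<noteq> 0 \<and> (\<forall>\<eta>\<in>X. (if \<eta> = \<xi> then d else 0) = (\<Sum>\<nu>\<in>B. c \<nu> * \<nu> (\<phi> \<eta>)))"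
      using t[OF xi] by blast
  qed
qed

end

section \<open>Necessity\<close>

context vector_field
begin

text \<open>The eigenvalue equation enters \<open>regularity\<close> with F = 0, leaving the factor
  exp(\<delta> \<omega>(1 + M nrm \<xi>)) \<le> exp(\<delta> (M + 2) \<omega>(nrm \<xi>)). Since
  \<delta> (M + 3) \<le> \<epsilon>, the prefactor covers it and leaves rate \<delta> in \<xi> as
  well.\<close>

lemma slice_decay:
  assumes e: "0 < \<epsilon>"
  shows "\<exists>\<delta>>0. \<forall>\<xi> w \<eta>. cmod \<eta> \<le> 1 \<longrightarrow> (\<forall>\<tau>. cmod (w \<tau>) \<le> 1) \<longrightarrow> (\<forall>\<tau>. Lxi \<xi> w \<tau> = \<i> * \<eta> * w \<tau>) \<longrightarrow>
    (\<forall>\<tau>. exp (- \<epsilon> * \<omega> (nrm \<xi>)) * cmod (w \<tau>) \<le> 2 * exp (- \<delta> * \<omega> (nrm (join \<tau> \<xi>))))"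
proof (rule regularity)
  fix M \<delta>1 :: real
  assume M: "1 \<le> M" "0 < \<delta>1" "\<And>\<delta> \<xi> w S F \<eta> \<tau>. 0 < \<delta> \<Longrightarrow> \<delta> \<le> \<delta>1 \<Longrightarrow> 0 \<le> F \<Longrightarrow> cmod \<eta> \<le> nrm \<xi> \<Longrightarrow> (\<And>\<tau>. cmod (w \<tau>) \<le> S) \<Longrightarrow>
     (\<And>\<tau>. cmod (Lxi \<xi> w \<tau> - \<i> * \<eta> * w \<tau>) \<le> F * exp (- \<delta> * \<omega> (1 + \<bar>of_int \<tau>\<bar>))) \<Longrightarrow>
     cmod (w \<tau>) \<le> 2 * (F + S * exp (\<delta> * \<omega> (1 + M * nrm \<xi>))) * exp (- \<delta> * \<omega> (1 + \<bar>of_int \<tau>\<bar>))"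
  define \<delta> where "\<delta> = min \<delta>1 (\<epsilon> / (M + 3))"
  have d: "0 < \<delta>" "\<delta> \<le> \<delta>1" using M e by (auto simp: \<delta>_def)
  have "\<delta> \<le> \<epsilon> / (M + 3)" by (simp add: \<delta>_def)
  then have dM: "\<delta> * (M + 3) \<le> \<epsilon>" using M by (simp add: field_simps)
  show ?thesis
  proof (rule exI[of _ \<delta>], intro conjI d(1) allI impI)
    fix \<xi> :: "'n \<Rightarrow> int" and w :: "int \<Rightarrow> complex" and \<eta> :: complex and \<tau> :: int
    assume eta: "cmod \<eta> \<le> 1" and w: "\<forall>\<tau>. cmod (w \<tau>) \<le> 1" and L: "\<forall>\<tau>. Lxi \<xi> w \<tau> = \<i> * \<eta> * w \<tau>"
    let ?n = "\<omega> (nrm \<xi>)" and ?w = "\<omega> (1 + \<bar>of_int \<tau>\<bar>)"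
    have "cmod (w \<tau>) \<le> 2 * (0 + 1 * exp (\<delta> * \<omega> (1 + M * nrm \<xi>))) * exp (- \<delta> * ?w)"
    proof (rule M(3)[OF d, of 0 \<eta>])
      show "cmod \<eta> \<le> nrm \<xi>" using eta nrm_ge_one[of \<xi>] by linarith
      show "cmod (w \<tau>) \<le> 1" for \<tau> using w by blast
      show "cmod (Lxi \<xi> w \<tau> - \<i> * \<eta> * w \<tau>) \<le> 0 * exp (- \<delta> * \<omega> (1 + \<bar>of_int \<tau>\<bar>))" for \<tau> using L by simp
    qed simp
    then have "exp (- \<epsilon> * ?n) * cmod (w \<tau>) \<le> exp (- \<epsilon> * ?n) * (2 * exp (\<delta> * \<omega> (1 + M * nrm \<xi>)) * exp (- \<delta> * ?w))"
      by (intro mult_left_mono) simp_all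
    also have "\<dots> = 2 * exp (- \<epsilon> * ?n + \<delta> * \<omega> (1 + M * nrm \<xi>)) * exp (- \<delta> * ?w)"
      by (simp only: exp_add mult_ac)
    also have "\<dots> \<le> 2 * exp (- \<delta> * ?n) * exp (- \<delta> * ?w)"
    proof (intro mult_right_mono mult_left_mono)
      have "1 + M * nrm \<xi> \<le> (M + 1) * nrm \<xi>" using nrm_ge_one[of \<xi>] by (simp add: algebra_simps)
      then have "\<omega> (1 + M * nrm \<xi>) \<le> \<omega> ((M + 1) * nrm \<xi>)" using M nrm_pos[of \<xi>] by (intro om_mono) auto
      also have "\<dots> \<le> (M + 1 + 1) * ?n" using M nrm_pos[of \<xi>] by (intro om_mult) auto
      finally have "\<delta> * \<omega> (1 + M * nrm \<xi>) \<le> \<delta> * ((M + 2) * ?n)"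
        using d by (intro mult_left_mono) (auto simp: algebra_simps)
      moreover have "\<delta> * (M + 3) * ?n \<le> \<epsilon> * ?n" by (intro mult_right_mono dM om_nrm_nonneg)
      ultimately have "- \<epsilon> * ?n + \<delta> * \<omega> (1 + M * nrm \<xi>) \<le> - \<delta> * ?n" by (simp add: algebra_simps)
      then show "exp (- \<epsilon> * ?n + \<delta> * \<omega> (1 + M * nrm \<xi>)) \<le> exp (- \<delta> * ?n)" by simp
    qed simp_all
    also have "\<dots> \<le> 2 * exp (- \<delta> * \<omega> (nrm (join \<tau> \<xi>)))"
      using exp_join_le(2)[OF d(1), of \<xi> \<tau>] by simp
    finally show "exp (- \<epsilon> * ?n) * cmod (w \<tau>) \<le> 2 * exp (- \<delta> * \<omega> (nrm (join \<tau> \<xi>)))" .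
  qed
qed

lemma periodic_reduce:
  obtains t' where "0 \<le> t'" "t' \<le> 2 * pi" "\<And>g::real \<Rightarrow> complex. (\<And>t. g (t + 2 * pi) = g t) \<Longrightarrow> g t = g t'"
proof
  define n where "n = \<lfloor>t / (2 * pi)\<rfloor>"
  have "of_int n * (2 * pi) \<le> t" "t \<le> (of_int n + 1) * (2 * pi)"
    unfolding n_def using pi_gt_zero by (simp_all flip: pos_le_divide_eq pos_divide_le_eq)
  then show "0 \<le> t - of_int n * (2 * pi)" "t - of_int n * (2 * pi) \<le> 2 * pi" by (simp_all add: algebra_simps)
  fix g :: "real \<Rightarrow> complex" assume g: "\<And>t. g (t + 2 * pi) = g t"
  have "(\<lambda>v::real^1. g (v $ 1)) ((\<chi> i. t) + (\<chi> i. 2 * pi * of_int (- n))) = g t"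
    by (subst periodic_torus_int_shift[OF periodic_torus_fun1[of g, OF g]]) simp
  then show "g t = g (t - of_int n * (2 * pi))" by (simp add: mult_ac)
qed

section \<open>Failure of (EDC): exact and approximate resonances\<close>

lemma Zx_scale: "Zx (\<lambda>j. m * \<xi> j) = of_int m * Zx \<xi>"
  by (simp add: Zx_def sum_distrib_left mult.assoc)

lemma px_scale: "px (\<lambda>j. m * \<xi> j) t = of_int m * px \<xi> t"
  by (simp add: px_def sum_distrib_left mult.assoc)

lemma infinite_multiples:
  assumes "infinite N" "\<xi> j \<noteq> 0"
  shows "infinite ((\<lambda>n::nat. (\<lambda>i. int n * \<xi> i)) ` N)"
proof -
  have "inj_on (\<lambda>n::nat. (\<lambda>i. int n * \<xi> i)) N"
    using assms(2) by (auto simp: inj_on_def fun_eq_iff)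
  then show ?thesis using assms(1) by (simp add: finite_image_iff)
qed

text \<open>Failure of (EDC) gives, for a fixed \<epsilon>0, one violating pair for each constant.
  An exactly resonant \<xi> \<noteq> 0 supplies all its multiples. Without one, finitely many
  candidates \<xi> would have divisors bounded below, and taking that bound as the constant gives a
  contradiction.\<close>

lemma infinite_small_divisors:
  assumes "\<not> EDC1 \<omega> (\<lambda>j. mean_T1 (a j)) (\<lambda>j. mean_T1 (b j))"
  obtains \<epsilon> where "0 < \<epsilon>" "infinite {\<xi>::'n \<Rightarrow> int. \<exists>\<tau>::int. cmod (of_int \<tau> + Zx \<xi>) \<le> exp (- \<epsilon> * \<omega> (nrm \<xi>))}"
proof -
  let ?eu = "\<lambda>(\<tau>::int) (\<xi>::'n \<Rightarrow> int). sqrt (real_of_int \<tau> ^ 2 + (\<Sum>j\<in>UNIV. real_of_int (\<xi> j) ^ 2))"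
  obtain \<epsilon>0 where e0: "\<epsilon>0 > 0" "\<And>C. C > 0 \<Longrightarrow> \<exists>(\<tau>::int) (\<xi>::'n \<Rightarrow> int). (\<tau> \<noteq> 0 \<or> (\<exists>j. \<xi> j \<noteq> 0)) \<and>
      cmod (of_int \<tau> + Zx \<xi>) < C * exp (- \<epsilon>0 * \<omega> (?eu \<tau> \<xi>))"
    using assms unfolding EDC1_def Zx_def by (auto simp: not_le)
  let ?N = "real CARD('n)"
  define \<epsilon> where "\<epsilon> = \<epsilon>0 / (?N + 2)"
  have e: "\<epsilon> > 0" using e0 by (simp add: \<epsilon>_def add_pos_pos)
  have eu: "exp (- \<epsilon>0 * \<omega> (?eu \<tau> \<xi>)) \<le> exp (- \<epsilon> * \<omega> (nrm \<xi>))" if xi: "\<exists>j. \<xi> j \<noteq> 0" for \<tau> \<xi>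
  proof -
    have le: "\<bar>real_of_int (\<xi> j)\<bar> \<le> ?eu \<tau> \<xi>" for j
    proof -
      have "real_of_int (\<xi> j) ^ 2 \<le> (\<Sum>j\<in>UNIV. real_of_int (\<xi> j) ^ 2)" by (rule member_le_sum) auto
      also have "\<dots> \<le> real_of_int \<tau> ^ 2 + (\<Sum>j\<in>UNIV. real_of_int (\<xi> j) ^ 2)" by simp
      finally show ?thesis using real_sqrt_le_mono by fastforce
    qed
    obtain j where "\<xi> j \<noteq> 0" using xi by blast
    then have 1: "1 \<le> ?eu \<tau> \<xi>" using le[of j] one_le_abs_of_int[of "\<xi> j"] by linarith
    have "nrm \<xi> \<le> 1 + (\<Sum>j\<in>(UNIV::'n set). ?eu \<tau> \<xi>)" unfolding nrm_def by (intro add_left_mono sum_mono le)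
    also have "\<dots> \<le> (?N + 1) * ?eu \<tau> \<xi>" using 1 by (simp add: algebra_simps)
    finally have "\<omega> (nrm \<xi>) \<le> \<omega> ((?N + 1) * ?eu \<tau> \<xi>)" using nrm_pos[of \<xi>] by (intro om_mono) auto
    also have "\<dots> \<le> (?N + 1 + 1) * \<omega> (?eu \<tau> \<xi>)" using 1 by (intro om_mult) auto
    finally have "\<epsilon> * \<omega> (nrm \<xi>) \<le> \<epsilon> * ((?N + 2) * \<omega> (?eu \<tau> \<xi>))" using e by (intro mult_left_mono) (auto simp: add.assoc)
    also have "\<dots> = \<epsilon>0 * \<omega> (?eu \<tau> \<xi>)" by (simp add: \<epsilon>_def add_nonneg_eq_0_iff)
    finally show ?thesis by simp
  qed
  let ?X = "{\<xi>::'n \<Rightarrow> int. \<exists>\<tau>::int. cmod (of_int \<tau> + Zx \<xi>) \<le> exp (- \<epsilon> * \<omega> (nrm \<xi>))}"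
  have "infinite ?X"
  proof (cases "\<exists>(\<tau>::int) \<xi>. (\<exists>j. \<xi> j \<noteq> 0) \<and> of_int \<tau> + Zx \<xi> = 0")
    case True
    then obtain \<tau> :: int and \<xi> j where t: "\<xi> j \<noteq> 0" "of_int \<tau> + Zx \<xi> = 0" by blast
    have "(\<lambda>n::nat. (\<lambda>i. int n * \<xi> i)) ` UNIV \<subseteq> ?X"
    proof
      fix \<zeta> assume "\<zeta> \<in> (\<lambda>n::nat. (\<lambda>i. int n * \<xi> i)) ` UNIV"
      then obtain n where n: "\<zeta> = (\<lambda>i. int n * \<xi> i)" by auto
      have "of_int (int n * \<tau>) + Zx \<zeta> = of_nat n * (of_int \<tau> + Zx \<xi>)" by (simp add: n Zx_scale algebra_simps)
      then have "cmod (of_int (int n * \<tau>) + Zx \<zeta>) \<le> exp (- \<epsilon> * \<omega> (nrm \<zeta>))" using t(2) by simp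
      then show "\<zeta> \<in> ?X" by blast
    qed
    then show ?thesis using infinite_multiples[of UNIV \<xi> j, OF infinite_UNIV_nat t(1)] finite_subset by blast
  next
    case False
    show ?thesis
    proof
      assume fin: "finite ?X"
      \<comment> \<open>For each of the finitely many candidates only finitely many \<tau> give a
        divisor at most 1, so the minimum \<open>c\<close> below is attained and positive. Pairs
        with \<xi> = 0 have divisor at least 1 \<ge> c.\<close>
      define F where "F = (SIGMA \<xi>:{\<xi>\<in>?X. \<exists>j. \<xi> j \<noteq> 0}. {\<tau>::int. cmod (of_int \<tau> + Zx \<xi>) \<le> 1})"
      have "finite {\<tau>::int. cmod (of_int \<tau> + Zx \<xi>) \<le> 1}" for \<xi>
      proof (rule finite_subset)
        show "{\<tau>::int. cmod (of_int \<tau> + Zx \<xi>) \<le> 1} \<subseteq> {- \<lceil>1 + cmod (Zx \<xi>)\<rceil>..\<lceil>1 + cmod (Zx \<xi>)\<rceil>}"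
        proof
          fix \<tau> :: int assume "\<tau> \<in> {\<tau>. cmod (of_int \<tau> + Zx \<xi>) \<le> 1}"
          then have "\<bar>real_of_int \<tau>\<bar> \<le> 1 + cmod (Zx \<xi>)"
            using norm_triangle_ineq4[of "of_int \<tau> + Zx \<xi>" "Zx \<xi>"] by simp
          then show "\<tau> \<in> {- \<lceil>1 + cmod (Zx \<xi>)\<rceil>..\<lceil>1 + cmod (Zx \<xi>)\<rceil>}" by (simp add: abs_le_iff) linarith
        qed
      qed simp
      then have "finite F" unfolding F_def using fin by (intro finite_SigmaI) auto
      define c where "c = Min (insert 1 ((\<lambda>(\<xi>, \<tau>). cmod (of_int \<tau> + Zx \<xi>)) ` F))"
      have "c \<in> insert 1 ((\<lambda>(\<xi>, \<tau>). cmod (of_int \<tau> + Zx \<xi>)) ` F)"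
        unfolding c_def using \<open>finite F\<close> by (intro Min_in) auto
      then have c: "c > 0" using False by (auto simp: F_def) blast
      have cle: "c \<le> 1" "\<And>\<xi> \<tau>. (\<xi>, \<tau>) \<in> F \<Longrightarrow> c \<le> cmod (of_int \<tau> + Zx \<xi>)"
        unfolding c_def using \<open>finite F\<close> by (auto intro!: Min_le)
      obtain \<tau> :: int and \<xi> :: "'n \<Rightarrow> int" where t: "\<tau> \<noteq> 0 \<or> (\<exists>j. \<xi> j \<noteq> 0)" "cmod (of_int \<tau> + Zx \<xi>) < c * exp (- \<epsilon>0 * \<omega> (?eu \<tau> \<xi>))"
        using e0(2)[OF c] by blast
      have "0 \<le> \<omega> (?eu \<tau> \<xi>)" by (intro om_nonneg real_sqrt_ge_zero add_nonneg_nonneg sum_nonneg) auto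
      then have "exp (- \<epsilon>0 * \<omega> (?eu \<tau> \<xi>)) \<le> 1" using e0(1) by simp
      then have "c * exp (- \<epsilon>0 * \<omega> (?eu \<tau> \<xi>)) \<le> c * 1" using c by (intro mult_left_mono) auto
      then have lt: "cmod (of_int \<tau> + Zx \<xi>) < c" using t(2) by linarith
      show False
      proof (cases "\<exists>j. \<xi> j \<noteq> 0")
        case True
        have "cmod (of_int \<tau> + Zx \<xi>) \<le> 1 * exp (- \<epsilon>0 * \<omega> (?eu \<tau> \<xi>))"
          by (rule order_trans[OF less_imp_le[OF t(2)] mult_right_mono[OF cle(1)]]) simp
        then have "cmod (of_int \<tau> + Zx \<xi>) \<le> exp (- \<epsilon> * \<omega> (nrm \<xi>))" using eu[OF True, of \<tau>] by linarith
        then have "(\<xi>, \<tau>) \<in> F" unfolding F_def using True lt cle(1) by auto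
        then show False using cle(2) lt by fastforce
      next
        case False
        then have "Zx \<xi> = 0" by (simp add: Zx_def)
        then show False using t(1) False lt cle(1) one_le_abs_of_int[of \<tau>] by simp
      qed
    qed
  qed
  then show ?thesis using that e by blast
qed

lemma quasi_solutions_if_not_EDC:
  assumes "\<not> EDC1 \<omega> (\<lambda>j. mean_T1 (a j)) (\<lambda>j. mean_T1 (b j))"
  shows "\<exists>\<Xi> w. quasi_solutions \<Xi> w"
proof -
  obtain \<epsilon> where e: "0 < \<epsilon>" and inf: "infinite {\<xi>::'n \<Rightarrow> int. \<exists>\<tau>::int. cmod (of_int \<tau> + Zx \<xi>) \<le> exp (- \<epsilon> * \<omega> (nrm \<xi>))}"
    by (rule infinite_small_divisors[OF assms])
  define \<Xi> where "\<Xi> = {\<xi>::'n \<Rightarrow> int. \<exists>\<tau>::int. cmod (of_int \<tau> + Zx \<xi>) \<le> exp (- \<epsilon> * \<omega> (nrm \<xi>))}"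
  obtain \<delta> where d: "\<delta> > 0" "\<And>\<xi> w \<eta> \<tau>. cmod \<eta> \<le> 1 \<Longrightarrow> \<forall>\<tau>. cmod (w \<tau>) \<le> 1 \<Longrightarrow> \<forall>\<tau>. Lxi \<xi> w \<tau> = \<i> * \<eta> * w \<tau> \<Longrightarrow>
      exp (- \<epsilon> * \<omega> (nrm \<xi>)) * cmod (w \<tau>) \<le> 2 * exp (- \<delta> * \<omega> (nrm (join \<tau> \<xi>)))"
    using slice_decay[OF e] by metis
  have "\<exists>w. (\<forall>\<tau>. cmod (w \<tau>) \<le> 1) \<and> (\<forall>\<tau>. cmod (Lxi \<xi> w \<tau>) \<le> 2 * exp (- \<delta> * \<omega> (nrm (join \<tau> \<xi>)))) \<and>
     ((\<lambda>\<tau>. cmod (w \<tau>)) summable_on UNIV \<longrightarrow> 1 \<le> (\<Sum>\<^sub>\<infinity>\<tau>. cmod (w \<tau>)))" if "\<xi> \<in> \<Xi>" for \<xi>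
  proof -
    obtain T :: int where T: "cmod (of_int T + Zx \<xi>) \<le> exp (- \<epsilon> * \<omega> (nrm \<xi>))" using \<open>\<xi> \<in> \<Xi>\<close> by (auto simp: \<Xi>_def)
    define \<eta> where "\<eta> = of_int T + Zx \<xi>"
    have "exp (- \<epsilon> * \<omega> (nrm \<xi>)) \<le> 1" using e om_nrm_nonneg[of \<xi>] by simp
    then have eta: "cmod \<eta> \<le> exp (- \<epsilon> * \<omega> (nrm \<xi>))" "cmod \<eta> \<le> 1" using T unfolding \<eta>_def by linarith+
    \<comment> \<open>Solves u' = i (\<eta> - px) u. Subtracting t \<eta> changes the increment of
      Px over a period from 2 pi Zx to -2 pi T with integer T, so u0 is periodic.\<close>
    define u0 where "u0 t = exp (- \<i> * (Px \<xi> t - of_real t * \<eta>))" for t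
    have dP: "((\<lambda>t. Px \<xi> t - of_real t * \<eta>) has_vector_derivative px \<xi> t - \<eta>) (at t)" for t
    proof -
      have "((\<lambda>z. z * \<eta>) has_field_derivative \<eta>) (at (of_real t))" by (auto intro!: derivative_eq_intros)
      from has_vector_derivative_diff[OF Px_derivative has_vector_derivative_real_field[OF this]]
      show ?thesis .
    qed
    have du0: "(u0 has_vector_derivative - \<i> * (px \<xi> t - \<eta>) * u0 t) (at t)" for t
      unfolding u0_def [abs_def] by (rule has_vector_derivative_exp_comp[OF dP])
    have cu0: "continuous_on UNIV u0"
      using du0 by (intro continuous_at_imp_continuous_on) (auto intro: has_vector_derivative_continuous)
    have pu0: "u0 (t + 2 * pi) = u0 t" for t
    proof -
      have "- \<i> * (Px \<xi> (t + 2 * pi) - of_real (t + 2 * pi) * \<eta>) = - \<i> * (Px \<xi> t - of_real t * \<eta>) + 2 * of_int T * of_real pi * \<i>"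
        unfolding Px_shift by (simp add: \<eta>_def algebra_simps)
      moreover have "exp (2 * of_int T * of_real pi * \<i>) = 1" by (auto simp: exp_eq_1)
      ultimately show ?thesis by (simp only: u0_def exp_add mult_1_right)
    qed
    obtain s where s: "\<And>t. 0 \<le> t \<Longrightarrow> t \<le> 2 * pi \<Longrightarrow> cmod (u0 t) \<le> cmod (u0 s)"
    proof -
      have "continuous_on {0..2 * pi} (\<lambda>t. cmod (u0 t))" by (intro continuous_intros continuous_on_subset[OF cu0]) auto
      then have "\<exists>s\<in>{0..2 * pi}. \<forall>t\<in>{0..2 * pi}. cmod (u0 t) \<le> cmod (u0 s)"
        by (intro continuous_attains_sup) auto
      then show ?thesis using that by (meson atLeastAtMost_iff)
    qed
    have sb: "cmod (u0 t) \<le> cmod (u0 s)" for t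
    proof -
      obtain t' where t': "0 \<le> t'" "t' \<le> 2 * pi" "\<And>g::real \<Rightarrow> complex. (\<And>t. g (t + 2 * pi) = g t) \<Longrightarrow> g t = g t'"
        using periodic_reduce[of t] by metis
      have "u0 t = u0 t'" by (rule t'(3)) (rule pu0)
      then show ?thesis using s t'(1,2) by simp
    qed
    have n0: "u0 s \<noteq> 0" by (simp add: u0_def)
    \<comment> \<open>Division by the value at a maximum of |u0| gives sup norm exactly 1, with no
      estimate of exp(Im Px) required.\<close>
    define u where "u t = 1 / u0 s * u0 t" for t
    have u1: "cmod (u t) \<le> 1" for t using sb[of t] n0 by (simp add: u_def norm_divide)
    have us: "u s = 1" using n0 by (simp add: u_def)
    have cu: "continuous_on UNIV u" unfolding u_def [abs_def] by (intro continuous_intros cu0)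
    have pu: "u (t + 2 * pi) = u t" for t by (simp add: u_def pu0)
    have du: "(u has_vector_derivative \<i> * \<eta> * u t - \<i> * px \<xi> t * u t) (at t)" for t
      using has_vector_derivative_mult_right[OF du0[of t], of "1 / u0 s"]
      by (simp add: u_def [abs_def] algebra_simps)
    let ?w = "fc1 u"
    have L: "Lxi \<xi> ?w \<tau> = \<i> * \<eta> * ?w \<tau>" for \<tau>
      using Lxi_fc1[OF cu _ pu u1 du, of \<tau>] cu by (simp add: fc1_cmult continuous_on_mult)
    have w1: "cmod (?w \<tau>) \<le> 1" for \<tau> by (rule fc1_norm_le[OF cu u1])
    have "cmod (Lxi \<xi> ?w \<tau>) \<le> 2 * exp (- \<delta> * \<omega> (nrm (join \<tau> \<xi>)))" for \<tau>
    proof -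
      have "cmod (Lxi \<xi> ?w \<tau>) \<le> exp (- \<epsilon> * \<omega> (nrm \<xi>)) * cmod (?w \<tau>)"
        unfolding L norm_mult using eta(1) by (simp add: mult_right_mono)
      also have "\<dots> \<le> 2 * exp (- \<delta> * \<omega> (nrm (join \<tau> \<xi>)))" by (rule d(2)[OF eta(2)]) (use w1 L in auto)
      finally show ?thesis .
    qed
    moreover have "(\<lambda>\<tau>. cmod (?w \<tau>)) summable_on UNIV \<longrightarrow> 1 \<le> (\<Sum>\<^sub>\<infinity>\<tau>. cmod (?w \<tau>))"
      using norm_le_infsum_fc1[OF cu pu, of s] us by simp
    ultimately show ?thesis using w1 by blast
  qed
  then obtain w where w: "\<And>\<xi> \<tau>. \<xi> \<in> \<Xi> \<Longrightarrow> cmod (w \<xi> \<tau>) \<le> 1"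
    "\<And>\<xi> \<tau>. \<xi> \<in> \<Xi> \<Longrightarrow> cmod (Lxi \<xi> (w \<xi>) \<tau>) \<le> 2 * exp (- \<delta> * \<omega> (nrm (join \<tau> \<xi>)))"
    "\<And>\<xi>. \<xi> \<in> \<Xi> \<Longrightarrow> (\<lambda>\<tau>. cmod (w \<xi> \<tau>)) summable_on UNIV \<Longrightarrow> 1 \<le> (\<Sum>\<^sub>\<infinity>\<tau>. cmod (w \<xi> \<tau>))"
    by metis
  have "quasi_solutions \<Xi> w"
    unfolding quasi_solutions_def
  proof (intro conjI allI impI)
    show "infinite \<Xi>" using inf by (simp add: \<Xi>_def)
    fix \<epsilon>' :: real assume e': "0 < \<epsilon>'"
    have ge: "1 \<le> 1 * exp (\<epsilon>' * \<omega> (nrm \<xi>))" for \<xi> :: "'n \<Rightarrow> int" using e' om_nrm_nonneg[of \<xi>] by simp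
    show "\<exists>C\<ge>0. \<forall>\<xi>\<in>\<Xi>. \<forall>\<tau>. cmod (w \<xi> \<tau>) \<le> C * exp (\<epsilon>' * \<omega> (nrm \<xi>))"
      using order_trans[OF w(1) ge] by (intro exI[of _ 1] conjI ballI allI) auto
  next
    show "\<exists>C \<delta>. 0 \<le> C \<and> 0 < \<delta> \<and> (\<forall>\<xi>\<in>\<Xi>. \<forall>\<tau>. cmod (Lxi \<xi> (w \<xi>) \<tau>) \<le> C * exp (- \<delta> * \<omega> (nrm (join \<tau> \<xi>))))"
      using w(2) d(1) by (intro exI[of _ 2] exI[of _ \<delta>]) auto
  next
    have "1 \<le> nrm \<xi> * (\<Sum>\<^sub>\<infinity>\<tau>. cmod (w \<xi> \<tau>))" if "\<xi> \<in> \<Xi>" "(\<lambda>\<tau>. cmod (w \<xi> \<tau>)) summable_on UNIV" for \<xi>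
      using mult_mono[OF nrm_ge_one[of \<xi>] w(3)[OF that]] nrm_pos[of \<xi>] by simp
    then show "\<exists>c>0. \<forall>\<xi>\<in>\<Xi>. (\<lambda>\<tau>. cmod (w \<xi> \<tau>)) summable_on UNIV \<longrightarrow> c \<le> nrm \<xi> * (\<Sum>\<^sub>\<infinity>\<tau>. cmod (w \<xi> \<tau>))"
      by (intro exI[of _ 1]) simp
  qed
  then show ?thesis by blast
qed

text \<open>If no single b_j changes sign, two of them are linearly independent, and their values at
  suitable s, t form an invertible matrix. Cramer's rule gives real coefficients with values 1 and
  -1 there; scaling by a large N and rounding down moves the values N and -N by less than N.\<close>

lemma integer_combination_changes_sign:
  assumes "\<not> ((\<forall>j. \<not> changes_sign (b j)) \<and> (\<exists>g::real \<Rightarrow> real. \<forall>j. \<exists>c::real. b j = (\<lambda>t. c * g t)))"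
  obtains \<xi> s t where "Im (px \<xi> s) > 0" "Im (px \<xi> t) < 0"
proof (cases "\<forall>j. \<not> changes_sign (b j)")
  case False
  then obtain j s t where j: "b j s > 0" "b j t < 0" by (auto simp: changes_sign_def)
  have "Im (px (\<lambda>i. if i = j then 1 else 0) r) = b j r" for r
  proof -
    have "(\<Sum>i\<in>UNIV. of_int (if i = j then 1 else 0) * b i r) = (\<Sum>i\<in>UNIV. if i = j then b j r else 0)"
      by (rule sum.cong) auto
    then show ?thesis by (simp add: Im_px)
  qed
  then show ?thesis using that j by metis
next
  case True
  then have ng: "\<not> (\<exists>g::real \<Rightarrow> real. \<forall>j. \<exists>c::real. b j = (\<lambda>t. c * g t))" using assms by blast
  have "\<exists>j s. b j s \<noteq> 0"
  proof (rule ccontr)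
    assume "\<not> ?thesis"
    then have "\<forall>j. \<exists>c::real. b j = (\<lambda>t. c * 0)" by (auto simp: fun_eq_iff)
    then show False using ng by (metis (full_types))
  qed
  then obtain j s where js: "b j s \<noteq> 0" by blast
  obtain l where l: "\<And>c. b l \<noteq> (\<lambda>t. c * b j t)" using ng by metis
  then obtain t where "b l t \<noteq> b l s / b j s * b j t" by (metis ext)
  define D where "D = b j s * b l t - b j t * b l s"
  have D: "D \<noteq> 0" using \<open>b l t \<noteq> b l s / b j s * b j t\<close> js by (simp add: D_def field_simps)
  have jl: "j \<noteq> l" using D by (auto simp: D_def)
  define x y where "x = (b l t + b l s) / D" and "y = - (b j t + b j s) / D"
  have xs: "x * b j s + y * b l s = 1"
  proof -
    have "x * b j s + y * b l s = ((b l t + b l s) * b j s - (b j t + b j s) * b l s) / D"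
      using D by (simp add: x_def y_def field_simps)
    also have "(b l t + b l s) * b j s - (b j t + b j s) * b l s = D" by (simp add: D_def algebra_simps)
    finally show ?thesis using D by simp
  qed
  have xt: "x * b j t + y * b l t = - 1"
  proof -
    have "x * b j t + y * b l t = ((b l t + b l s) * b j t - (b j t + b j s) * b l t) / D"
      using D by (simp add: x_def y_def field_simps)
    also have "(b l t + b l s) * b j t - (b j t + b j s) * b l t = - D" by (simp add: D_def algebra_simps)
    finally show ?thesis using D by simp
  qed
  obtain N :: nat where N: "\<bar>b j s\<bar> + \<bar>b l s\<bar> + \<bar>b j t\<bar> + \<bar>b l t\<bar> < real N" using reals_Archimedean2 by blast
  define \<xi> where "\<xi> = (\<lambda>_. 0 :: int)(j := \<lfloor>real N * x\<rfloor>, l := \<lfloor>real N * y\<rfloor>)"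
  have I: "Im (px \<xi> r) = of_int \<lfloor>real N * x\<rfloor> * b j r + of_int \<lfloor>real N * y\<rfloor> * b l r" for r
  proof -
    have "(\<Sum>i\<in>UNIV. of_int (\<xi> i) * b i r) = (\<Sum>i\<in>UNIV. (if i = j then of_int \<lfloor>real N * x\<rfloor> * b j r else 0)
       + (if i = l then of_int \<lfloor>real N * y\<rfloor> * b l r else 0))"
      by (rule sum.cong) (use jl in \<open>auto simp: \<xi>_def\<close>)
    then show ?thesis by (simp add: Im_px sum.distrib)
  qed
  have near: "\<bar>of_int \<lfloor>z\<rfloor> * c - z * c\<bar> \<le> \<bar>c\<bar>" for z c :: real
  proof -
    have "\<bar>of_int \<lfloor>z\<rfloor> - z\<bar> \<le> 1" by linarith
    then have "\<bar>of_int \<lfloor>z\<rfloor> - z\<bar> * \<bar>c\<bar> \<le> 1 * \<bar>c\<bar>" by (intro mult_right_mono) auto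
    then show ?thesis by (metis abs_mult left_diff_distrib mult_1)
  qed
  have Ib: "\<bar>Im (px \<xi> r) - real N * (x * b j r + y * b l r)\<bar> \<le> \<bar>b j r\<bar> + \<bar>b l r\<bar>" for r
    using near[of "real N * x" "b j r"] near[of "real N * y" "b l r"] unfolding I by (simp add: algebra_simps)
  have "\<bar>Im (px \<xi> s) - real N * 1\<bar> < real N" "\<bar>Im (px \<xi> t) - real N * (- 1)\<bar> < real N"
    using Ib[of s, unfolded xs] Ib[of t, unfolded xt] N by linarith+
  then have "Im (px \<xi> s) > 0" "Im (px \<xi> t) < 0" by (simp_all add: abs_less_iff)
  then show ?thesis by (rule that)
qed

end

section \<open>Quasi-solutions from a sign change of the imaginary part\<close>

lemma has_vector_derivative_cis_comp:
  assumes "(g has_real_derivative D) (at t)"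
  shows "((\<lambda>t. cis (g t)) has_vector_derivative \<i> * of_real D * cis (g t)) (at t)"
proof -
  have "((\<lambda>t. complex_of_real (g t)) has_vector_derivative of_real D) (at t)"
    using bounded_linear.has_vector_derivative[OF bounded_linear_of_real] assms
    by (simp add: has_real_derivative_iff_has_vector_derivative)
  from has_vector_derivative_exp_comp[OF this, of \<i>] show ?thesis by (simp add: cis_conv_exp)
qed

lemma increment_ge:
  fixes \<psi> \<psi>' :: "real \<Rightarrow> real"
  assumes d: "\<And>s. (\<psi> has_real_derivative \<psi>' s) (at s)"
    and nn: "\<And>s. x \<le> s \<Longrightarrow> s \<le> y \<Longrightarrow> 0 \<le> \<psi>' s" and m: "\<And>s. \<alpha> \<le> s \<Longrightarrow> s \<le> \<beta> \<Longrightarrow> m \<le> \<psi>' s"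
    and le: "x \<le> \<alpha>" "\<alpha> \<le> \<beta>" "\<beta> \<le> y"
  shows "m * (\<beta> - \<alpha>) \<le> \<psi> y - \<psi> x"
proof -
  have "\<psi> x \<le> \<psi> \<alpha>" by (rule DERIV_nonneg_imp_nondecreasing[OF le(1)]) (use d nn le in force)
  moreover have "\<psi> \<beta> \<le> \<psi> y" by (rule DERIV_nonneg_imp_nondecreasing[OF le(3)]) (use d nn le in force)
  moreover have "\<psi> \<alpha> - m * \<alpha> \<le> \<psi> \<beta> - m * \<beta>"
  proof (rule DERIV_nonneg_imp_nondecreasing[OF le(2), of "\<lambda>s. \<psi> s - m * s"])
    fix s assume "\<alpha> \<le> s" "s \<le> \<beta>"
    then have "0 \<le> \<psi>' s - m" using m by simp
    moreover have "((\<lambda>s. \<psi> s - m * s) has_real_derivative \<psi>' s - m) (at s)"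
      by (auto intro!: derivative_eq_intros d)
    ultimately show "\<exists>y. ((\<lambda>s. \<psi> s - m * s) has_real_derivative y) (at s) \<and> 0 \<le> y" by blast
  qed
  ultimately show ?thesis by (simp add: algebra_simps)
qed

text \<open>Dirichlet approximation is applied to (m + 1) \<theta> rather than to \<theta>: the
  resulting n is a multiple of m + 1 and hence exceeds m. The tolerance 1/8 limits the phase drift
  over one period to pi/4.\<close>

lemma approximable_multiples:
  fixes \<theta> :: real
  shows "infinite {n::nat. \<exists>\<tau>::int. \<bar>real n * \<theta> - of_int \<tau>\<bar> \<le> 1 / 8}"
  unfolding infinite_nat_iff_unbounded
proof
  fix m :: nat
  obtain h k :: int where k: "0 < k" "\<bar>of_int k * (real (Suc m) * \<theta>) - of_int h\<bar> < 1 / real 8"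
    by (metis Dirichlet_approx zero_less_numeral)
  have e: "real (nat k * Suc m) * \<theta> = of_int k * (real (Suc m) * \<theta>)"
    using k(1) by (simp add: algebra_simps)
  have "\<bar>real (nat k * Suc m) * \<theta> - of_int h\<bar> \<le> 1 / 8" unfolding e using k(2) by simp
  moreover have "Suc m \<le> nat k * Suc m" using mult_le_mono1[of 1 "nat k" "Suc m"] k(1) by (simp del: mult_Suc_right)
  ultimately show "\<exists>n>m. n \<in> {n::nat. \<exists>\<tau>::int. \<bar>real n * \<theta> - of_int \<tau>\<bar> \<le> 1 / 8}"
    unfolding mem_Collect_eq Suc_le_eq by blast
qed

context vector_field
begin

text \<open>Used for the right-hand sides below: they are eigenfunctions of the slices of the field
  with b = 0, so \<open>slice_decay\<close> for that field bounds their coefficients.\<close>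

lemma vector_field_real_part: "vector_field \<omega> a (\<lambda>_ _. 0)"
proof
  have "lift_T1 (\<lambda>_. 0) = Ffun (\<lambda>_. 0)" by (simp add: lift_T1_def fun_eq_iff Ffun_zero)
  then show "lift_T1 (\<lambda>_. 0) \<in> E_roumieu \<omega>" using Ffun_in_E_roumieu[OF decays_zero] by metis
qed (rule a_E)

text \<open>For a fixed lag the difference of Px at r and at r minus the lag is periodic in r, so
  all oscillations over lags up to 2 pi are values of one continuous function of (time, lag) on a
  compact square.\<close>

lemma maximal_oscillation:
  "\<exists>s0 t0. t0 - 2 * pi \<le> s0 \<and> s0 \<le> t0 \<and>
    (\<forall>s t. t - 2 * pi \<le> s \<longrightarrow> s \<le> t \<longrightarrow> Im (Px \<xi> t) - Im (Px \<xi> s) \<le> Im (Px \<xi> t0) - Im (Px \<xi> s0))"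
proof -
  define B where "B t = Im (Px \<xi> t)" for t
  have Pc: "continuous_on UNIV (Px \<xi>)"
    using Px_derivative by (intro continuous_at_imp_continuous_on) (auto intro: has_vector_derivative_continuous)
  have Bc: "continuous_on UNIV B" unfolding B_def [abs_def] by (intro continuous_intros Pc)
  let ?D = "\<lambda>z. B (fst z) - B (fst z - snd z)"
  let ?R = "{0..2 * pi} \<times> {0..2 * pi}"
  have "continuous_on ?R ?D" by (intro continuous_intros continuous_on_compose2[OF Bc]) auto
  moreover have "compact ?R" by (intro compact_Times) auto
  moreover have "?R \<noteq> {}" by auto
  ultimately obtain z where z: "z \<in> ?R" "\<And>y. y \<in> ?R \<Longrightarrow> ?D y \<le> ?D z"
    using continuous_attains_sup[of ?R ?D] by blast
  show ?thesis
  proof (rule exI[of _ "fst z - snd z"], rule exI[of _ "fst z"], intro conjI allI impI)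
    fix s t :: real assume st: "t - 2 * pi \<le> s" "s \<le> t"
    obtain t' where t': "0 \<le> t'" "t' \<le> 2 * pi" "\<And>g::real \<Rightarrow> complex. (\<And>t. g (t + 2 * pi) = g t) \<Longrightarrow> g t = g t'"
      using periodic_reduce[of t] by metis
    let ?g = "\<lambda>r. Px \<xi> r - Px \<xi> (r - (t - s))"
    have "?g (r + 2 * pi) = ?g r" for r
      using Px_shift[of \<xi> r] Px_shift[of \<xi> "r - (t - s)"] by (simp add: algebra_simps)
    then have "?g t = ?g t'" by (rule t'(3))
    then have "Im (Px \<xi> t) - Im (Px \<xi> s) = ?D (t', t - s)" by (simp add: B_def) (metis minus_complex.simps(2))
    also have "\<dots> \<le> ?D z" using z(2)[of "(t', t - s)"] t' st by auto
    finally show "Im (Px \<xi> t) - Im (Px \<xi> s) \<le> Im (Px \<xi> (fst z)) - Im (Px \<xi> (fst z - snd z))"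
      by (simp only: B_def)
  qed (use z(1) in \<open>auto simp: B_def\<close>)
qed

text \<open>If \<open>Im (px \<xi>)\<close> changes sign, the right-hand sides \<open>exp (- n * K) * cis (\<kappa> s - n * Re (Px \<xi> s))\<close>
  decay, while the solution of the slice at \<open>n \<xi>\<close> stays bounded below near \<open>t0\<close>: the phase of the
  integrand is almost constant because \<open>\<kappa>\<close> is small, and its modulus peaks at \<open>s0\<close> with value 1.\<close>

lemma quasi_solutions_if_changes_sign:
  assumes EDC: "EDC1 \<omega> (\<lambda>j. mean_T1 (a j)) (\<lambda>j. mean_T1 (b j))"
    and pos: "Im (px \<xi> t1) > 0" and mean: "Im (Zx \<xi>) \<le> 0"
  shows "\<exists>\<Xi> w. quasi_solutions \<Xi> w"
proof -
  interpret A: vector_field \<omega> a "\<lambda>_ _. 0" by (rule vector_field_real_part)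
  define \<A> \<B> where "\<A> t = Re (Px \<xi> t)" and "\<B> t = Im (Px \<xi> t)" for t
  have dA: "(\<A> has_real_derivative Re (px \<xi> t)) (at t)" for t
    unfolding \<A>_def [abs_def] has_real_derivative_iff_has_vector_derivative
    by (rule bounded_linear.has_vector_derivative[OF bounded_linear_Re Px_derivative])
  have dB: "(\<B> has_real_derivative Im (px \<xi> t)) (at t)" for t
    unfolding \<B>_def [abs_def] has_real_derivative_iff_has_vector_derivative
    by (rule bounded_linear.has_vector_derivative[OF bounded_linear_Im Px_derivative])
  have P: "Px \<xi> t = of_real (\<A> t) + \<i> * of_real (\<B> t)" for t by (simp add: \<A>_def \<B>_def complex_eq_iff)
  have Ashift: "\<A> (t + 2 * pi) = \<A> t + 2 * pi * Re (Zx \<xi>)" for t by (simp add: \<A>_def Px_shift)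
  obtain s0 t0 K where K: "t0 - 2 * pi \<le> s0" "s0 \<le> t0" "K = \<B> t0 - \<B> s0"
    "\<And>s t. t - 2 * pi \<le> s \<Longrightarrow> s \<le> t \<Longrightarrow> \<B> t - \<B> s \<le> K"
    unfolding \<B>_def using maximal_oscillation[of \<xi>] by blast
  \<comment> \<open>A point where Im px is positive makes the primitive increase over a short
    interval ending there.\<close>
  have Kpos: "K > 0"
  proof -
    obtain h where h: "h > 0" "\<And>r. 0 < r \<Longrightarrow> r < h \<Longrightarrow> \<B> (t1 - r) < \<B> t1"
      using DERIV_pos_inc_left[OF dB pos] by blast
    define r where "r = min (h / 2) 1"
    have r: "0 < r" "r < h" "r \<le> 2 * pi" using h(1) pi_gt3 by (auto simp: r_def)
    show ?thesis using h(2)[OF r(1,2)] K(4)[of t1 "t1 - r"] r by simp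
  qed
  have xi: "\<exists>j. \<xi> j \<noteq> 0"
  proof (rule ccontr)
    assume "\<not> ?thesis" then show False using pos by (simp add: px_def)
  qed
  then obtain j0 where j0: "\<xi> j0 \<noteq> 0" by blast
  obtain L where L: "L \<ge> 1" "\<And>t. t0 - 2 * pi \<le> t \<Longrightarrow> t \<le> t0 \<Longrightarrow> \<bar>Im (px \<xi> t)\<bar> \<le> L"
  proof -
    have "bounded ((\<lambda>t. Im (px \<xi> t)) ` {t0 - 2 * pi..t0})"
      by (intro compact_imp_bounded compact_continuous_image continuous_intros continuous_on_subset[OF px_props(1)]) auto
    then obtain L where "\<And>t. t0 - 2 * pi \<le> t \<Longrightarrow> t \<le> t0 \<Longrightarrow> \<bar>Im (px \<xi> t)\<bar> \<le> L"
      unfolding bounded_iff by (metis atLeastAtMost_iff imageI real_norm_def)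
    then show ?thesis using that[of "max 1 L"] by (auto intro: order_trans max.coboundedI2)
  qed
  define W0 where "W0 = \<omega> (nrm \<xi>)"
  have W0: "0 \<le> W0" unfolding W0_def by (rule om_nrm_nonneg)
  \<comment> \<open>Chosen so that \<kappa>0 \<omega>(nrm (X n)) \<le> n K: the factor exp(- n K) of
    the right-hand side is then at most the prefactor that \<open>slice_decay\<close> asks
    for.\<close>
  define \<kappa>0 where "\<kappa>0 = K / (2 * W0 + 1)"
  have k0: "\<kappa>0 > 0" using Kpos W0 by (simp add: \<kappa>0_def add_nonneg_pos)
  obtain \<delta> where d: "\<delta> > 0" "\<And>\<xi> w \<eta> \<tau>. cmod \<eta> \<le> 1 \<Longrightarrow> \<forall>\<tau>. cmod (w \<tau>) \<le> 1 \<Longrightarrow> \<forall>\<tau>. A.Lxi \<xi> w \<tau> = \<i> * \<eta> * w \<tau> \<Longrightarrow>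
      exp (- \<kappa>0 * \<omega> (nrm \<xi>)) * cmod (w \<tau>) \<le> 2 * exp (- \<delta> * \<omega> (nrm (join \<tau> \<xi>)))"
    using A.slice_decay[OF k0] by metis
  define N where "N = {n::nat. \<exists>\<tau>::int. \<bar>real n * Re (Zx \<xi>) - of_int \<tau>\<bar> \<le> 1 / 8} - {0}"
  have infN: "infinite N" unfolding N_def using approximable_multiples by simp
  define X where "X n = (\<lambda>j. int n * \<xi> j)" for n
  define c where "c = exp (- 1) / (4 * L)"
  have c: "c > 0" using L by (simp add: c_def)
  have nrmX: "real n \<le> nrm (X n)" "\<omega> (nrm (X n)) \<le> real n * (2 * W0 + 1)" if "n \<in> N" for n
  proof -
    have n1: "1 \<le> n" using that by (simp add: N_def)
    have "real n * 1 \<le> real n * \<bar>real_of_int (\<xi> j0)\<bar>" using one_le_abs_of_int[OF j0] by (intro mult_left_mono) auto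
    then show "real n \<le> nrm (X n)" using nrm_ge[of "X n" j0] by (simp add: X_def abs_mult)
    have "nrm (X n) \<le> real n * nrm \<xi>"
      using n1 by (simp add: nrm_def X_def abs_mult distrib_left sum_distrib_left)
    then have "\<omega> (nrm (X n)) \<le> \<omega> (real n * nrm \<xi>)" using nrm_pos[of "X n"] by (intro om_mono) auto
    also have "\<dots> \<le> (real n + 1) * W0" unfolding W0_def using nrm_pos[of \<xi>] by (intro om_mult) auto
    also have "\<dots> \<le> (2 * real n) * W0" using n1 W0 by (intro mult_right_mono) auto
    also have "\<dots> \<le> real n * (2 * W0 + 1)" by (simp add: algebra_simps)
    finally show "\<omega> (nrm (X n)) \<le> real n * (2 * W0 + 1)" .
  qed
  \<comment> \<open>The growth bound is stated for all C and \<epsilon> because the constant of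
    (EDC) depends on \<epsilon>, whereas the solution w has to be fixed beforehand.\<close>
  have main: "\<exists>w. (\<forall>\<tau>. cmod (Lxi (X n) w \<tau>) \<le> 2 * exp (- \<delta> * \<omega> (nrm (join \<tau> (X n))))) \<and>
      (\<forall>C \<epsilon>. 0 < C \<longrightarrow> C * exp (- \<epsilon> * \<omega> (nrm (X n))) \<le> cmod (exp (- 1 * (2 * of_real pi * \<i> * Zx (X n))) - 1) \<longrightarrow>
        (\<forall>\<tau>. cmod (w \<tau>) \<le> 2 * pi / C * exp (\<epsilon> * \<omega> (nrm (X n))))) \<and>
      ((\<lambda>\<tau>. cmod (w \<tau>)) summable_on UNIV \<longrightarrow> c \<le> nrm (X n) * (\<Sum>\<^sub>\<infinity>\<tau>. cmod (w \<tau>)))" if n: "n \<in> N" for n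
  proof -
    have n1: "1 \<le> real n" using n by (simp add: N_def)
    obtain T :: int where T: "\<bar>real n * Re (Zx \<xi>) - of_int T\<bar> \<le> 1 / 8" using n by (auto simp: N_def)
    \<comment> \<open>The rounding error of n Re Zx. With it the phase of g below changes by -2 pi T
      over a period, so g is periodic.\<close>
    define \<kappa> where "\<kappa> = real n * Re (Zx \<xi>) - of_int T"
    have kap: "\<bar>\<kappa>\<bar> \<le> 1 / 8" using T by (simp add: \<kappa>_def)
    define g where "g t = cis (\<kappa> * t - real n * \<A> t)" for t
    have dg: "(g has_vector_derivative \<i> * of_real (\<kappa> - real n * Re (px \<xi> t)) * g t) (at t)" for t
      unfolding g_def [abs_def]
      by (rule has_vector_derivative_cis_comp) (auto intro!: derivative_eq_intros dA)
    have cg: "continuous_on UNIV g"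
      using dg by (intro continuous_at_imp_continuous_on) (auto intro: has_vector_derivative_continuous)
    have pg: "g (t + 2 * pi) = g t" for t
    proof -
      have "\<kappa> * (t + 2 * pi) - real n * \<A> (t + 2 * pi) = (\<kappa> * t - real n * \<A> t) + 2 * pi * (- of_int T)"
        unfolding Ashift by (simp add: \<kappa>_def algebra_simps)
      moreover have "cis (2 * pi * (- of_int T)) = 1" by (rule cis_multiple_2pi) simp
      ultimately show ?thesis by (simp only: g_def cis_mult [symmetric] mult_1_right)
    qed
    have ng: "cmod (g t) = 1" for t by (simp add: g_def)
    have pxA: "A.px (X n) t = of_real (real n * Re (px \<xi> t))" for t
    proof -
      have "A.px (X n) t = of_int (int n) * A.px \<xi> t" unfolding X_def by (rule A.px_scale)
      moreover have "A.px \<xi> t = of_real (Re (px \<xi> t))" by (simp add: A.px_def px_def)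
      ultimately show ?thesis by simp
    qed
    have dgA: "(g has_vector_derivative \<i> * of_real \<kappa> * g t - \<i> * A.px (X n) t * g t) (at t)" for t
      using dg[of t] by (simp add: pxA algebra_simps)
    have LA: "A.Lxi (X n) (fc1 g) \<tau> = \<i> * of_real \<kappa> * fc1 g \<tau>" for \<tau>
    proof -
      have "continuous_on UNIV (\<lambda>t. \<i> * of_real \<kappa> * g t)" by (intro continuous_intros cg)
      from A.Lxi_fc1[OF cg this pg _ dgA, of 1 \<tau>] ng show ?thesis by (simp add: fc1_cmult)
    qed
    have gdec: "exp (- \<kappa>0 * \<omega> (nrm (X n))) * cmod (fc1 g \<tau>) \<le> 2 * exp (- \<delta> * \<omega> (nrm (join \<tau> (X n))))" for \<tau>
    proof (rule d(2))
      show "cmod (of_real \<kappa>) \<le> 1" using kap by simp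
      show "\<forall>\<tau>. cmod (fc1 g \<tau>) \<le> 1" using fc1_norm_le[OF cg, of 1] ng by simp
      show "\<forall>\<tau>. A.Lxi (X n) (fc1 g) \<tau> = \<i> * of_real \<kappa> * fc1 g \<tau>" using LA by blast
    qed
    define f where "f t = of_real (exp (- real n * K)) * g t" for t
    have cf: "continuous_on UNIV f" unfolding f_def [abs_def] by (intro continuous_intros cg)
    have pf: "f (t + 2 * pi) = f t" for t by (simp add: f_def pg)
    define Q where "Q t = of_nat n * Px \<xi> t" for t
    have dQ: "(Q has_vector_derivative px (X n) t) (at t)" for t
      unfolding Q_def [abs_def] X_def px_scale using has_vector_derivative_mult_right[OF Px_derivative, of "of_nat n"] by simp
    have Qs: "Q (t + 2 * pi) = Q t + 2 * of_real pi * Zx (X n)" for t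
      by (simp add: Q_def X_def Zx_scale Px_shift distrib_left)
    have q1: "exp (- \<i> * (2 * of_real pi * Zx (X n))) \<noteq> 1"
    proof -
      obtain C where C: "C > 0" "\<And>\<xi> \<sigma>. (\<exists>j. \<xi> j \<noteq> 0) \<Longrightarrow> \<sigma> \<in> {1, -1} \<Longrightarrow>
         C * exp (- 1 * \<omega> (nrm \<xi>)) \<le> cmod (exp (\<sigma> * (2 * of_real pi * \<i> * Zx \<xi>)) - 1)"
        using EDC_exp_bound[OF EDC zero_less_one] by blast
      have "X n j0 \<noteq> 0" using j0 n by (simp add: X_def N_def)
      then have "C * exp (- 1 * \<omega> (nrm (X n))) \<le> cmod (exp (- 1 * (2 * of_real pi * \<i> * Zx (X n))) - 1)"
        by (intro C(2)) auto
      moreover have "0 < C * exp (- 1 * \<omega> (nrm (X n)))" using C(1) by simp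
      ultimately have "0 < cmod (exp (- 1 * (2 * of_real pi * \<i> * Zx (X n))) - 1)" by linarith
      then show ?thesis by (auto simp: mult_ac)
    qed
    obtain u where u: "\<And>t. (u has_vector_derivative f t - \<i> * px (X n) t * u t) (at t)" "\<And>t. u (t + 2 * pi) = u t"
      using periodic_ode_solution[OF dQ Qs cf pf q1] by blast
    have cu: "continuous_on UNIV u"
      using u(1) by (intro continuous_at_imp_continuous_on) (auto intro: has_vector_derivative_continuous)
    have Qdiff: "\<i> * (Q s - Q t) = \<i> * of_real (real n * (\<A> s - \<A> t)) + of_real (real n * (\<B> t - \<B> s))" for s t
      by (simp add: Q_def P algebra_simps)
    \<comment> \<open>The phase of f cancels the oscillation of the integrating factor: apart from a
      constant only \<kappa> s is left, and the modulus compares one increment of \<B> with the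
      maximal one.\<close>
    have Qf: "exp (\<i> * (Q s - Q t)) * f s
        = of_real (exp (real n * (\<B> t - \<B> s - K))) * cis (\<kappa> * s - real n * \<A> t)" for s t
    proof -
      have "exp (\<i> * (Q s - Q t)) = cis (real n * (\<A> s - \<A> t)) * of_real (exp (real n * (\<B> t - \<B> s)))"
        unfolding Qdiff exp_add by (simp only: cis_conv_exp exp_of_real)
      then have "exp (\<i> * (Q s - Q t)) * f s = of_real (exp (real n * (\<B> t - \<B> s)) * exp (- real n * K)) *
          (cis (real n * (\<A> s - \<A> t)) * g s)"
        by (simp add: f_def)
      also have "exp (real n * (\<B> t - \<B> s)) * exp (- real n * K) = exp (real n * (\<B> t - \<B> s - K))"
        by (simp add: algebra_simps flip: exp_add)
      also have "cis (real n * (\<A> s - \<A> t)) * g s = cis (\<kappa> * s - real n * \<A> t)"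
        by (simp add: g_def cis_mult algebra_simps)
      finally show ?thesis .
    qed
    have eq: "\<i> * (Q (t + - 2 * pi) - Q t) = - 1 * (2 * of_real pi * \<i> * Zx (X n))" for t
      using Qs[of "t - 2 * pi"] by (simp add: algebra_simps)
    \<comment> \<open>Integration runs backward from t: for s in the preceding period the increment
      of \<B> from s to t is at most K, so the integrand has modulus at most 1.\<close>
    have upper: "cmod (exp (- 1 * (2 * of_real pi * \<i> * Zx (X n))) - 1) * cmod (u t) \<le> 2 * pi * 1" for t
    proof -
      have "cmod (exp (\<i> * (Q (t + - 2 * pi) - Q t)) - 1) * cmod (u t) \<le> 2 * pi * 1"
      proof (rule periodic_ode_bound[OF dQ u])
        fix s assume s: "min t (t + - 2 * pi) \<le> s" "s \<le> max t (t + - 2 * pi)"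
        then have "t - 2 * pi \<le> s" "s \<le> t" using pi_gt_zero by (auto simp: min_def max_def split: if_splits)
        then have "\<B> t - \<B> s - K \<le> 0" using K(4)[of t s] by simp
        then have "real n * (\<B> t - \<B> s - K) \<le> 0" by (simp add: mult_le_0_iff)
        then show "cmod (exp (\<i> * (Q s - Q t)) * f s) \<le> 1" unfolding Qf by (simp add: norm_mult)
      qed simp
      then show ?thesis unfolding eq .
    qed
    have "\<exists>D. \<forall>t. cmod (u t) \<le> D"
    proof -
      let ?q = "cmod (exp (- 1 * (2 * of_real pi * \<i> * Zx (X n))) - 1)"
      have "?q > 0" using q1 by (auto simp: mult_ac)
      then have "cmod (u t) \<le> 2 * pi / ?q" for t using upper[of t] by (simp add: field_simps)
      then show ?thesis by blast
    qed
    then obtain D where D: "\<And>t. cmod (u t) \<le> D" by blast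
    let ?w = "fc1 u"
    have L1: "Lxi (X n) ?w \<tau> = of_real (exp (- real n * K)) * fc1 g \<tau>" for \<tau>
      using Lxi_fc1[OF cu cf u(2) D u(1)] by (simp add: f_def [abs_def] fc1_cmult)
    have "cmod (Lxi (X n) ?w \<tau>) \<le> 2 * exp (- \<delta> * \<omega> (nrm (join \<tau> (X n))))" for \<tau>
    proof -
      have "\<kappa>0 * \<omega> (nrm (X n)) \<le> \<kappa>0 * (real n * (2 * W0 + 1))" using nrmX(2)[OF n] k0 by (intro mult_left_mono) auto
      also have "\<dots> = real n * K" using W0 by (simp add: \<kappa>0_def field_simps add_nonneg_eq_0_iff)
      finally have "exp (- real n * K) \<le> exp (- \<kappa>0 * \<omega> (nrm (X n)))" by simp
      then have "exp (- real n * K) * cmod (fc1 g \<tau>) \<le> exp (- \<kappa>0 * \<omega> (nrm (X n))) * cmod (fc1 g \<tau>)"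
        by (intro mult_right_mono) auto
      then show ?thesis using gdec[of \<tau>] unfolding L1 by (simp add: norm_mult)
    qed
    moreover have "cmod (?w \<tau>) \<le> 2 * pi / C * exp (\<epsilon> * \<omega> (nrm (X n)))"
      if C: "0 < C" "C * exp (- \<epsilon> * \<omega> (nrm (X n))) \<le> cmod (exp (- 1 * (2 * of_real pi * \<i> * Zx (X n))) - 1)" for C \<epsilon> \<tau>
    proof (rule fc1_norm_le[OF cu])
      fix t
      have "C * exp (- \<epsilon> * \<omega> (nrm (X n))) * cmod (u t) \<le> 2 * pi * 1"
        by (rule order_trans[OF mult_right_mono[OF C(2) norm_ge_zero] upper])
      then show "cmod (u t) \<le> 2 * pi / C * exp (\<epsilon> * \<omega> (nrm (X n)))" using C(1) by (simp add: exp_minus field_simps)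
    qed
    moreover have "c \<le> nrm (X n) * (\<Sum>\<^sub>\<infinity>\<tau>. cmod (?w \<tau>))" if s: "(\<lambda>\<tau>. cmod (?w \<tau>)) summable_on UNIV"
    proof -
      define H where "H s = exp (\<i> * (Q s - Q t0)) * u s" for s
      \<comment> \<open>Rotates the phase of the integrand to \<kappa> (s - t0), which stays within
        pi/4 of 0; its real part is then positive and nothing cancels.\<close>
      define \<theta> where "\<theta> = cis (real n * \<A> t0 - \<kappa> * t0)"
      define \<psi> where "\<psi> s = Re (\<theta> * H s)" for s
      define \<psi>' where "\<psi>' s = exp (real n * (\<B> t0 - \<B> s - K)) * cos (\<kappa> * (s - t0))" for s
      have dH: "(H has_vector_derivative exp (\<i> * (Q s - Q t0)) * f s) (at s)" for s
      proof -
        have "((\<lambda>s. Q s - Q t0) has_vector_derivative px (X n) s) (at s)"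
          using has_vector_derivative_diff[OF dQ[of s] has_vector_derivative_const[of "Q t0"]] by simp
        from has_vector_derivative_mult[OF has_vector_derivative_exp_comp[OF this, of \<i>] u(1)[of s]]
        show ?thesis by (simp add: H_def [abs_def] algebra_simps)
      qed
      have dpsi: "(\<psi> has_real_derivative \<psi>' s) (at s)" for s
      proof -
        have "((\<lambda>s. \<theta> * H s) has_vector_derivative \<theta> * (exp (\<i> * (Q s - Q t0)) * f s)) (at s)"
          by (rule has_vector_derivative_mult_right[OF dH])
        from bounded_linear.has_vector_derivative[OF bounded_linear_Re this]
        have "(\<psi> has_vector_derivative Re (\<theta> * (exp (\<i> * (Q s - Q t0)) * f s))) (at s)"
          by (simp only: \<psi>_def [abs_def])
        moreover have "\<theta> * (exp (\<i> * (Q s - Q t0)) * f s)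
            = of_real (exp (real n * (\<B> t0 - \<B> s - K))) * cis (\<kappa> * (s - t0))"
        proof -
          have "\<theta> * cis (\<kappa> * s - real n * \<A> t0) = cis (\<kappa> * (s - t0))"
            by (simp add: \<theta>_def cis_mult algebra_simps)
          then show ?thesis unfolding Qf by (simp add: mult_ac)
        qed
        ultimately show ?thesis by (simp add: \<psi>'_def has_real_derivative_iff_has_vector_derivative)
      qed
      have cosge: "1 / 2 \<le> cos (\<kappa> * (s - t0))" if "t0 - 2 * pi \<le> s" "s \<le> t0" for s
      proof -
        have "\<bar>\<kappa> * (s - t0)\<bar> \<le> 1 / 8 * (2 * pi)" unfolding abs_mult using kap that by (intro mult_mono) auto
        also have "\<dots> \<le> pi / 3" using pi_gt_zero by simp
        finally have "cos (pi / 3) \<le> cos \<bar>\<kappa> * (s - t0)\<bar>" using pi_gt_zero by (intro cos_monotone_0_pi_le) auto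
        then show ?thesis by (simp add: cos_60)
      qed
      \<comment> \<open>On an interval of this length at s0 the function \<B> varies by at most 1 /
        n, so the modulus stays above exp(-1).\<close>
      define ell where "ell = 1 / (real n * L)"
      have nL: "1 \<le> real n * L" using mult_mono[OF n1 L(1)] n1 by simp
      have l: "0 < ell" "ell \<le> 1" using nL by (simp_all add: ell_def)
      have near: "exp (- 1) / 2 \<le> \<psi>' s" if s: "t0 - 2 * pi \<le> s" "s \<le> t0" "\<bar>s - s0\<bar> \<le> ell" for s
      proof -
        have "\<bar>\<B> s - \<B> s0\<bar> \<le> L * \<bar>s - s0\<bar>"
        proof -
          have "norm (\<B> s - \<B> s0) \<le> L * norm (s - s0)"
          proof (rule field_differentiable_bound[where S="{t0 - 2 * pi..t0}"])
            show "(\<B> has_real_derivative Im (px \<xi> z)) (at z within {t0 - 2 * pi..t0})" for z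
              by (rule has_field_derivative_at_within[OF dB])
            show "norm (Im (px \<xi> z)) \<le> L" if "z \<in> {t0 - 2 * pi..t0}" for z using L(2)[of z] that by simp
          qed (use s K(1,2) in auto)
          then show ?thesis by simp
        qed
        also have "\<dots> \<le> L * ell" using s(3) L(1) by (intro mult_left_mono) auto
        also have "\<dots> = 1 / real n" using L(1) by (simp add: ell_def)
        finally have "real n * (\<B> s - \<B> s0) \<le> real n * (1 / real n)" using n1 by (intro mult_left_mono) auto
        then have "- 1 \<le> real n * (\<B> t0 - \<B> s - K)" using n1 by (simp add: K(3) algebra_simps)
        then have "exp (- 1) \<le> exp (real n * (\<B> t0 - \<B> s - K))" by simp
        from mult_mono[OF this cosge[OF s(1,2)]] show ?thesis by (simp add: \<psi>'_def)
      qed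
      have nn: "0 \<le> \<psi>' s" if "t0 - 2 * pi \<le> s" "s \<le> t0" for s
        using cosge[OF that] by (simp add: \<psi>'_def)
      \<comment> \<open>The interval of length \<open>ell\<close> is taken to the right of s0 if it
        fits below t0, otherwise to the left.\<close>
      have inc: "exp (- 1) / 2 * ell \<le> \<psi> t0 - \<psi> (t0 - 2 * pi)"
      proof (cases "s0 + ell \<le> t0")
        case True
        have "exp (- 1) / 2 * ((s0 + ell) - s0) \<le> \<psi> t0 - \<psi> (t0 - 2 * pi)"
          by (rule increment_ge[OF dpsi]) (use nn near K True l in auto)
        then show ?thesis by simp
      next
        case False
        then have "t0 - 2 * pi \<le> s0 - ell" using l pi_gt3 by linarith
        then have "exp (- 1) / 2 * (s0 - (s0 - ell)) \<le> \<psi> t0 - \<psi> (t0 - 2 * pi)"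
          by (intro increment_ge[OF dpsi]) (use nn near K l in auto)
        then show ?thesis by simp
      qed
      have ut: "u (t0 - 2 * pi) = u t0" using u(2)[of "t0 - 2 * pi"] by simp
      have e2: "\<i> * (Q (t0 - 2 * pi) - Q t0) = - 1 * (2 * of_real pi * \<i> * Zx (X n))"
        using eq[of t0] by simp
      have Hd: "H t0 - H (t0 - 2 * pi) = (1 - exp (- 1 * (2 * of_real pi * \<i> * Zx (X n)))) * u t0"
        unfolding H_def e2 ut by (simp add: left_diff_distrib)
      \<comment> \<open>Here the sign of the mean enters: the multiplier has modulus at most 1, so
        |1 - q| \<le> 2 and the lower bound on the integral passes to u(t0).\<close>
      have qle: "cmod (exp (- 1 * (2 * of_real pi * \<i> * Zx (X n)))) \<le> 1"
      proof -
        have "Re (- 1 * (2 * of_real pi * \<i> * Zx (X n))) = 2 * pi * (real n * Im (Zx \<xi>))"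
          by (simp add: X_def Zx_scale)
        also have "\<dots> \<le> 0" using mean by (simp add: mult_le_0_iff)
        finally show ?thesis by simp
      qed
      have "\<psi> t0 - \<psi> (t0 - 2 * pi) = Re (\<theta> * (H t0 - H (t0 - 2 * pi)))" by (simp add: \<psi>_def right_diff_distrib)
      also have "\<dots> \<le> cmod (\<theta> * (H t0 - H (t0 - 2 * pi)))" by (rule complex_Re_le_cmod)
      also have "\<dots> = cmod (1 - exp (- 1 * (2 * of_real pi * \<i> * Zx (X n)))) * cmod (u t0)"
        by (simp only: Hd norm_mult \<theta>_def norm_cis mult_1_left)
      also have "\<dots> \<le> 2 * cmod (u t0)"
      proof (rule mult_right_mono)
        show "cmod (1 - exp (- 1 * (2 * of_real pi * \<i> * Zx (X n)))) \<le> 2"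
          using qle norm_triangle_ineq4[of 1 "exp (- 1 * (2 * of_real pi * \<i> * Zx (X n)))"]
          unfolding norm_one by linarith
      qed simp
      also have "\<dots> \<le> 2 * (\<Sum>\<^sub>\<infinity>\<tau>. cmod (?w \<tau>))" using norm_le_infsum_fc1[OF cu u(2) s] by simp
      finally have "exp (- 1) / 4 * ell \<le> (\<Sum>\<^sub>\<infinity>\<tau>. cmod (?w \<tau>))" using inc by simp
      then have "real n * (exp (- 1) / 4 * ell) \<le> nrm (X n) * (\<Sum>\<^sub>\<infinity>\<tau>. cmod (?w \<tau>))"
        using nrmX(1)[OF n] l n1 nrm_pos[of "X n"] by (intro mult_mono) auto
      moreover have "real n * (exp (- 1) / 4 * ell) = c" using n1 by (simp add: ell_def c_def)
      ultimately show ?thesis by simp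
    qed
    ultimately show ?thesis by blast
  qed
  have "\<forall>n. \<exists>w. n \<in> N \<longrightarrow> (\<forall>\<tau>. cmod (Lxi (X n) w \<tau>) \<le> 2 * exp (- \<delta> * \<omega> (nrm (join \<tau> (X n))))) \<and>
      (\<forall>C \<epsilon>. 0 < C \<longrightarrow> C * exp (- \<epsilon> * \<omega> (nrm (X n))) \<le> cmod (exp (- 1 * (2 * of_real pi * \<i> * Zx (X n))) - 1) \<longrightarrow>
        (\<forall>\<tau>. cmod (w \<tau>) \<le> 2 * pi / C * exp (\<epsilon> * \<omega> (nrm (X n))))) \<and>
      ((\<lambda>\<tau>. cmod (w \<tau>)) summable_on UNIV \<longrightarrow> c \<le> nrm (X n) * (\<Sum>\<^sub>\<infinity>\<tau>. cmod (w \<tau>)))"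
    using main by blast
  then obtain w' where w': "\<And>n \<tau>. n \<in> N \<Longrightarrow> cmod (Lxi (X n) (w' n) \<tau>) \<le> 2 * exp (- \<delta> * \<omega> (nrm (join \<tau> (X n))))"
    "\<And>n C \<epsilon> \<tau>. n \<in> N \<Longrightarrow> 0 < C \<Longrightarrow> C * exp (- \<epsilon> * \<omega> (nrm (X n))) \<le> cmod (exp (- 1 * (2 * of_real pi * \<i> * Zx (X n))) - 1) \<Longrightarrow>
        cmod (w' n \<tau>) \<le> 2 * pi / C * exp (\<epsilon> * \<omega> (nrm (X n)))"
    "\<And>n. n \<in> N \<Longrightarrow> (\<lambda>\<tau>. cmod (w' n \<tau>)) summable_on UNIV \<Longrightarrow> c \<le> nrm (X n) * (\<Sum>\<^sub>\<infinity>\<tau>. cmod (w' n \<tau>))"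
    using choice[of "\<lambda>n w. n \<in> N \<longrightarrow> _ n w"] by metis
  have injX: "inj X" using j0 by (auto simp: inj_def X_def fun_eq_iff)
  define w where "w \<zeta> = w' (inv X \<zeta>)" for \<zeta>
  have wX: "w (X n) = w' n" for n by (simp add: w_def injX)
  have "quasi_solutions (X ` N) w"
    unfolding quasi_solutions_def
  proof (intro conjI allI impI)
    show "infinite (X ` N)" using infN injX by (simp add: finite_image_iff inj_on_subset)
    fix \<epsilon> :: real assume e: "0 < \<epsilon>"
    obtain C where C: "C > 0" "\<And>\<xi> \<sigma>. (\<exists>j. \<xi> j \<noteq> 0) \<Longrightarrow> \<sigma> \<in> {1, -1} \<Longrightarrow>
         C * exp (- \<epsilon> * \<omega> (nrm \<xi>)) \<le> cmod (exp (\<sigma> * (2 * of_real pi * \<i> * Zx \<xi>)) - 1)"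
      using EDC_exp_bound[OF EDC e] by blast
    have "cmod (w (X n) \<tau>) \<le> 2 * pi / C * exp (\<epsilon> * \<omega> (nrm (X n)))" if n: "n \<in> N" for n \<tau>
    proof -
      have "X n j0 \<noteq> 0" using j0 n by (simp add: X_def N_def)
      then have "C * exp (- \<epsilon> * \<omega> (nrm (X n))) \<le> cmod (exp (- 1 * (2 * of_real pi * \<i> * Zx (X n))) - 1)"
        by (intro C(2)) auto
      then show ?thesis unfolding wX by (rule w'(2)[OF n C(1)])
    qed
    then show "\<exists>C\<ge>0. \<forall>\<xi>\<in>X ` N. \<forall>\<tau>. cmod (w \<xi> \<tau>) \<le> C * exp (\<epsilon> * \<omega> (nrm \<xi>))"
      using C(1) by (intro exI[of _ "2 * pi / C"]) auto
  next
    show "\<exists>C \<delta>. 0 \<le> C \<and> 0 < \<delta> \<and> (\<forall>\<xi>\<in>X ` N. \<forall>\<tau>. cmod (Lxi \<xi> (w \<xi>) \<tau>) \<le> C * exp (- \<delta> * \<omega> (nrm (join \<tau> \<xi>))))"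
      using w'(1) d(1) by (intro exI[of _ 2] exI[of _ \<delta>]) (auto simp: wX)
    show "\<exists>c>0. \<forall>\<xi>\<in>X ` N. (\<lambda>\<tau>. cmod (w \<xi> \<tau>)) summable_on UNIV \<longrightarrow> c \<le> nrm \<xi> * (\<Sum>\<^sub>\<infinity>\<tau>. cmod (w \<xi> \<tau>))"
      using w'(3) c by (intro exI[of _ c]) (auto simp: wX)
  qed
  then show ?thesis by blast
qed

text \<open>If <\<xi>, b> has positive mean, \<xi> is replaced by its negative; the sign change
  provides a positive value for that one too.\<close>

lemma quasi_solutions_if_not_conditions:
  assumes "\<not> ((\<forall>j. \<not> changes_sign (b j)) \<and> (\<exists>g::real \<Rightarrow> real. \<forall>j. \<exists>c::real. b j = (\<lambda>t. c * g t)) \<and>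
             EDC1 \<omega> (\<lambda>j. mean_T1 (a j)) (\<lambda>j. mean_T1 (b j)))"
  shows "\<exists>\<Xi> w. quasi_solutions \<Xi> w"
proof (cases "EDC1 \<omega> (\<lambda>j. mean_T1 (a j)) (\<lambda>j. mean_T1 (b j))")
  case True
  then have "\<not> ((\<forall>j. \<not> changes_sign (b j)) \<and> (\<exists>g::real \<Rightarrow> real. \<forall>j. \<exists>c::real. b j = (\<lambda>t. c * g t)))"
    using assms by blast
  then obtain \<xi> s t where st: "Im (px \<xi> s) > 0" "Im (px \<xi> t) < 0"
    by (rule integer_combination_changes_sign)
  show ?thesis
  proof (cases "Im (Zx \<xi>) \<le> 0")
    case False
    have "Im (px (\<lambda>j. - 1 * \<xi> j) t) > 0" "Im (Zx (\<lambda>j. - 1 * \<xi> j)) \<le> 0"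
      unfolding px_scale Zx_scale using False st(2) by simp_all
    then show ?thesis by (rule quasi_solutions_if_changes_sign[OF True])
  qed (rule quasi_solutions_if_changes_sign[OF True st(1)])
qed (rule quasi_solutions_if_not_EDC)

end

text \<open>Dimension at most one of the span is expressed by a common function g of which all b_j
  are real multiples. The equivalences follow by cases: under the conditions both properties hold,
  and otherwise one family of quasi-solutions refutes both.\<close>

theorem theorem2p3:
  fixes \<omega> :: "real \<Rightarrow> real"
    and a b :: "'n::finite \<Rightarrow> real \<Rightarrow> real"
  assumes "weight_function \<omega>" and "subadditive_weight \<omega>"
    and "\<And>j. lift_T1 (a j) \<in> E_roumieu \<omega>"
    and "\<And>j. lift_T1 (b j) \<in> E_roumieu \<omega>"
  shows "(strongly_solvable \<omega> a b \<longleftrightarrow> globally_hypoelliptic \<omega> a b) \<and>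
         (globally_hypoelliptic \<omega> a b \<longleftrightarrow>
            ((\<forall>j. \<not> changes_sign (b j)) \<and>
             (\<exists>g::real \<Rightarrow> real. \<forall>j. \<exists>c::real. b j = (\<lambda>t. c * g t)) \<and>
             EDC1 \<omega> (\<lambda>j. mean_T1 (a j)) (\<lambda>j. mean_T1 (b j))))"
proof -
  interpret vector_field \<omega> a b using assms by unfold_locales
  show ?thesis
  proof (cases "(\<forall>j. \<not> changes_sign (b j)) \<and> (\<exists>g::real \<Rightarrow> real. \<forall>j. \<exists>c::real. b j = (\<lambda>t. c * g t)) \<and>
             EDC1 \<omega> (\<lambda>j. mean_T1 (a j)) (\<lambda>j. mean_T1 (b j))")
    case True
    then obtain g c where g: "\<And>j. b j = (\<lambda>t. c j * g t)" by metis
    have onto using True by (intro onto_if_conditions Im_px_sign[OF _ g]) auto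
    then show ?thesis using True hypoelliptic_if_onto solvable_if_onto by blast
  next
    case False
    then show ?thesis using quasi_solutions_if_not_conditions not_hypoelliptic not_solvable by blast
  qed
qed

end
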